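(* Let $\mathfrak g$ be a real solvable Lie algebra of dimension $2n$ whose nilradical $\mathfrak h$ has codimension $2$, and let $(J,\langle\cdot,\cdot\rangle)$ be an almost Hermitian structure on $\mathfrak g$ such that $J\mathfrak h=\mathfrak h$. Let $\{U,JU\}$ be an orthonormal basis of $\mathfrak h^\perp$ (with respect to $\langle\cdot,\cdot\rangle$), and set $A:=\mathrm{ad}_U|_{\mathfrak h}$, $B:=\mathrm{ad}_{JU}|_{\mathfrak h}$. Let $J_{\mathfrak h}$ and $\langle\cdot,\cdot\rangle_{\mathfrak h}$ be the restrictions of $J$ and $\langle\cdot,\cdot\rangle$ to $\mathfrak h$. Then: (i) $J$ is integrable if and only if $J_{\mathfrak h}$ is a complex structure on $\mathfrak h$ (i.e. integrable) and $$[J_{\mathfrak h},A]J_{\mathfrak h}+[J_{\mathfrak h},B]=0.$$ (ii) If $J$ is integrable, then the Hermitian Lie algebra $(\mathfrak g,J,\langle\cdot,\cdot\rangle)$ is Chern Ricci flat. (iii) If $J$ is integrable, $\mathfrak g$ is unimodular and $[U,JU]=0$, then $(J,\langle\cdot,\cdot\rangle)$ is balanced if and only if $(J_{\mathfrak h},\langle\cdot,\cdot\rangle_{\mathfrak h})$ is balanced. (iv) If $J$ is integrable and the Hermitian Lie algebra $(\mathfrak g,J,\langle\cdot,\cdot\rangle)$ is SKT, then $\mathfrak h$ is at most $2$-step nilpotent and the restrictions $A_{\mathfrak z(\mathfrak h)},B_{\mathfrak z(\mathfrak h)}$ of $A$ and $B$ to the center $\mathfrak z(\mathfrak h)$ of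 $\mathfrak h$ satisfy $$A_{\mathfrak z(\mathfrak h)},\,B_{\mathfrak z(\mathfrak h)}\in\mathfrak{so}(\mathfrak z(\mathfrak h)),\qquad [A_{\mathfrak z(\mathfrak h)},J_{\mathfrak z(\mathfrak h)}]=[B_{\mathfrak z(\mathfrak h)},J_{\mathfrak z(\mathfrak h)}]=0.$$
   Context: All Lie algebras are real and finite-dimensional. The nilradical is the maximal nilpotent ideal. An almost Hermitian structure on a Lie algebra $\mathfrak g$ is a pair $(J,\langle\cdot,\cdot\rangle)$ with $J\in\mathrm{End}(\mathfrak g)$, $J^2=-\mathrm{Id}$, and $\langle\cdot,\cdot\rangle$ an inner product with $\langle JX,JY\rangle=\langle X,Y\rangle$. $J$ is integrable (a complex structure) if its Nijenhuis tensor $N(X,Y)=[X,Y]+J([JX,Y]+[X,JY])-[JX,JY]$ vanishes; then $(\mathfrak g,J,\langle\cdot,\cdot\rangle)$ is called Hermitian. Fundamental form: $\omega=\langle J\cdot,\cdot\rangle$. The differential $d$ is the Chevalley–Eilenberg differential, i.e. $d\alpha(X,Y)=-\alpha([X,Y])$ for $\alpha\in\mathfrak g^*$, extended as a graded derivation. Bismut torsion: $c(X,Y,Z)=d\omega(JX,JY,JZ)$. A Hermitian structure is SKT if $dc=0$. On a Lie algebra of dimension $2m$, a Hermitian structure is balanced if $d\omega^{m-1}=0$ (for $\mathfrak h$, of dimension $2n-2$, this means $d_{\mathfrak h}\omega_{\mathfrak h}^{n-2}=0$, with $d_{\mathfrak h}$ the Chevalley–Eilenberg differential of $\mathfrak h$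 and $\omega_{\mathfrak h}=\omega|_{\mathfrak h}$). Chern Ricci flat means that the Chern–Ricci form $\rho^{Ch}$ (the Ricci form of the Chern connection of the associated left-invariant Hermitian structure on the simply connected Lie group with Lie algebra $\mathfrak g$, i.e. up to convention $\rho^{Ch}(X,Y)=\frac12\mathrm{tr}(J\circ R^{Ch}(X,Y))$) vanishes. The Chern connection is the unique Hermitian connection ($\nabla g=0$, $\nabla J=0$) with $\nabla^{0,1}=\overline\partial$. $\mathfrak{so}(\mathfrak z(\mathfrak h))$ is the space of endomorphisms of $\mathfrak z(\mathfrak h)$ that are skew-symmetric with respect to the restriction of $\langle\cdot,\cdot\rangle$; derivations of $\mathfrak h$ preserve $\mathfrak z(\mathfrak h)$, so the restrictions of $A,B$ are endomorphisms of $\mathfrak z(\mathfrak h)$. $J_{\mathfrak z(\mathfrak h)}$ is the restriction of $J$ to $\mathfrak z(\mathfrak h)$ (which is $J$-invariant in the situation of (iv)). $[\cdot,\cdot]$ between endomorphisms is the commutator. *)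

theory Defs
  imports "HOL-Analysis.Analysis"
begin

text \<open>
  A real finite-dimensional Lie algebra with an inner product is a bracket \<open>br\<close> on a type
  of class \<open>euclidean_space\<close>, whose inner product \<open>(\<bullet>)\<close> is the metric.
  Subalgebras are carrier sets \<open>V\<close> with the same bracket, and an endomorphism of a
  subspace \<open>V\<close> is a function of which only the values on \<open>V\<close> matter; the whole Lie
  algebra is the carrier \<open>UNIV\<close>.
\<close>


subsection \<open>Lie algebras\<close>

definition lie_algebra :: "('a::euclidean_space \<Rightarrow> 'a \<Rightarrow> 'a) \<Rightarrow> bool" where
  "lie_algebra br \<longleftrightarrow> bilinear br \<and> (\<forall>x. br x x = 0) \<and>
     (\<forall>x y z. br x (br y z) + br y (br z x) + br z (br x y) = 0)"

definition lie_ideal :: "('a::euclidean_space \<Rightarrow> 'a \<Rightarrow> 'a) \<Rightarrow> 'a set \<Rightarrow> bool" where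
  "lie_ideal br I \<longleftrightarrow> subspace I \<and> (\<forall>x. \<forall>y\<in>I. br x y \<in> I)"

primrec derived_series ::
    "('a::euclidean_space \<Rightarrow> 'a \<Rightarrow> 'a) \<Rightarrow> 'a set \<Rightarrow> nat \<Rightarrow> 'a set" where
  "derived_series br V 0 = V"
| "derived_series br V (Suc k) =
     span {br x y | x y. x \<in> derived_series br V k \<and> y \<in> derived_series br V k}"

primrec lower_central_series ::
    "('a::euclidean_space \<Rightarrow> 'a \<Rightarrow> 'a) \<Rightarrow> 'a set \<Rightarrow> nat \<Rightarrow> 'a set" where
  "lower_central_series br V 0 = V"
| "lower_central_series br V (Suc k) =
     span {br x y | x y. x \<in> V \<and> y \<in> lower_central_series br V k}"

definition lie_solvable :: "('a::euclidean_space \<Rightarrow> 'a \<Rightarrow> 'a) \<Rightarrow> 'a set \<Rightarrow> bool" where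
  "lie_solvable br V \<longleftrightarrow> (\<exists>k. derived_series br V k = {0})"

definition at_most_step_nilpotent ::
    "('a::euclidean_space \<Rightarrow> 'a \<Rightarrow> 'a) \<Rightarrow> 'a set \<Rightarrow> nat \<Rightarrow> bool" where
  "at_most_step_nilpotent br V k \<longleftrightarrow> lower_central_series br V k = {0}"

definition lie_nilpotent :: "('a::euclidean_space \<Rightarrow> 'a \<Rightarrow> 'a) \<Rightarrow> 'a set \<Rightarrow> bool" where
  "lie_nilpotent br V \<longleftrightarrow> (\<exists>k. at_most_step_nilpotent br V k)"

definition is_nilradical :: "('a::euclidean_space \<Rightarrow> 'a \<Rightarrow> 'a) \<Rightarrow> 'a set \<Rightarrow> bool" where
  "is_nilradical br h \<longleftrightarrow> lie_ideal br h \<and> lie_nilpotent br h \<and>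
     (\<forall>I. lie_ideal br I \<and> lie_nilpotent br I \<longrightarrow> I \<subseteq> h)"

definition lie_center :: "('a::euclidean_space \<Rightarrow> 'a \<Rightarrow> 'a) \<Rightarrow> 'a set \<Rightarrow> 'a set" where
  "lie_center br V = {x\<in>V. \<forall>y\<in>V. br x y = 0}"

text \<open>The library's \<open>trace\<close> is for matrices only.\<close>

definition endo_trace :: "('a::euclidean_space \<Rightarrow> 'a) \<Rightarrow> real" where
  "endo_trace f = (\<Sum>b\<in>Basis. f b \<bullet> b)"

definition unimodular :: "('a::euclidean_space \<Rightarrow> 'a \<Rightarrow> 'a) \<Rightarrow> bool" where
  "unimodular br \<longleftrightarrow> (\<forall>x. endo_trace (br x) = 0)"


subsection \<open>Endomorphisms of subspaces\<close>

definition endo_on :: "'a::euclidean_space set \<Rightarrow> ('a \<Rightarrow> 'a) \<Rightarrow> bool" where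
  "endo_on V f \<longleftrightarrow> (\<forall>x\<in>V. f x \<in> V) \<and> (\<forall>x\<in>V. \<forall>y\<in>V. f (x + y) = f x + f y) \<and>
     (\<forall>c. \<forall>x\<in>V. f (c *\<^sub>R x) = c *\<^sub>R f x)"

definition commutator :: "('a::euclidean_space \<Rightarrow> 'a) \<Rightarrow> ('a \<Rightarrow> 'a) \<Rightarrow> 'a \<Rightarrow> 'a" where
  "commutator f g = (\<lambda>x. f (g x) - g (f x))"

definition so_on :: "'a::euclidean_space set \<Rightarrow> ('a \<Rightarrow> 'a) set" where
  "so_on V = {f. endo_on V f \<and> (\<forall>x\<in>V. \<forall>y\<in>V. f x \<bullet> y = - (x \<bullet> f y))}"


subsection \<open>Almost Hermitian and complex structures\<close>

definition almost_complex_on :: "'a::euclidean_space set \<Rightarrow> ('a \<Rightarrow> 'a) \<Rightarrow> bool" where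
  "almost_complex_on V J \<longleftrightarrow> endo_on V J \<and> (\<forall>x\<in>V. J (J x) = - x)"

definition almost_hermitian_on :: "'a::euclidean_space set \<Rightarrow> ('a \<Rightarrow> 'a) \<Rightarrow> bool" where
  "almost_hermitian_on V J \<longleftrightarrow> almost_complex_on V J \<and> (\<forall>x\<in>V. \<forall>y\<in>V. J x \<bullet> J y = x \<bullet> y)"

definition nijenhuis ::
    "('a::euclidean_space \<Rightarrow> 'a \<Rightarrow> 'a) \<Rightarrow> ('a \<Rightarrow> 'a) \<Rightarrow> 'a \<Rightarrow> 'a \<Rightarrow> 'a" where
  "nijenhuis br J X Y = br X Y + J (br (J X) Y + br X (J Y)) - br (J X) (J Y)"

definition complex_structure_on ::
    "('a::euclidean_space \<Rightarrow> 'a \<Rightarrow> 'a) \<Rightarrow> 'a set \<Rightarrow> ('a \<Rightarrow> 'a) \<Rightarrow> bool" where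
  "complex_structure_on br V J \<longleftrightarrow> almost_complex_on V J \<and>
     (\<forall>X\<in>V. \<forall>Y\<in>V. nijenhuis br J X Y = 0)"

definition hermitian_on ::
    "('a::euclidean_space \<Rightarrow> 'a \<Rightarrow> 'a) \<Rightarrow> 'a set \<Rightarrow> ('a \<Rightarrow> 'a) \<Rightarrow> bool" where
  "hermitian_on br V J \<longleftrightarrow> almost_hermitian_on V J \<and> complex_structure_on br V J"


subsection \<open>Exterior forms and the Chevalley--Eilenberg differential\<close>

text \<open>
  A \<open>k\<close>-form is a function on argument lists, of which only the values on lists of length
  \<open>k\<close> with entries in the carrier matter. The differential is
  \[ d\alpha(x_0,\ldots,x_k) = \sum_{i<j} (-1)^{i+j}
       \alpha([x_i,x_j],x_0,\ldots,\widehat{x_i},\ldots,\widehat{x_j},\ldots,x_k), \]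
  which on \<open>1\<close>-forms is \<open>d\<alpha>(X,Y) = -\<alpha>([X,Y])\<close> and is a graded derivation for the
  wedge product normalised by \<open>1/(p! q!)\<close> below.
\<close>

type_synonym 'a form = "'a list \<Rightarrow> real"

definition ce_d :: "('a::euclidean_space \<Rightarrow> 'a \<Rightarrow> 'a) \<Rightarrow> 'a form \<Rightarrow> 'a form" where
  "ce_d br \<alpha> xs =
     (\<Sum>j<length xs. \<Sum>i<j. (- 1) ^ (i + j) * \<alpha> (br (xs ! i) (xs ! j) # nths xs (- {i, j})))"

lemma ce_d_1: "ce_d br \<alpha> [X, Y] = - \<alpha> [br X Y]"
  by (simp add: ce_d_def nths_Cons numeral_2_eq_2)

lemma ce_d_2: "ce_d br \<alpha> [X, Y, Z] = - \<alpha> [br X Y, Z] + \<alpha> [br X Z, Y] - \<alpha> [br Y Z, X]"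
  by (simp add: ce_d_def nths_Cons eval_nat_numeral lessThan_Suc)

definition form_vanishes_on :: "'a::euclidean_space set \<Rightarrow> nat \<Rightarrow> 'a form \<Rightarrow> bool" where
  "form_vanishes_on V k \<alpha> \<longleftrightarrow> (\<forall>xs. length xs = k \<and> set xs \<subseteq> V \<longrightarrow> \<alpha> xs = 0)"

text \<open>\<open>wedge p q \<alpha> \<beta>\<close> is the wedge product of a \<open>p\<close>-form \<open>\<alpha>\<close> and a \<open>q\<close>-form \<open>\<beta>\<close>.\<close>

definition wedge :: "nat \<Rightarrow> nat \<Rightarrow> 'a::euclidean_space form \<Rightarrow> 'a form \<Rightarrow> 'a form" where
  "wedge p q \<alpha> \<beta> xs =
     (\<Sum>\<sigma> | \<sigma> permutes {..<p + q}. of_int (sign \<sigma>) *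
        \<alpha> (map (\<lambda>i. xs ! \<sigma> i) [0..<p]) * \<beta> (map (\<lambda>i. xs ! \<sigma> i) [p..<p + q]))
     / (fact p * fact q)"

text \<open>\<open>wedge_power p \<alpha> k\<close> is the \<open>k\<close>-th wedge power of the \<open>p\<close>-form \<open>\<alpha>\<close>,
  a form of degree \<open>k * p\<close>.\<close>

primrec wedge_power :: "nat \<Rightarrow> 'a::euclidean_space form \<Rightarrow> nat \<Rightarrow> 'a form" where
  "wedge_power p \<alpha> 0 = (\<lambda>xs. 1)"
| "wedge_power p \<alpha> (Suc k) = wedge p (k * p) \<alpha> (wedge_power p \<alpha> k)"

definition fundamental_form :: "('a::euclidean_space \<Rightarrow> 'a) \<Rightarrow> 'a form" where
  "fundamental_form J xs = J (xs ! 0) \<bullet> (xs ! 1)"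

definition bismut_torsion ::
    "('a::euclidean_space \<Rightarrow> 'a \<Rightarrow> 'a) \<Rightarrow> ('a \<Rightarrow> 'a) \<Rightarrow> 'a form" where
  "bismut_torsion br J xs = ce_d br (fundamental_form J) (map J xs)"

definition skt_on ::
    "('a::euclidean_space \<Rightarrow> 'a \<Rightarrow> 'a) \<Rightarrow> 'a set \<Rightarrow> ('a \<Rightarrow> 'a) \<Rightarrow> bool" where
  "skt_on br V J \<longleftrightarrow> hermitian_on br V J \<and>
     form_vanishes_on V 4 (ce_d br (bismut_torsion br J))"

text \<open>Here \<open>dim V = 2 * m\<close>. For \<open>m = 1\<close> the form is the constant \<open>0\<close>-form \<open>1\<close>,
  whose differential vanishes.\<close>

definition balanced_on ::
    "('a::euclidean_space \<Rightarrow> 'a \<Rightarrow> 'a) \<Rightarrow> 'a set \<Rightarrow> ('a \<Rightarrow> 'a) \<Rightarrow> bool" where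
  "balanced_on br V J \<longleftrightarrow> hermitian_on br V J \<and>
     (let m = dim V div 2 in
        form_vanishes_on V (2 * (m - 1) + 1)
          (ce_d br (wedge_power 2 (fundamental_form J) (m - 1))))"


subsection \<open>The Chern connection\<close>

text \<open>
  Elements \<open>x + iy\<close> of the complexification are pairs \<open>(x, y)\<close>. \<open>cx_ext\<close> is the
  complex-bilinear extension; \<open>type10\<close> and \<open>type01\<close> are the eigenspaces of \<open>J\<close> for
  \<open>i\<close> and \<open>-i\<close>; \<open>proj10\<close> is the projection \<open>(1 - iJ)/2\<close> onto \<open>type10\<close>.
\<close>

definition cx_ext :: "('a::euclidean_space \<Rightarrow> 'a \<Rightarrow> 'a) \<Rightarrow> 'a \<times> 'a \<Rightarrow> 'a \<times> 'a \<Rightarrow> 'a \<times> 'a" where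
  "cx_ext f z w = (f (fst z) (fst w) - f (snd z) (snd w), f (fst z) (snd w) + f (snd z) (fst w))"

definition type10 :: "('a::euclidean_space \<Rightarrow> 'a) \<Rightarrow> ('a \<times> 'a) set" where
  "type10 J = {(x, - J x) | x. True}"

definition type01 :: "('a::euclidean_space \<Rightarrow> 'a) \<Rightarrow> ('a \<times> 'a) set" where
  "type01 J = {(x, J x) | x. True}"

definition proj10 :: "('a::euclidean_space \<Rightarrow> 'a) \<Rightarrow> 'a \<times> 'a \<Rightarrow> 'a \<times> 'a" where
  "proj10 J z = ((1 / 2) *\<^sub>R (fst z + J (snd z)), (1 / 2) *\<^sub>R (snd z - J (fst z)))"

text \<open>
  A left-invariant connection is its bilinear map \<open>D X Y = \<nabla>\<^sub>X Y\<close> on left-invariant fields,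
  on which the metric is constant. The Dolbeault operator of the holomorphic tangent bundle is
  the \<open>(1,0)\<close>-part of \<open>[W, Z]\<close>, for \<open>W\<close> of type \<open>(0,1)\<close> and \<open>Z\<close> of type \<open>(1,0)\<close>,
  so the last conjunct says that the \<open>(0,1)\<close>-part of \<open>\<nabla>\<close> is the Dolbeault operator.
\<close>

definition is_chern_connection ::
    "('a::euclidean_space \<Rightarrow> 'a \<Rightarrow> 'a) \<Rightarrow> ('a \<Rightarrow> 'a) \<Rightarrow> ('a \<Rightarrow> 'a \<Rightarrow> 'a) \<Rightarrow> bool" where
  "is_chern_connection br J D \<longleftrightarrow> bilinear D \<and>
     (\<forall>X Y Z. D X Y \<bullet> Z + Y \<bullet> D X Z = 0) \<and>
     (\<forall>X Y. D X (J Y) = J (D X Y)) \<and>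
     (\<forall>W\<in>type01 J. \<forall>Z\<in>type10 J. cx_ext D W Z = proj10 J (cx_ext br W Z))"

definition chern_connection ::
    "('a::euclidean_space \<Rightarrow> 'a \<Rightarrow> 'a) \<Rightarrow> ('a \<Rightarrow> 'a) \<Rightarrow> 'a \<Rightarrow> 'a \<Rightarrow> 'a" where
  "chern_connection br J = (THE D. is_chern_connection br J D)"

lemma chern_connection_unique:
  assumes J: "almost_hermitian_on UNIV J"
    and D: "is_chern_connection br J D" and D': "is_chern_connection br J D'"
  shows "D = D'"
proof -
  have JJ: "J (J x) = - x" and Jlin: "J (x + y) = J x + J y" "J (c *\<^sub>R x) = c *\<^sub>R J x"
    and Ji: "J x \<bullet> J y = x \<bullet> y" for x y c
    using J by (auto simp: almost_hermitian_on_def almost_complex_on_def endo_on_def)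
  have Jm: "J (- x) = - J x" for x using Jlin(2)[of "-1" x] by simp
  have Jd: "J (x - y) = J x - J y" for x y using Jlin(1)[of x "-y"] Jm by simp
  have Jsk: "J x \<bullet> y = - (x \<bullet> J y)" for x y using Ji[of x "J y"] JJ by simp
  define S where "S X Y = D X Y - D' X Y" for X Y
  have bD: "bilinear D" "bilinear D'" using D D' by (auto simp: is_chern_connection_def)
  have a: "S X Y \<bullet> Z = - (Y \<bullet> S X Z)" for X Y Z
  proof -
    have "D X Y \<bullet> Z + Y \<bullet> D X Z = 0" "D' X Y \<bullet> Z + Y \<bullet> D' X Z = 0"
      using D D' by (auto simp: is_chern_connection_def)
    then show ?thesis by (simp add: S_def algebra_simps inner_diff_left inner_diff_right)
  qed
  have b: "S X (J Y) = J (S X Y)" for X Y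
    using D D' by (auto simp: is_chern_connection_def S_def Jd)
  have c: "S X Y = - J (S (J X) Y)" for X Y
  proof -
    have "cx_ext D (X, J X) (Y, - J Y) = cx_ext D' (X, J X) (Y, - J Y)"
      using D D' by (auto simp: is_chern_connection_def type01_def type10_def)
    then have "D X Y - D (J X) (- J Y) = D' X Y - D' (J X) (- J Y)"
      by (simp add: cx_ext_def)
    moreover have "D (J X) (- J Y) = - J (D (J X) Y)" "D' (J X) (- J Y) = - J (D' (J X) Y)"
      using D D' bilinear_rneg[OF bD(1)] bilinear_rneg[OF bD(2)]
      by (auto simp: is_chern_connection_def)
    ultimately show ?thesis by (simp add: S_def Jd algebra_simps)
  qed
  have "S X Y = 0" for X Y
  proof -
    have 1: "S X Y \<bullet> Z = Y \<bullet> S X Z" for Z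
    proof -
      have "S X Y \<bullet> Z = - (J (S (J X) Y) \<bullet> Z)" by (subst c) simp
      also have "\<dots> = S (J X) Y \<bullet> J Z" by (simp add: Jsk)
      also have "\<dots> = - (Y \<bullet> J (S (J X) Z))" by (simp add: a b)
      also have "\<dots> = Y \<bullet> S X Z" by (subst (2) c) simp
      finally show ?thesis .
    qed
    have "S X Y \<bullet> S X Y = 0" using a[of X Y "S X Y"] 1[of "S X Y"] by linarith
    then show ?thesis by simp
  qed
  then show ?thesis by (intro ext) (simp add: S_def)
qed

lemma chern_connection_exists:
  assumes L: "bilinear br" "\<forall>x. br x x = 0" and J: "hermitian_on br UNIV J"
  shows "\<exists>D. is_chern_connection br J D"
proof -
  have JJ: "J (J x) = - x" and Jlin: "J (x + y) = J x + J y" "J (c *\<^sub>R x) = c *\<^sub>R J x"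
    and Ji: "J x \<bullet> J y = x \<bullet> y" and N: "nijenhuis br J x y = 0" for x y c
    using J by (auto simp: almost_hermitian_on_def almost_complex_on_def endo_on_def
       hermitian_on_def complex_structure_on_def)
  have Jm: "J (- x) = - J x" for x using Jlin(2)[of "-1" x] by simp
  have Jd: "J (x - y) = J x - J y" for x y using Jlin(1)[of x "-y"] Jm by simp
  have Jsk: "J x \<bullet> y = - (x \<bullet> J y)" for x y using Ji[of x "J y"] JJ by simp
  note bl = bilinear_ladd[OF L(1)] bilinear_radd[OF L(1)] bilinear_lmul[OF L(1)] bilinear_rmul[OF L(1)]
     bilinear_lneg[OF L(1)] bilinear_rneg[OF L(1)]
  define F where "F X Y = (1/2) *\<^sub>R (br X Y + J (br (J X) Y))" for X Y
  have linF: "linear (F X)" for X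
    by (rule linearI) (simp_all add: F_def bl Jlin algebra_simps)
  have FJ: "F X (J Y) = J (F X Y)" for X Y
  proof -
    have "br X Y + J (br (J X) Y + br X (J Y)) - br (J X) (J Y) = 0"
      using N[of X Y] by (simp add: nijenhuis_def)
    then have "J (br X Y + J (br (J X) Y + br X (J Y)) - br (J X) (J Y)) = J 0" by simp
    moreover have "J 0 = 0" using Jlin(2)[of 0 0] by simp
    ultimately show ?thesis by (simp add: F_def Jlin Jd JJ algebra_simps)
  qed
  have FJl: "F (J X) Y = - J (F X Y)" for X Y
    by (simp add: F_def Jlin JJ Jm bl algebra_simps)
  define G where "G X = adjoint (F X)" for X
  have G: "G X Y \<bullet> Z = Y \<bullet> F X Z" for X Y Z
    by (simp add: G_def adjoint_clauses[OF linF])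
  have ext: "x = y" if "\<And>z. x \<bullet> z = y \<bullet> z" for x y :: 'a
    using that vector_eq_rdot by blast
  have Fl: "F (X + X') Y = F X Y + F X' Y" "F (c *\<^sub>R X) Y = c *\<^sub>R F X Y" for X X' Y c
    by (simp_all add: F_def bl Jlin algebra_simps)
  have GJ: "G X (J Y) = J (G X Y)" for X Y
    by (rule ext) (simp add: G Jsk FJ)
  have GJl: "G (J X) Y = J (G X Y)" for X Y
    by (rule ext) (simp add: G Jsk FJ FJl)
  define D where "D X Y = F X Y - G X Y" for X Y
  have "bilinear D"
    unfolding bilinear_def
  proof (intro conjI allI)
    show "linear (D X)" for X
      unfolding D_def G_def using linF adjoint_linear[OF linF] by (intro linear_compose_sub) auto
    show "linear (\<lambda>X. D X Y)" for Y
    proof (rule linearI)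
      have "G (X + X') Y = G X Y + G X' Y" for X X'
        by (rule ext) (simp add: G Fl inner_add_left inner_add_right)
      then show "D (X + X') Y = D X Y + D X' Y" for X X' by (simp add: D_def Fl)
      have "G (c *\<^sub>R X) Y = c *\<^sub>R G X Y" for c X by (rule ext) (simp add: G Fl)
      then show "D (c *\<^sub>R X) Y = c *\<^sub>R D X Y" for c X by (simp add: D_def Fl algebra_simps)
    qed
  qed
  moreover have "D X Y \<bullet> Z + Y \<bullet> D X Z = 0" for X Y Z
    by (simp add: D_def inner_diff_left inner_diff_right G inner_commute[of Y "G X Z"])
       (simp add: inner_commute)
  moreover have DJ: "D X (J Y) = J (D X Y)" for X Y
    by (simp add: D_def FJ GJ Jd)
  moreover have "cx_ext D W Z = proj10 J (cx_ext br W Z)"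
    if "W \<in> type01 J" "Z \<in> type10 J" for W Z
  proof -
    from that obtain X Y where W: "W = (X, J X)" and Z: "Z = (Y, - J Y)"
      by (auto simp: type01_def type10_def)
    have Dneg: "D X (- Y) = - D X Y" for X Y using bilinear_rneg[OF \<open>bilinear D\<close>] .
    have DD: "D X Y + J (D (J X) Y) = 2 *\<^sub>R F X Y"
      by (simp add: D_def Jd FJl GJl Jm JJ scaleR_2)
    have "br X Y + J (br (J X) Y + br X (J Y)) - br (J X) (J Y) = 0"
      using N[of X Y] by (simp add: nijenhuis_def)
    then have Neq: "br (J X) (J Y) = br X Y + J (br (J X) Y) + J (br X (J Y))"
      by (simp add: Jlin algebra_simps)
    have 1: "fst (cx_ext D W Z) = 2 *\<^sub>R F X Y"
      using DD by (simp add: cx_ext_def W Z Dneg DJ)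
    have 2: "snd (cx_ext D W Z) = - J (2 *\<^sub>R F X Y)"
      using DD[symmetric] by (simp add: cx_ext_def W Z Dneg DJ Jlin JJ)
    have 3: "fst (proj10 J (cx_ext br W Z)) = 2 *\<^sub>R F X Y"
      by (simp add: proj10_def cx_ext_def W Z bl F_def Neq Jlin Jd Jm algebra_simps)
         (simp add: scaleR_add_left[symmetric])?
    have 4: "snd (proj10 J (cx_ext br W Z)) = - J (2 *\<^sub>R F X Y)"
      by (simp add: proj10_def cx_ext_def W Z bl F_def Neq Jlin Jd Jm JJ algebra_simps)
         (simp add: scaleR_add_left[symmetric])?
    show ?thesis using 1 2 3 4 by (simp add: prod_eq_iff)
  qed
  ultimately have "is_chern_connection br J D" by (simp add: is_chern_connection_def)
  then show ?thesis by blast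
qed

lemma is_chern_connection_chern_connection:
  assumes "bilinear br" "\<forall>x. br x x = 0" "hermitian_on br UNIV J"
  shows "is_chern_connection br J (chern_connection br J)"
proof -
  obtain D where D: "is_chern_connection br J D"
    using chern_connection_exists[OF assms] by blast
  have J: "almost_hermitian_on UNIV J"
    using assms(3) by (simp add: hermitian_on_def)
  have "(THE D. is_chern_connection br J D) = D"
    by (rule the_equality[where P = "is_chern_connection br J", OF D])
       (rule chern_connection_unique[OF J _ D])
  with D show ?thesis
    by (simp only: chern_connection_def)
qed

definition curvature ::
    "('a::euclidean_space \<Rightarrow> 'a \<Rightarrow> 'a) \<Rightarrow> ('a \<Rightarrow> 'a \<Rightarrow> 'a) \<Rightarrow> 'a \<Rightarrow> 'a \<Rightarrow> 'a \<Rightarrow> 'a" where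
  "curvature br D X Y Z = D X (D Y Z) - D Y (D X Z) - D (br X Y) Z"

definition chern_ricci_form ::
    "('a::euclidean_space \<Rightarrow> 'a \<Rightarrow> 'a) \<Rightarrow> ('a \<Rightarrow> 'a) \<Rightarrow> 'a \<Rightarrow> 'a \<Rightarrow> real" where
  "chern_ricci_form br J X Y =
     (1 / 2) * endo_trace (J \<circ> curvature br (chern_connection br J) X Y)"

definition chern_ricci_flat ::
    "('a::euclidean_space \<Rightarrow> 'a \<Rightarrow> 'a) \<Rightarrow> ('a \<Rightarrow> 'a) \<Rightarrow> bool" where
  "chern_ricci_flat br J \<longleftrightarrow> (\<forall>X Y. chern_ricci_form br J X Y = 0)"

end

theory Submission
  imports Defs
begin

text \<open>
  Write \<open>F\<^sub>X = ad\<^sub>X + J ad\<^bsub>JX\<^esub>\<close>, \<open>V = JU\<close> and \<open>C\<^sub>i\<close> for the lower central series of the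
  algebra at hand, so that \<open>C\<^sub>0\<close> is the algebra itself.

  \<^bold>\<open>Integrability.\<close> The Nijenhuis tensor vanishes identically on \<open>(U, V)\<close>, satisfies
  \<open>N(V, X) = - J N(U, X)\<close>, and on \<open>(U, X)\<close> with \<open>X \<in> \<hh>\<close> it is the displayed expression in \<open>A\<close>, \<open>B\<close>.

  \<^bold>\<open>The derived algebra.\<close> The bracket of \<open>U\<close> and \<open>V\<close> lies in \<open>\<hh>\<close>
  (\<open>nilradical_contains_derived\<close>). Otherwise \<open>Z = [U, V]\<close> and some \<open>W\<close> satisfy \<open>[W, Z] = Z\<close> modulo
  \<open>\<hh>\<close>; on each quotient \<open>C\<^sub>i / C\<^sub>i\<^sub>+\<^sub>1\<close> of \<open>\<hh>\<close> the induced operators satisfy \<open>wz - zw = z\<close>, which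
  forces \<open>z\<close> to be nilpotent, so that \<open>\<hh> + \<real>Z\<close> is a nilpotent ideal larger than the nilradical.

  \<^bold>\<open>Chern--Ricci flatness.\<close> The Chern--Ricci form is
  \<open>\<rho>(X, Y) = - tr (J F\<^bsub>[X,Y]\<^esub>) / 2\<close> (\<open>chern_ricci_form_eq\<close>). For \<open>Z\<close> in the nilradical \<open>F\<^sub>Z\<close> is the
  map induced by the nilpotent map \<open>ad\<close> of \<open>Z + iJZ\<close> on the quotient of the complexification by the
  subalgebra of vectors of type \<open>(0,1)\<close>. Hence \<open>F\<^sub>Z\<close> is nilpotent, and so is \<open>J F\<^sub>Z\<close>, since
  \<open>J\<close> commutes with \<open>F\<^sub>Z\<close>.

  \<^bold>\<open>Balanced metrics.\<close> With \<open>\<omega> = \<omega>\<^sub>\<hh> + u \<and> v\<close>, where \<open>u\<close>, \<open>v\<close> are the closed \<open>1\<close>-forms dual to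
  \<open>U\<close>, \<open>V\<close>, one has \<open>\<omega>\<^bsup>n-1\<^esup> = \<omega>\<^sub>\<hh>\<^bsup>n-1\<^esup> + (n-1) \<omega>\<^sub>\<hh>\<^bsup>n-2\<^esup> \<and> u \<and> v\<close>. The first summand is a volume form
  of \<open>\<hh>\<close>, closed by unimodularity and \<open>[U, V] = 0\<close>; the differential of the second is
  \<open>(n-1) d\<^sub>\<hh>\<omega>\<^sub>\<hh>\<^bsup>n-2\<^esup> \<and> u \<and> v\<close>. Forms are handled through their contractions: the wedge product is a
  graded derivation under contraction (\<open>wedge_Cons\<close>), the differential obeys Cartan's formula
  (\<open>ce_d_Cons\<close>), and an alternating form is determined by its values on argument lists that are
  adapted to a chain of subspaces (\<open>alternating_vanish_insert\<close>).

  \<^bold>\<open>SKT metrics.\<close> Closedness of the torsion \<open>c\<close> is used through a few well-chosen arguments.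

  \<^item> For \<open>x\<close> central in a nilpotent SKT algebra, \<open>dc(x, Jx, y, Jy) = 0\<close> makes \<open>ad\<^bsub>Jx\<^esub>\<close> vanish on
    \<open>C\<^sub>i\<close> once it vanishes on \<open>C\<^sub>i\<^sub>+\<^sub>1\<close>. So the centre is \<open>J\<close>-invariant (\<open>J_center\<close>).

  \<^item> On the centre of an ideal, \<open>dc(U, V, x, Jx) = 0\<close> summed over an orthonormal basis is the
    equality case of Cauchy--Schwarz and gives \<open>A\<^sup>T = JAJ\<close>, \<open>B\<^sup>T = JBJ\<close>. As \<open>A\<close> and \<open>B\<close> commute
    there, the trace of \<open>J[A, B]\<close> shows that their symmetric parts vanish (\<open>skew_on_abelian\<close>).

  \<^item> A nilpotent SKT algebra \<open>\<hh>\<close> is at most \<open>2\<close>-step (\<open>skt_nilpotent_two_step\<close>), by induction on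
    the dimension. The ideal \<open>\<rr> = C\<^sub>1 + J C\<^sub>1\<close> is proper (\<open>J_closure_proper\<close>), hence at most
    \<open>2\<close>-step. Elements of \<open>\<hh>\<close> act on the centre of \<open>\<rr>\<close> by maps that are both skew and
    nilpotent, so this centre is central in \<open>\<hh>\<close>. Then
    \<open>N = {x \<in> \<rr>. [x, \<hh>] \<subseteq> \<zz>(\<rr>)}\<close> turns out to be \<open>J\<close>-invariant and to commute with \<open>C\<^sub>1\<close> and \<open>J C\<^sub>1\<close>,
    so \<open>N = \<zz>(\<rr>)\<close>, which by nilpotency forces \<open>\<rr> = \<zz>(\<rr>)\<close>, central in \<open>\<hh>\<close>.
\<close>

section \<open>Lie algebras and their lower central series\<close>

declare lower_central_series.simps(2) [simp del]

locale lie_alg =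
  fixes br :: "'a::euclidean_space \<Rightarrow> 'a \<Rightarrow> 'a"
  assumes lie: "lie_algebra br"
begin

lemma bilinear_br: "bilinear br"
  using lie by (simp add: lie_algebra_def)

lemmas br_simps = bilinear_ladd[OF bilinear_br] bilinear_radd[OF bilinear_br]
  bilinear_lmul[OF bilinear_br] bilinear_rmul[OF bilinear_br]
  bilinear_lneg[OF bilinear_br] bilinear_rneg[OF bilinear_br]
  bilinear_lzero[OF bilinear_br] bilinear_rzero[OF bilinear_br]
  bilinear_lsub[OF bilinear_br] bilinear_rsub[OF bilinear_br]

lemma br_self [simp]: "br x x = 0"
  using lie by (simp add: lie_algebra_def)

lemma br_anti: "br x y = - br y x"
proof -
  have "br (x + y) (x + y) = 0" by (rule br_self)
  then have "br x y + br y x = 0" by (simp only: br_simps) (simp add: add.commute)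
  then show ?thesis by (metis eq_neg_iff_add_eq_0)
qed

lemma jacobi: "br x (br y z) = br (br x y) z + br y (br x z)"
proof -
  have "br x (br y z) + br y (br z x) + br z (br x y) = 0"
    using lie by (simp add: lie_algebra_def)
  moreover have "br y (br z x) = - br y (br x z)"
    by (subst br_anti[of z x]) (simp add: br_simps)
  moreover have "br z (br x y) = - br (br x y) z" by (rule br_anti)
  ultimately show ?thesis by (simp add: algebra_simps)
qed

lemma linear_br_right: "linear (br x)"
  using bilinear_br by (simp add: bilinear_def)

lemma subspace_lower_central_series:
  "subspace V \<Longrightarrow> subspace (lower_central_series br V k)"
  by (cases k) (auto simp: lower_central_series.simps)

lemma br_in_lower_central_series:
  "x \<in> V \<Longrightarrow> y \<in> lower_central_series br V k \<Longrightarrow> br x y \<in> lower_central_series br V (Suc k)"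
  unfolding lower_central_series.simps(2) by (intro span_base) blast

lemma lower_central_series_Suc_subset:
  assumes "subspace T" "\<And>x y. x \<in> V \<Longrightarrow> y \<in> lower_central_series br V k \<Longrightarrow> br x y \<in> T"
  shows "lower_central_series br V (Suc k) \<subseteq> T"
  unfolding lower_central_series.simps(2) by (rule span_minimal) (use assms in auto)

lemma lower_central_series_decreasing:
  assumes "subspace V" "\<And>x y. x \<in> V \<Longrightarrow> y \<in> V \<Longrightarrow> br x y \<in> V"
  shows "lower_central_series br V (Suc k) \<subseteq> lower_central_series br V k"
proof (induction k)
  case 0
  show ?case using assms by (intro lower_central_series_Suc_subset) auto
next
  case (Suc k)
  show ?case
    using assms(1) Suc.IH br_in_lower_central_series[of _ V _ k]
    by (intro lower_central_series_Suc_subset[where k = "Suc k"] subspace_lower_central_series) blast+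
qed

lemma lower_central_series_subset:
  assumes "subspace V" "\<And>x y. x \<in> V \<Longrightarrow> y \<in> V \<Longrightarrow> br x y \<in> V"
  shows "lower_central_series br V k \<subseteq> V"
proof (induction k)
  case (Suc k)
  then show ?case using lower_central_series_decreasing[OF assms, of k] by blast
qed simp

lemma lower_central_series_mono:
  assumes "W \<subseteq> V"
  shows "lower_central_series br W k \<subseteq> lower_central_series br V k"
proof (induction k)
  case (Suc k)
  then show ?case using assms unfolding lower_central_series.simps(2) by (intro span_mono) blast
qed (use assms in simp)

lemma lie_ideal_lower_central_series:
  assumes "lie_ideal br I"
  shows "lie_ideal br (lower_central_series br I k)"
proof (induction k)
  case 0
  then show ?case using assms by simp
next
  case (Suc k)
  have sI: "subspace I" using assms by (simp add: lie_ideal_def)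
  have sub: "subspace (lower_central_series br I (Suc k))"
    using sI by (rule subspace_lower_central_series)
  have "lower_central_series br I (Suc k) \<subseteq> {y. br x y \<in> lower_central_series br I (Suc k)}" for x
  proof (rule lower_central_series_Suc_subset)
    show "subspace {y. br x y \<in> lower_central_series br I (Suc k)}"
      using linear_subspace_vimage[OF linear_br_right sub] by (simp add: vimage_def)
    fix a b assume a: "a \<in> I" and b: "b \<in> lower_central_series br I k"
    have "br (br x a) b \<in> lower_central_series br I (Suc k)"
      using assms a b by (intro br_in_lower_central_series) (auto simp: lie_ideal_def)
    moreover have "br a (br x b) \<in> lower_central_series br I (Suc k)"
      using Suc a b by (intro br_in_lower_central_series) (auto simp: lie_ideal_def)
    ultimately show "br a b \<in> {y. br x y \<in> lower_central_series br I (Suc k)}"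
      using subspace_add[OF sub] by (simp add: jacobi[of x a b])
  qed
  then show ?case using sub unfolding lie_ideal_def by blast
qed

lemma lie_ideal_closed: "lie_ideal br I \<Longrightarrow> x \<in> I \<Longrightarrow> br x y \<in> I"
  using br_anti[of x y] subspace_neg by (auto simp: lie_ideal_def)

end

section \<open>The derived algebra lies in the nilradical\<close>

lemma linear_funpow: "linear (f ^^ k)" if "linear f" for f :: "'a::real_vector \<Rightarrow> 'a"
  by (induction k) (auto simp: linear_ident intro: linear_compose[OF _ that, unfolded o_def])

text \<open>
  The relation propagates to \<open>w z\<^sup>k - z\<^sup>k w = k z\<^sup>k\<close>. In operator norm this gives
  \<open>k |z\<^sup>k| \<le> 2 |w| |z\<^sup>k|\<close>, which for \<open>k > 2 |w|\<close> leaves only \<open>z\<^sup>k = 0\<close>.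
\<close>

lemma linear_commutator_self_imp_nilpotent:
  fixes w z :: "'a::euclidean_space \<Rightarrow> 'a"
  assumes w: "linear w" and z: "linear z"
    and comm: "\<And>x. w (z x) - z (w x) = z x"
  shows "\<exists>N. \<forall>x. (z ^^ N) x = 0"
proof -
  have lin: "linear (z ^^ k)" for k by (rule linear_funpow[OF z])
  have key: "w ((z ^^ k) x) - (z ^^ k) (w x) = real k *\<^sub>R (z ^^ k) x" for k x
  proof (induction k)
    case (Suc k)
    have "w (z ((z ^^ k) x)) = z (w ((z ^^ k) x)) + z ((z ^^ k) x)"
      using comm[of "(z ^^ k) x"] by (simp add: algebra_simps)
    moreover have "w ((z ^^ k) x) = (z ^^ k) (w x) + real k *\<^sub>R (z ^^ k) x"
      using Suc by (simp add: algebra_simps)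
    ultimately show ?case
      by (simp add: linear_add[OF z] linear_cmul[OF z] algebra_simps)
  qed simp
  obtain N :: nat where N: "2 * onorm w < real N" using reals_Archimedean2 by blast
  have bw: "bounded_linear w" and bN: "bounded_linear (z ^^ N)"
    using w lin by (auto simp: linear_conv_bounded_linear)
  let ?f = "\<lambda>x. w ((z ^^ N) x)" and ?g = "\<lambda>x. (z ^^ N) (w x)"
  have "real N * onorm (z ^^ N) = onorm (\<lambda>x. real N *\<^sub>R (z ^^ N) x)"
    by (simp add: onorm_scaleR[OF bN])
  also have "(\<lambda>x. real N *\<^sub>R (z ^^ N) x) = (\<lambda>x. ?f x + - ?g x)"
    using key[of N] by (intro ext) simp
  also have "onorm (\<lambda>x. ?f x + - ?g x) \<le> onorm ?f + onorm (\<lambda>x. - ?g x)"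
    by (intro onorm_triangle bounded_linear_minus bounded_linear_compose[OF bw bN]
         bounded_linear_compose[OF bN bw])
  also have "\<dots> \<le> onorm w * onorm (z ^^ N) + onorm (z ^^ N) * onorm w"
    using onorm_compose[OF bw bN] onorm_compose[OF bN bw] by (intro add_mono) (simp_all add: onorm_neg o_def)
  finally have "(real N - 2 * onorm w) * onorm (z ^^ N) \<le> 0" by (simp add: algebra_simps)
  moreover have "0 \<le> onorm (z ^^ N)" by (rule onorm_pos_le[OF bN])
  ultimately have "onorm (z ^^ N) = 0"
    using N by (auto simp: mult_le_0_iff)
  then show ?thesis using onorm_eq_0[OF bN] by blast
qed

lemma subspace_projection_exists:
  fixes V :: "'a::euclidean_space set"
  assumes "subspace V"
  obtains P where "linear P" "\<And>x. P x \<in> V" "\<And>x. x \<in> V \<Longrightarrow> P x = x"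
proof -
  have "\<exists>g. g ` (UNIV :: 'a set) \<subseteq> V \<and> linear g \<and> (\<forall>v\<in>V. g (id v) = v)"
    by (rule linear_exists_left_inverse_on[OF linear_id assms]) simp
  then show ?thesis using that by auto
qed

text \<open>
  The quotient \<open>V / V'\<close> is modelled inside the ambient space: with projections \<open>R\<close> onto \<open>V\<close> and
  \<open>Q\<close> onto \<open>V'\<close>, the assignment \<open>f \<mapsto> (1 - Q) f R\<close> is multiplicative on maps that preserve \<open>V\<close>
  and \<open>V'\<close>, so the commutator relation modulo \<open>V'\<close> becomes an exact one.
\<close>

lemma nilpotent_on_quotient:
  fixes w z :: "'a::euclidean_space \<Rightarrow> 'a"
  assumes w: "linear w" and z: "linear z" and V: "subspace V" and V': "subspace V'" "V' \<subseteq> V"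
    and pres: "w ` V \<subseteq> V" "z ` V \<subseteq> V" "w ` V' \<subseteq> V'" "z ` V' \<subseteq> V'"
    and comm: "\<And>x. x \<in> V \<Longrightarrow> w (z x) - z (w x) - z x \<in> V'"
  shows "\<exists>N. \<forall>x\<in>V. (z ^^ N) x \<in> V'"
proof -
  obtain R where R: "linear R" "\<And>x. R x \<in> V" "\<And>x. x \<in> V \<Longrightarrow> R x = x"
    using subspace_projection_exists[OF V] by blast
  obtain Q where Q: "linear Q" "\<And>x. Q x \<in> V'" "\<And>x. x \<in> V' \<Longrightarrow> Q x = x"
    using subspace_projection_exists[OF V'(1)] by blast
  define T where "T f x = f (R x) - Q (f (R x))" for f :: "'a \<Rightarrow> 'a" and x
  have linT: "linear (T f)" if "linear f" for f
    unfolding T_def using linear_compose[OF R(1) that] linear_compose[OF linear_compose[OF R(1) that] Q(1)]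
    by (auto simp: o_def intro!: linear_compose_sub)
  have mult: "T f (T g x) = T (f \<circ> g) x"
    if "linear f" "f ` V \<subseteq> V" "f ` V' \<subseteq> V'" "g ` V \<subseteq> V" for f g x
  proof -
    let ?y = "g (R x)"
    have y: "?y \<in> V" using that(4) R(2) by blast
    have "?y - Q ?y \<in> V" using y Q(2) V'(2) by (auto intro!: subspace_diff[OF V])
    then have "T f (T g x) = f (?y - Q ?y) - Q (f (?y - Q ?y))" by (simp add: T_def R(3))
    moreover have "Q (f (Q ?y)) = f (Q ?y)" using Q(2) Q(3) that(3) by blast
    ultimately show ?thesis
      by (simp add: T_def linear_diff[OF that(1)] linear_diff[OF Q(1)])
  qed
  have "T w (T z x) - T z (T w x) = T z x" for x
  proof -
    have "w (z (R x)) - z (w (R x)) - z (R x) \<in> V'" using comm R(2) by blast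
    from Q(3)[OF this] linear_add[OF Q(1)]
    have "T (w \<circ> z) x - T (z \<circ> w) x = T z x"
      by (simp add: T_def linear_diff[OF Q(1)] algebra_simps)
    then show ?thesis using mult[of w z x] mult[of z w x] w z pres by simp
  qed
  then obtain N where N: "\<And>x. (T z ^^ N) x = 0"
    using linear_commutator_self_imp_nilpotent[OF linT[OF w] linT[OF z]] by blast
  have zV: "(z ^^ k) x \<in> V" if "x \<in> V" for k x
    using that pres(2) by (induction k) auto
  have pw: "(T z ^^ k) x = (z ^^ k) x - Q ((z ^^ k) x)" if "x \<in> V" "k > 0" for k x
    using that(2)
  proof (induction k)
    case (Suc k)
    show ?case
    proof (cases "k = 0")
      case True
      then show ?thesis using that(1) by (simp add: T_def R(3))
    next
      case False
      let ?y = "(z ^^ k) x"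
      have "?y - Q ?y \<in> V" using zV[OF that(1)] Q(2) V'(2) by (auto intro!: subspace_diff[OF V])
      moreover have "Q (z (Q ?y)) = z (Q ?y)" using Q(2) Q(3) pres(4) by blast
      ultimately show ?thesis using Suc False
        by (simp add: T_def R(3) linear_diff[OF z] linear_diff[OF Q(1)])
    qed
  qed simp
  have "(z ^^ Suc N) x \<in> V'" if "x \<in> V" for x
  proof -
    have "(T z ^^ Suc N) x = 0" using N linear_0[OF linT[OF z]] by simp
    then have "(z ^^ Suc N) x = Q ((z ^^ Suc N) x)" using pw[OF that, of "Suc N"] by simp
    then show ?thesis using Q(2) by metis
  qed
  then show ?thesis by blast
qed

context lie_alg
begin

text \<open>
  If \<open>Z = [u, v]\<close> were outside \<open>h\<close>, the quotient by \<open>h\<close> would be the nonabelian algebra of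
  dimension two and a suitable \<open>W\<close> would satisfy \<open>[W, Z] = Z\<close> modulo \<open>h\<close>. Since \<open>h\<close> acts trivially
  on each \<open>C\<^sub>i / C\<^sub>i\<^sub>+\<^sub>1\<close>, \<open>Z\<close> acts nilpotently there, which makes the ideal \<open>h + \<real>Z\<close> nilpotent and
  contradicts the maximality of \<open>h\<close>.
\<close>

lemma nilradical_contains_derived:
  assumes nil: "is_nilradical br h" and dec: "\<And>x. \<exists>y\<in>h. \<exists>a b. x = y + a *\<^sub>R u + b *\<^sub>R v"
  shows "br x y \<in> h"
proof -
  have idl: "lie_ideal br h" and hn: "lie_nilpotent br h" 
    and hmax: "\<And>I. lie_ideal br I \<Longrightarrow> lie_nilpotent br I \<Longrightarrow> I \<subseteq> h"
    using nil by (auto simp: is_nilradical_def)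
  have sh: "subspace h" using idl by (simp add: lie_ideal_def)
  note hI = lie_ideal_closed[OF idl]
  have hI': "br x y \<in> h" if "y \<in> h" for x y using idl that by (simp add: lie_ideal_def)
  let ?Z = "br u v"
  have Zh: "?Z \<in> h"
  proof (rule ccontr)
    assume "?Z \<notin> h"
    obtain y a b where Z: "?Z = y + a *\<^sub>R u + b *\<^sub>R v" and y: "y \<in> h" using dec by blast
    have ab: "a \<noteq> 0 \<or> b \<noteq> 0" using \<open>?Z \<notin> h\<close> y Z by auto
    have uZ: "br u ?Z - b *\<^sub>R ?Z \<in> h" and vZ: "br v ?Z + a *\<^sub>R ?Z \<in> h"
    proof -
      have "br u ?Z = br u y + b *\<^sub>R ?Z" by (subst Z) (simp add: br_simps)
      then show "br u ?Z - b *\<^sub>R ?Z \<in> h" using hI'[OF y] by simp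
      have "br v ?Z = br v y - a *\<^sub>R ?Z"
        by (subst Z) (simp add: br_simps br_anti[of v u])
      then show "br v ?Z + a *\<^sub>R ?Z \<in> h" using hI'[OF y] by simp
    qed
    obtain W where W: "br W ?Z - ?Z \<in> h"
    proof (cases "b = 0")
      case False
      have "br ((1/b) *\<^sub>R u) ?Z - ?Z = (1/b) *\<^sub>R (br u ?Z - b *\<^sub>R ?Z)"
        using False by (simp add: br_simps algebra_simps)
      then show ?thesis using that subspace_scale[OF sh uZ] by metis
    next
      case True
      have "br ((-1/a) *\<^sub>R v) ?Z - ?Z = (-1/a) *\<^sub>R (br v ?Z + a *\<^sub>R ?Z)"
        using True ab by (simp add: br_simps algebra_simps)
      then show ?thesis using that subspace_scale[OF sh vZ] by metis
    qed
    let ?C = "lower_central_series br h"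
    let ?z = "br ?Z"
    define h' where "h' = {x + c *\<^sub>R ?Z | x c. x \<in> h}"
    have Ci: "lie_ideal br (?C i)" for i using lie_ideal_lower_central_series[OF idl] .
    have sC: "subspace (?C i)" for i using Ci by (simp add: lie_ideal_def)
    have CI: "br x y \<in> ?C i" if "y \<in> ?C i" for x y i using Ci that by (auto simp: lie_ideal_def)
    have decr: "?C (Suc i) \<subseteq> ?C i" for i
      using lower_central_series_decreasing[OF sh] hI' by blast
    have h'I: "x + c *\<^sub>R ?Z \<in> h'" if "x \<in> h" for x c using that by (auto simp: h'_def)
    have sh': "subspace h'"
    proof -
      have "h' = {x + y | x y. x \<in> h \<and> y \<in> span {?Z}}"
        by (auto simp: h'_def span_singleton)
      then show ?thesis using subspace_sums[OF sh subspace_span, of "{?Z}"] by simp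
    qed
    have gZ: "br g ?Z \<in> h'" for g
    proof -
      obtain p c d where g: "g = p + c *\<^sub>R u + d *\<^sub>R v" "p \<in> h" using dec by blast
      have "br g ?Z = (br p ?Z + c *\<^sub>R (br u ?Z - b *\<^sub>R ?Z) + d *\<^sub>R (br v ?Z + a *\<^sub>R ?Z))
         + (c * b - d * a) *\<^sub>R ?Z"
        by (simp add: g br_simps algebra_simps)
      then show ?thesis using hI[OF g(2)] uZ vZ by (metis h'I sh subspace_add subspace_scale)
    qed
    have idl': "lie_ideal br h'"
      unfolding lie_ideal_def
    proof (intro conjI sh' allI ballI)
      fix g q assume "q \<in> h'"
      then obtain p c where q: "q = p + c *\<^sub>R ?Z" "p \<in> h" by (auto simp: h'_def)
      have "br g q = (br g p + 0 *\<^sub>R ?Z) + c *\<^sub>R br g ?Z" by (simp add: q br_simps)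
      then show "br g q \<in> h'" using h'I[OF hI'[OF q(2)]] gZ by (metis sh' subspace_add subspace_scale)
    qed
    \<comment> \<open>the commutator of \<open>ad W\<close> and \<open>ad Z\<close> differs from \<open>ad Z\<close> by the bracket with an element of \<open>h\<close>\<close>
    have nilstep: "\<exists>N. \<forall>x\<in>?C i. (?z ^^ N) x \<in> ?C (Suc i)" for i
    proof (rule nilpotent_on_quotient[where w = "br W"])
      show "br W (?z x) - ?z (br W x) - ?z x \<in> ?C (Suc i)" if "x \<in> ?C i" for x
      proof -
        have "br W (?z x) - ?z (br W x) - ?z x = br (br W ?Z - ?Z) x"
          by (simp add: jacobi[of W ?Z x] br_simps)
        then show ?thesis using br_in_lower_central_series[OF W that] by simp
      qed
    qed (use CI sC linear_br_right decr in auto)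
    have C1: "lower_central_series br h' 1 \<subseteq> h"
      unfolding One_nat_def
    proof (rule lower_central_series_Suc_subset[OF sh])
      fix p q assume "p \<in> h'" "q \<in> lower_central_series br h' 0"
      then obtain p' c q' d where pq: "p = p' + c *\<^sub>R ?Z" "q = q' + d *\<^sub>R ?Z" "p' \<in> h" "q' \<in> h"
        by (auto simp: h'_def)
      have "br p' q' \<in> h" "br ?Z q' \<in> h" "br p' ?Z \<in> h" using pq hI hI' by blast+
      then show "br p q \<in> h"
        by (auto simp: pq br_simps intro!: subspace_add[OF sh] subspace_scale[OF sh])
    qed
    have "\<exists>N. lower_central_series br h' N \<subseteq> ?C i" for i
    proof (induction i)
      case 0
      show ?case using C1 by (intro exI[of _ 1]) (simp del: One_nat_def)
    next
      case (Suc i)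
      then obtain N where N: "lower_central_series br h' N \<subseteq> ?C i" by blast
      obtain m where m: "\<And>x. x \<in> ?C i \<Longrightarrow> (?z ^^ m) x \<in> ?C (Suc i)" using nilstep by blast
      \<comment> \<open>brackets with \<open>h'\<close> either raise the power of \<open>ad Z\<close> or land in \<open>C (Suc i)\<close>\<close>
      define T where "T k = {(?z ^^ k) x + y | x y. x \<in> ?C i \<and> y \<in> ?C (Suc i)}" for k
      have linzk: "linear (?z ^^ k)" for k
        by (rule linear_funpow[OF linear_br_right])
      have sT: "subspace (T k)" for k
      proof -
        have "T k = {x + y | x y. x \<in> (?z ^^ k) ` ?C i \<and> y \<in> ?C (Suc i)}"
          unfolding T_def by blast
        then show ?thesis
          using subspace_sums[OF linear_subspace_image[OF linzk sC] sC, of k i "Suc i"] by simp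
      qed
      have zkC: "(?z ^^ k) x \<in> ?C i" if "x \<in> ?C i" for k x
        using that CI by (induction k) auto
      have "lower_central_series br h' (N + k) \<subseteq> T k" for k
      proof (induction k)
        case 0
        have "?C i \<subseteq> T 0" unfolding T_def using subspace_0[OF sC[of "Suc i"]] by force
        then show ?case using N by simp
      next
        case (Suc k)
        show ?case unfolding add_Suc_right
        proof (rule lower_central_series_Suc_subset[OF sT])
          fix p q assume p: "p \<in> h'" and q: "q \<in> lower_central_series br h' (N + k)"
          obtain p' c where p': "p = p' + c *\<^sub>R ?Z" "p' \<in> h" using p by (auto simp: h'_def)
          obtain x y where xy: "q = (?z ^^ k) x + y" "x \<in> ?C i" "y \<in> ?C (Suc i)"
            using q Suc by (auto simp: T_def)
          have "br p q = (?z ^^ Suc k) (c *\<^sub>R x) + (br p' ((?z ^^ k) x) + br p y)"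
            by (simp add: p' xy br_simps linear_cmul[OF linzk] algebra_simps)
          moreover have "c *\<^sub>R x \<in> ?C i" using xy sC subspace_scale by blast
          moreover have "br p' ((?z ^^ k) x) + br p y \<in> ?C (Suc i)"
            using br_in_lower_central_series[OF p'(2) zkC[OF xy(2)]] CI[OF xy(3)] sC subspace_add by blast
          ultimately show "br p q \<in> T (Suc k)" unfolding T_def by blast
        qed
      qed
      then have "lower_central_series br h' (N + m) \<subseteq> T m" .
      also have "T m \<subseteq> ?C (Suc i)" unfolding T_def using m subspace_add[OF sC[of "Suc i"]] by blast
      finally show ?case by blast
    qed
    moreover obtain k where "?C k = {0}"
      using hn by (auto simp: lie_nilpotent_def at_most_step_nilpotent_def)
    ultimately obtain N where "lower_central_series br h' N \<subseteq> {0}" by metis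
    then have "lower_central_series br h' N = {0}"
      using subspace_0[OF subspace_lower_central_series[OF sh']] by blast
    then have "lie_nilpotent br h'" by (auto simp: lie_nilpotent_def at_most_step_nilpotent_def)
    from hmax[OF idl' this] have "?Z \<in> h"
      using h'I[OF subspace_0[OF sh], of 1] by auto
    with \<open>?Z \<notin> h\<close> show False by simp
  qed
  obtain p a b q c d where "x = p + a *\<^sub>R u + b *\<^sub>R v" "y = q + c *\<^sub>R u + d *\<^sub>R v" "p \<in> h" "q \<in> h"
    using dec by metis
  moreover have "br v u \<in> h" using Zh br_anti[of v u] subspace_neg[OF sh] by metis
  moreover have "br z p \<in> h" "br p z \<in> h" "br z q \<in> h" "br q z \<in> h" for z
    using calculation hI hI' by blast+
  ultimately show ?thesis using Zh
    by (auto simp: br_simps intro!: subspace_add[OF sh] subspace_scale[OF sh])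
qed

end

section \<open>Traces of nilpotent maps\<close>

lemma endo_trace_comm:
  fixes f g :: "'a::euclidean_space \<Rightarrow> 'a"
  assumes f: "linear f" and g: "linear g"
  shows "endo_trace (\<lambda>x. f (g x)) = endo_trace (\<lambda>x. g (f x))"
proof -
  have *: "endo_trace (\<lambda>x. p (q x)) = (\<Sum>b\<in>Basis. \<Sum>c\<in>Basis. (q b \<bullet> c) * (p c \<bullet> b))"
    if "linear p" for p q :: "'a \<Rightarrow> 'a"
    unfolding endo_trace_def
  proof (rule sum.cong[OF refl])
    fix b :: 'a
    have "p (q b) = p (\<Sum>c\<in>Basis. (q b \<bullet> c) *\<^sub>R c)" by (simp add: euclidean_representation)
    also have "\<dots> = (\<Sum>c\<in>Basis. (q b \<bullet> c) *\<^sub>R p c)"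
      by (simp add: linear_sum[OF that] linear_cmul[OF that])
    finally show "p (q b) \<bullet> b = (\<Sum>c\<in>Basis. (q b \<bullet> c) * (p c \<bullet> b))"
      by (simp add: inner_sum_left)
  qed
  show ?thesis unfolding *[OF f] *[OF g]
    by (subst sum.swap) (simp add: mult.commute)
qed

text \<open>
  With a projection \<open>P\<close> onto the range of \<open>f\<close> one has \<open>tr f = tr (P f) = tr (f P)\<close>, and
  \<open>(f P)\<^sup>k = f\<^sup>k P\<close> vanishes one power earlier than \<open>f\<close> does.
\<close>

lemma endo_trace_nilpotent:
  fixes f :: "'a::euclidean_space \<Rightarrow> 'a"
  assumes "linear f" "\<And>x. (f ^^ k) x = 0"
  shows "endo_trace f = 0"
  using assms
proof (induction k arbitrary: f)
  case 0
  then have "\<And>x::'a. x = 0" by simp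
  then show ?case unfolding endo_trace_def by (metis inner_zero_right sum.neutral)
next
  case (Suc k)
  show ?case
  proof (cases "k = 0")
    case True
    then show ?thesis using Suc.prems(2) by (simp add: endo_trace_def)
  next
    case False
    obtain P where P: "linear P" "\<And>x. P x \<in> range f" "\<And>x. x \<in> range f \<Longrightarrow> P x = x"
      using subspace_projection_exists[OF linear_subspace_image[OF Suc.prems(1) subspace_UNIV]] by blast
    let ?g = "\<lambda>x. f (P x)"
    have "(?g ^^ j) x = (f ^^ j) (if j = 0 then x else P x)" for j x
    proof (induction j)
      case (Suc j)
      have "P ((f ^^ j) (P x)) = (f ^^ j) (P x)" 
      proof (rule P(3))
        show "(f ^^ j) (P x) \<in> range f" using P(2)[of x] by (cases j) auto
      qed
      then show ?case using Suc by (cases j) auto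
    qed simp
    moreover have "(f ^^ k) (P x) = 0" for x
    proof -
      obtain y where "P x = f y" using P(2) by blast
      then show ?thesis using Suc.prems(2)[of y] by (simp only: funpow_Suc_right o_apply)
    qed
    ultimately have "(?g ^^ k) x = 0" for x using \<open>k \<noteq> 0\<close> by simp
    then have "endo_trace ?g = 0"
      using Suc.IH[of ?g] linear_compose[OF P(1) Suc.prems(1)] by (simp add: o_def)
    also have "endo_trace ?g = endo_trace (\<lambda>x. P (f x))" by (rule endo_trace_comm[OF Suc.prems(1) P(1)])
    also have "(\<lambda>x. P (f x)) = f" using P(3) by auto
    finally show ?thesis .
  qed
qed

lemma endo_trace_nilpotent_compose:
  fixes f g :: "'a::euclidean_space \<Rightarrow> 'a"
  assumes f: "linear f" and g: "linear g" and comm: "\<And>x. f (g x) = g (f x)" and nil: "\<And>x. (f ^^ k) x = 0"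
  shows "endo_trace (\<lambda>x. g (f x)) = 0"
proof (rule endo_trace_nilpotent)
  show "linear (\<lambda>x. g (f x))" using linear_compose[OF f g] by (simp add: o_def)
  have c: "f ((g ^^ j) x) = (g ^^ j) (f x)" for j x by (induction j) (simp_all add: comm)
  have "((\<lambda>x. g (f x)) ^^ j) x = (g ^^ j) ((f ^^ j) x)" for j x
    by (induction j) (simp_all add: c)
  moreover have "(g ^^ k) 0 = 0" by (rule linear_0[OF linear_funpow[OF g]])
  ultimately show "((\<lambda>x. g (f x)) ^^ k) x = 0" for x using nil by simp
qed

section \<open>Almost Hermitian structures and integrability\<close>

locale almost_herm_lie = lie_alg br for br :: "'a::euclidean_space \<Rightarrow> 'a \<Rightarrow> 'a" +
  fixes J :: "'a \<Rightarrow> 'a"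
  assumes almost_hermitian: "almost_hermitian_on UNIV J"
begin

lemma JJ [simp]: "J (J x) = - x"
  and J_add: "J (x + y) = J x + J y"
  and J_scale: "J (c *\<^sub>R x) = c *\<^sub>R J x"
  and J_inner [simp]: "J x \<bullet> J y = x \<bullet> y"
  using almost_hermitian
  by (auto simp: almost_hermitian_on_def almost_complex_on_def endo_on_def)

lemma linear_J: "linear J"
  by (rule linearI) (simp_all add: J_add J_scale)

lemmas J_simps = J_add J_scale linear_neg[OF linear_J] linear_diff[OF linear_J] linear_0[OF linear_J]

lemma J_skew: "J x \<bullet> y = - (x \<bullet> J y)"
  using J_inner[of x "J y"] by simp

lemma norm_J [simp]: "norm (J x) = norm x"
  by (simp add: norm_eq_sqrt_inner)

lemma nijenhuis_simps:
  "nijenhuis br J (x + x') y = nijenhuis br J x y + nijenhuis br J x' y"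
  "nijenhuis br J x (y + y') = nijenhuis br J x y + nijenhuis br J x y'"
  "nijenhuis br J (c *\<^sub>R x) y = c *\<^sub>R nijenhuis br J x y"
  "nijenhuis br J x (c *\<^sub>R y) = c *\<^sub>R nijenhuis br J x y"
  by (simp_all add: nijenhuis_def br_simps J_simps algebra_simps)

lemma nijenhuis_anti: "nijenhuis br J x y = - nijenhuis br J y x"
  by (simp add: nijenhuis_def br_anti[of x y] br_anti[of "J x"] br_anti[of x "J y"] J_simps)

lemma nijenhuis_J_left: "nijenhuis br J (J x) y = - J (nijenhuis br J x y)"
  by (simp add: nijenhuis_def br_simps J_simps)

lemma nijenhuis_plane: "nijenhuis br J x x = 0" "nijenhuis br J x (J x) = 0"
  using br_anti[of x "J x"] by (simp_all add: nijenhuis_def br_simps J_simps)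

text \<open>
  By bilinearity and \<open>N(Ju, x) = - J N(u, x)\<close> only the values on \<open>h\<close> and those with first argument
  \<open>u\<close> matter.
\<close>

lemma nijenhuis_vanishes_iff:
  assumes dec: "\<And>x. \<exists>y\<in>h. \<exists>a b. x = y + a *\<^sub>R u + b *\<^sub>R J u"
  shows "(\<forall>x y. nijenhuis br J x y = 0) \<longleftrightarrow>
    (\<forall>x\<in>h. \<forall>y\<in>h. nijenhuis br J x y = 0) \<and> (\<forall>x\<in>h. nijenhuis br J u x = 0)"
proof (intro iffI allI)
  fix x y
  assume N: "(\<forall>x\<in>h. \<forall>y\<in>h. nijenhuis br J x y = 0) \<and> (\<forall>x\<in>h. nijenhuis br J u x = 0)"
  obtain p a b q c d where x: "x = p + a *\<^sub>R u + b *\<^sub>R J u" "p \<in> h"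
     and y: "y = q + c *\<^sub>R u + d *\<^sub>R J u" "q \<in> h"
    using dec by metis
  have "nijenhuis br J u z = 0" "nijenhuis br J (J u) z = 0" "nijenhuis br J z u = 0"
    "nijenhuis br J z (J u) = 0"
    if "z \<in> h" for z
    using N that nijenhuis_anti[of z] by (auto simp: nijenhuis_J_left J_simps)
  then show "nijenhuis br J x y = 0"
    using x y N nijenhuis_anti[of "J u" u]
    by (simp add: nijenhuis_simps nijenhuis_plane)
qed blast

end

section \<open>The Chern--Ricci form\<close>

locale herm_lie = almost_herm_lie +
  assumes integrable: "nijenhuis br J x y = 0"
begin

lemma hermitian: "hermitian_on br UNIV J"
  using almost_hermitian integrable
  by (auto simp: hermitian_on_def complex_structure_on_def almost_hermitian_on_def)

lemma hermitian_on_subspace: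
  "(\<And>x. x \<in> V \<Longrightarrow> J x \<in> V) \<Longrightarrow> hermitian_on br V J"
  using hermitian
  by (auto simp: hermitian_on_def complex_structure_on_def almost_hermitian_on_def
      almost_complex_on_def endo_on_def)

lemma br_J_J: "br (J x) (J y) = br x y + J (br (J x) y) + J (br x (J y))"
  using integrable[of x y] by (simp add: nijenhuis_def J_simps algebra_simps)

text \<open>
  Twice the Dolbeault operator of the holomorphic tangent bundle along the \<open>(0,1)\<close>-part of \<open>x\<close>,
  transported to real vectors. On the quotient of the complexification by the vectors of type
  \<open>(0,1)\<close>, identified with the real space by \<open>a + ib \<mapsto> a + Jb\<close>, it is the map induced by the
  adjoint action of \<open>x + iJx\<close>.
\<close>

definition dolbeault :: "'a \<Rightarrow> 'a \<Rightarrow> 'a" where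
  "dolbeault x y = br x y + J (br (J x) y)"

lemma dolbeault_J: "dolbeault x (J y) = J (dolbeault x y)"
  by (simp add: dolbeault_def J_simps br_J_J)

lemma linear_dolbeault: "linear (dolbeault x)"
  by (rule linearI) (simp_all add: dolbeault_def br_simps J_simps algebra_simps)

text \<open>
  Since \<open>dolbeault z (a + Jb) = ([z,a] - [Jz,b]) + J ([z,b] + [Jz,a])\<close>, each application moves both
  components one step down the lower central series.
\<close>

lemma dolbeault_nilpotent:
  assumes "lie_ideal br h" "\<And>x. x \<in> h \<Longrightarrow> J x \<in> h" "z \<in> h"
  shows "\<exists>a\<in>lower_central_series br h k. \<exists>b\<in>lower_central_series br h k.
    (dolbeault z ^^ Suc k) x = a + J b"
proof (induction k)
  case 0
  show ?case
    using lie_ideal_closed[OF assms(1,3)] lie_ideal_closed[OF assms(1) assms(2)[OF assms(3)]]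
    by (simp add: dolbeault_def) blast
next
  case (Suc k)
  have s: "subspace (lower_central_series br h (Suc k))"
    using assms(1) by (intro subspace_lower_central_series) (simp add: lie_ideal_def)
  note b = br_in_lower_central_series[of _ h _ k]
  obtain a c where ac: "a \<in> lower_central_series br h k" "c \<in> lower_central_series br h k"
    "(dolbeault z ^^ Suc k) x = a + J c" using Suc by blast
  have "(dolbeault z ^^ Suc (Suc k)) x = dolbeault z (a + J c)" using ac(3) by simp
  also have "\<dots> = (br z a - br (J z) c) + J (br z c + br (J z) a)"
    by (simp add: dolbeault_def br_simps J_simps br_J_J)
  finally have "(dolbeault z ^^ Suc (Suc k)) x = (br z a - br (J z) c) + J (br z c + br (J z) a)" .
  moreover have "br z a - br (J z) c \<in> lower_central_series br h (Suc k)"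
    "br z c + br (J z) a \<in> lower_central_series br h (Suc k)"
    using b[OF assms(3)] b[OF assms(2)[OF assms(3)]] ac subspace_add[OF s] subspace_diff[OF s] by simp_all
  ultimately show ?case by blast
qed

lemma endo_trace_J_dolbeault:
  assumes idl: "lie_ideal br h" and "lie_nilpotent br h" "\<And>x. x \<in> h \<Longrightarrow> J x \<in> h" "z \<in> h"
  shows "endo_trace (\<lambda>x. J (dolbeault z x)) = 0"
proof -
  obtain k where "lower_central_series br h k = {0}"
    using assms(2) by (auto simp: lie_nilpotent_def at_most_step_nilpotent_def)
  then have "(dolbeault z ^^ Suc k) x = 0" for x
    using dolbeault_nilpotent[OF idl assms(3,4), of k x] by (auto simp: J_simps)
  then show ?thesis
    by (rule endo_trace_nilpotent_compose[where f = "dolbeault z" and g = J and k = "Suc k",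
          OF linear_dolbeault linear_J dolbeault_J])
qed

text \<open>
  The last axiom of the Chern connection \<open>D\<close> says \<open>D\<^sub>x + J D\<^bsub>Jx\<^esub> = dolbeault x\<close>. Skew maps are
  trace free, so \<open>J D\<^sub>x\<close> and \<open>J dolbeault x\<close> have the same trace; and \<open>J [D\<^sub>x, D\<^sub>y]\<close> is trace free because
  \<open>D\<^sub>x\<close> commutes with \<open>J\<close>. Only the term \<open>D\<^bsub>[x,y]\<^esub>\<close> of the curvature survives.
\<close>

lemma chern_ricci_form_eq:
  "chern_ricci_form br J x y = - (1/2) * endo_trace (\<lambda>z. J (dolbeault (br x y) z))"
proof -
  let ?D = "chern_connection br J"
  have D: "is_chern_connection br J ?D"
    using is_chern_connection_chern_connection[OF bilinear_br _ hermitian] by simp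
  then have bD: "bilinear ?D" and skew: "\<And>x y z. ?D x y \<bullet> z + y \<bullet> ?D x z = 0"
    and DJ: "\<And>x y. ?D x (J y) = J (?D x y)"
    by (auto simp: is_chern_connection_def)
  have lD: "linear (?D x)" for x using bD by (simp add: bilinear_def)
  have lJD: "linear (\<lambda>z. J (?D x z))" for x
    using linear_compose[OF lD linear_J] by (simp add: o_def)
  have DF: "?D x y + J (?D (J x) y) = dolbeault x y" for x y
  proof -
    have "(x, J x) \<in> type01 J" "(y, - J y) \<in> type10 J" by (auto simp: type01_def type10_def)
    then have "cx_ext ?D (x, J x) (y, - J y) = proj10 J (cx_ext br (x, J x) (y, - J y))"
      using D by (auto simp: is_chern_connection_def)
    then have "fst (cx_ext ?D (x, J x) (y, - J y)) = fst (proj10 J (cx_ext br (x, J x) (y, - J y)))"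
      by simp
    then have "?D x y + J (?D (J x) y) = (1/2) *\<^sub>R (2 *\<^sub>R br x y + 2 *\<^sub>R J (br (J x) y))"
      by (simp add: cx_ext_def proj10_def bilinear_rneg[OF bD] DJ br_simps J_simps br_J_J scaleR_2 algebra_simps)
    then show ?thesis by (simp add: dolbeault_def scaleR_right_distrib)
  qed
  have tr0: "endo_trace (?D x) = 0" for x
  proof -
    have "?D x b \<bullet> b = 0" for b using skew[of x b b] by (simp add: inner_commute)
    then show ?thesis by (simp add: endo_trace_def)
  qed
  have trJ: "endo_trace (\<lambda>z. J (?D w z)) = endo_trace (\<lambda>z. J (dolbeault w z))" for w
  proof -
    have "J (dolbeault w z) = J (?D w z) - ?D (J w) z" for z
      by (simp add: DF[symmetric] J_simps)
    then show ?thesis using tr0[of "J w"]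
      by (simp add: endo_trace_def inner_diff_left sum_subtractf)
  qed
  have "endo_trace (\<lambda>z. J (?D x (?D y z))) = endo_trace (\<lambda>z. J (?D y (?D x z)))"
    using endo_trace_comm[OF lJD[of x] lD[of y]] by (simp add: DJ)
  then show ?thesis
    using trJ[of "br x y"]
    by (simp add: chern_ricci_form_def curvature_def endo_trace_def J_simps inner_diff_left sum_subtractf)
qed

lemma chern_ricci_flat_if_derived_in_nilpotent_ideal:
  assumes "lie_ideal br h" "lie_nilpotent br h" "\<And>x. x \<in> h \<Longrightarrow> J x \<in> h" "\<And>x y. br x y \<in> h"
  shows "chern_ricci_flat br J"
  using endo_trace_J_dolbeault[OF assms(1-3) assms(4)]
  by (simp add: chern_ricci_flat_def chern_ricci_form_eq)

end

section \<open>Adjoints and commuting pairs of operators\<close>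

lemma orthogonal_projection_exists:
  fixes V :: "'a::euclidean_space set"
  assumes "subspace V"
  obtains P where "linear P" "\<And>x. P x \<in> V" "\<And>x. x \<in> V \<Longrightarrow> P x = x" "\<And>x y. P x \<bullet> y = x \<bullet> P y"
proof -
  obtain B where B: "B \<subseteq> V" "pairwise orthogonal B" "\<And>x. x \<in> B \<Longrightarrow> norm x = 1"
    "independent B" "span B = V"
    using orthonormal_basis_subspace[OF assms] by metis
  have fB: "finite B" using B(4) by (rule independent_imp_finite)
  define P where "P x = (\<Sum>b\<in>B. (x \<bullet> b) *\<^sub>R b)" for x
  show ?thesis
  proof
    show "linear P" unfolding P_def
      by (intro linear_compose_sum ballI linearI) (simp_all add: inner_add_left scaleR_left_distrib)
    show "P x \<in> V" for x unfolding P_def using B(1)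
      by (intro subspace_sum[OF assms] subspace_scale[OF assms]) auto
    show "P x = x" if "x \<in> V" for x unfolding P_def
      using orthonormal_basis_expand[OF B(2,3) _ fB] that B(5) by blast
    show "P x \<bullet> y = x \<bullet> P y" for x y
      by (simp add: P_def inner_sum_left inner_sum_right inner_commute mult.commute)
  qed
qed

lemma sum_norm_square_adjoint:
  fixes f :: "'a::euclidean_space \<Rightarrow> 'a"
  assumes f: "linear f" and g: "linear g" and adj: "\<And>x y. f x \<bullet> y = x \<bullet> g y"
  shows "(\<Sum>e\<in>Basis. f e \<bullet> f e) = (\<Sum>e\<in>Basis. g e \<bullet> g e)"
proof -
  have "(\<Sum>e\<in>Basis. f e \<bullet> f e) = endo_trace (\<lambda>e. g (f e))"
    by (simp add: endo_trace_def adj inner_commute)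
  also have "\<dots> = endo_trace (\<lambda>e. f (g e))" by (rule endo_trace_comm[OF g f])
  also have "\<dots> = (\<Sum>e\<in>Basis. g e \<bullet> g e)" by (simp add: endo_trace_def adj)
  finally show ?thesis .
qed

lemma linear_eq_zero_if_sum_norm_square:
  fixes f :: "'a::euclidean_space \<Rightarrow> 'a"
  assumes f: "linear f" and "(\<Sum>e\<in>Basis. f e \<bullet> f e) = 0"
  shows "f x = 0"
proof -
  have "\<forall>e\<in>Basis. f e = 0" using assms(2) by (simp add: sum_nonneg_eq_0_iff)
  then show ?thesis using linear_eq_on_span[OF f linear_zero, of Basis x] by simp
qed

context almost_herm_lie
begin

text \<open>
  The squared Hilbert--Schmidt norm of \<open>a - (JaJ)\<^sup>T\<close>: this is twice the defect in the
  Cauchy--Schwarz inequality \<open>tr (JaJ a) \<le> |a|\<^sup>2\<close>.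
\<close>

lemma sum_norm_square_minus_adjoint:
  assumes a: "linear a"
  defines "c \<equiv> \<lambda>x. J (adjoint a (J x))"
  shows "(\<Sum>e\<in>Basis. (a e - c e) \<bullet> (a e - c e)) =
    (\<Sum>e\<in>Basis. a e \<bullet> a e + a (J e) \<bullet> a (J e) - a (J (a (J e))) \<bullet> e - J (a (J (a e))) \<bullet> e)"
proof -
  have JaJ: "linear (\<lambda>x. J (f (J x)))" if "linear f" for f
    using linear_compose[OF linear_compose[OF linear_J that] linear_J] by (simp add: o_def)
  have aJa: "linear (\<lambda>x. a (J (a x)))"
    using linear_compose[OF linear_compose[OF a linear_J] a] by (simp add: o_def)
  have adj: "c x \<bullet> y = x \<bullet> J (a (J y))" for x y
    using adjoint_works[OF a, of "J y" "J x"] J_skew[of "adjoint a (J x)" y] J_skew[of x "a (J y)"]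
    by (simp add: c_def inner_commute)
  have "(\<Sum>e\<in>Basis. c e \<bullet> c e) = (\<Sum>e\<in>Basis. J (a (J e)) \<bullet> J (a (J e)))"
    using JaJ[OF adjoint_linear[OF a]] JaJ[OF a] adj
    unfolding c_def by (rule sum_norm_square_adjoint)
  then have 1: "(\<Sum>e\<in>Basis. c e \<bullet> c e) = (\<Sum>e\<in>Basis. a (J e) \<bullet> a (J e))" by simp
  have 2: "a e \<bullet> c e = J (a (J (a e))) \<bullet> e" for e
    using adj[of e "a e"] by (metis inner_commute)
  have 3: "endo_trace (\<lambda>e. J (a (J (a e)))) = endo_trace (\<lambda>e. a (J (a (J e))))"
    by (rule endo_trace_comm[OF linear_J aJa])
  have "(a e - c e) \<bullet> (a e - c e) = a e \<bullet> a e + c e \<bullet> c e - 2 * (J (a (J (a e))) \<bullet> e)" for e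
    using 2[of e] inner_commute[of "c e" "a e"] by (simp add: inner_diff_left inner_diff_right)
  then show ?thesis using 1 3
    by (simp add: endo_trace_def sum.distrib sum_subtractf sum_distrib_left[symmetric])
qed

text \<open>
  The assumptions say \<open>a\<^sup>T = JaJ\<close> and \<open>b\<^sup>T = JbJ\<close>, and the last one is integrability. Writing
  \<open>T = a + a\<^sup>T\<close> and \<open>T' = b + b\<^sup>T\<close>, it reads \<open>T = T' J\<close>. Then \<open>|T|\<^sup>2 = tr (T T' J)\<close> reduces, by
  cyclicity, to \<open>2 tr (abJ) - 2 tr (baJ)\<close>, which is zero.
\<close>

lemma commuting_pair_skew:
  assumes a: "linear a" and b: "linear b"
    and adja: "\<And>x y. a x \<bullet> y = x \<bullet> J (a (J y))" and adjb: "\<And>x y. b x \<bullet> y = x \<bullet> J (b (J y))"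
    and comm: "\<And>x. a (b x) = b (a x)"
    and int: "\<And>x. a x + J (a (J x)) = b (J x) - J (b x)"
  shows "J (a (J x)) = - a x" "J (b (J x)) = - b x"
proof -
  have lc: "linear (\<lambda>x. f (g x))" if "linear f" "linear g" for f g :: "'a \<Rightarrow> 'a"
    using linear_compose[OF that(2,1)] by (simp add: o_def)
  note an = linear_neg[OF a] linear_neg[OF b] linear_add[OF a] linear_add[OF b]
    linear_diff[OF a] linear_diff[OF b]
  define T where "T x = a x + J (a (J x))" for x
  define T' where "T' x = b x + J (b (J x))" for x
  have TT': "T x = T' (J x)" for x
    using int[of x] by (simp add: T_def T'_def J_simps an)
  have lT: "linear T" unfolding T_def using linear_compose_add[OF a lc[OF linear_J lc[OF a linear_J]]] by simp
  have sT: "T x \<bullet> y = x \<bullet> T y" for x y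
    using adja[of x y] adja[of y x] by (simp add: T_def inner_add_left inner_add_right inner_commute)
  have e1: "endo_trace (\<lambda>e. J (a (J (b (J e))))) = endo_trace (\<lambda>e. - a (J (b e)))"
    using endo_trace_comm[OF linear_J lc[OF a lc[OF linear_J lc[OF b linear_J]]]] by (simp add: an J_simps)
  have e2: "endo_trace (\<lambda>e. J (a (b e))) = endo_trace (\<lambda>e. a (b (J e)))"
    using endo_trace_comm[OF linear_J lc[OF a b]] by simp
  have e3: "endo_trace (\<lambda>e. a (J (b e))) = endo_trace (\<lambda>e. a (b (J e)))"
    using endo_trace_comm[OF lc[OF a linear_J] b] by (simp add: comm)
  have "T e \<bullet> T e = a (b (J e)) \<bullet> e - a (J (b e)) \<bullet> e + J (a (J (b (J e)))) \<bullet> e + J (a (b e)) \<bullet> e" for e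
  proof -
    have "T e \<bullet> T e = T (T' (J e)) \<bullet> e" using sT[of "T e" e] TT'[of e] by simp
    then show ?thesis by (simp add: T_def T'_def an J_simps inner_add_left inner_diff_left)
  qed
  then have "(\<Sum>e\<in>Basis. T e \<bullet> T e) = 0"
    using e1 e2 e3 by (simp add: endo_trace_def sum.distrib sum_subtractf sum_negf)
  then have T0: "T x = 0" for x by (rule linear_eq_zero_if_sum_norm_square[OF lT])
  then show "J (a (J x)) = - a x" by (metis T_def add.inverse_unique)
  have "T' x = 0" using TT'[of "- J x"] T0 by (simp add: J_simps)
  then show "J (b (J x)) = - b x" by (metis T'_def add.inverse_unique)
qed

definition complex_subalgebra :: "'a set \<Rightarrow> bool" where
  "complex_subalgebra V \<longleftrightarrow> subspace V \<and> (\<forall>x\<in>V. \<forall>y\<in>V. br x y \<in> V) \<and> (\<forall>x\<in>V. J x \<in> V)"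

end

section \<open>Consequences of a closed Bismut torsion\<close>

locale skt_lie = herm_lie +
  assumes skt: "skt_on br UNIV J"
begin

text \<open>
  The Bismut torsion with the opposite sign.
\<close>

definition torsion :: "'a \<Rightarrow> 'a \<Rightarrow> 'a \<Rightarrow> real" where
  "torsion a b c = br (J a) (J b) \<bullet> c - br (J a) (J c) \<bullet> b + br (J b) (J c) \<bullet> a"

lemma bismut_torsion_eq: "bismut_torsion br J [a, b, c] = - torsion a b c"
  by (simp add: bismut_torsion_def ce_d_2 fundamental_form_def torsion_def)

lemma torsion_closed:
  "torsion (br w x) y z - torsion (br w y) x z + torsion (br w z) x y
   + torsion (br x y) w z - torsion (br x z) w y + torsion (br y z) w x = 0"
proof -
  have "ce_d br (bismut_torsion br J) [w, x, y, z] = 0"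
    using skt by (simp add: skt_on_def form_vanishes_on_def)
  moreover have "ce_d br \<alpha> [w, x, y, z] = - \<alpha> [br w x, y, z] + \<alpha> [br w y, x, z] - \<alpha> [br w z, x, y]
      - \<alpha> [br x y, w, z] + \<alpha> [br x z, w, y] - \<alpha> [br y z, w, x]" for \<alpha>
    by (simp add: ce_d_def nths_Cons eval_nat_numeral lessThan_Suc)
  ultimately show ?thesis by (simp add: bismut_torsion_eq)
qed

text \<open>
  For \<open>x\<close> central, \<open>D = ad\<^bsub>Jx\<^esub>\<close> commutes with \<open>J\<close> and closedness of the torsion on \<open>(x, Jx, y, Jy)\<close> reads
  \<open>\<langle>D\<^sup>2y, y\<rangle> + |Dy|\<^sup>2 + \<langle>D[y,Jy], x\<rangle> = 0\<close>. If \<open>D\<close> kills \<open>C\<^sub>k\<^sub>+\<^sub>1\<close>, which contains \<open>Dy\<close> and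
  \<open>[y, Jy]\<close> for \<open>y \<in> C\<^sub>k\<close>, only \<open>|Dy|\<^sup>2\<close> remains.
\<close>

lemma J_center:
  assumes h: "complex_subalgebra h" and nil: "lie_nilpotent br h" and x: "x \<in> lie_center br h"
  shows "J x \<in> lie_center br h"
proof -
  have sh: "subspace h" and cl: "\<And>x y. x \<in> h \<Longrightarrow> y \<in> h \<Longrightarrow> br x y \<in> h"
    and Jh: "\<And>x. x \<in> h \<Longrightarrow> J x \<in> h"
    using h by (auto simp: complex_subalgebra_def)
  have xh: "x \<in> h" and x0: "\<And>y. y \<in> h \<Longrightarrow> br x y = 0" using x by (auto simp: lie_center_def)
  have x0': "br y x = 0" if "y \<in> h" for y using x0[OF that] br_anti[of y x] by simp
  let ?D = "br (J x)"
  have DJ: "?D (J y) = J (?D y)" if "y \<in> h" for y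
    using br_J_J[of x y] x0[OF that] x0[OF Jh[OF that]] by (simp add: J_simps)
  have step: "?D y = 0" if y: "y \<in> h" and "?D (?D y) = 0" "?D (br y (J y)) = 0" for y
  proof -
    have Dy: "?D y \<in> h" "br y (J y) \<in> h" using xh y cl Jh by blast+
    note flip = br_anti[of _ "J x"]
    have 1: "torsion (?D y) x (J y) = br (J (?D y)) y \<bullet> x - ?D y \<bullet> ?D y"
      using that DJ[OF Dy(1)] by (simp add: torsion_def flip br_simps J_simps)
    have 2: "torsion (?D (J y)) x y = br (?D y) (J y) \<bullet> x + ?D y \<bullet> ?D y"
      using that by (simp add: torsion_def DJ flip br_simps J_simps)
    have 3: "torsion (br y (J y)) x (J x) = 0"
      using that DJ[OF Dy(2)] x0'[OF Jh[OF Dy(2)]] x0'[OF Jh[OF xh]]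
      by (simp add: torsion_def flip br_simps J_simps)
    have "br (?D y) (J y) + br y (J (?D y)) = 0"
      using jacobi[of "J x" y "J y"] that DJ[OF y] by simp
    then have 4: "br (?D y) (J y) \<bullet> x = br (J (?D y)) y \<bullet> x"
      using br_anti[of y "J (?D y)"] by simp
    have "torsion (?D y) x (J y) - torsion (?D (J y)) x y + torsion (br y (J y)) x (J x) = 0"
      using torsion_closed[of x "J x" y "J y"] x0[OF Jh[OF xh]] x0[OF y] x0[OF Jh[OF y]]
      by (simp add: torsion_def br_simps J_simps)
    then have "?D y \<bullet> ?D y = 0" using 1 2 3 4 by simp
    then show ?thesis by simp
  qed
  let ?C = "lower_central_series br h"
  have Ch: "?C k \<subseteq> h" for k using lower_central_series_subset[OF sh cl] by simp
  have down: "\<forall>y\<in>?C k. ?D y = 0" if "\<forall>y\<in>?C (Suc k). ?D y = 0" for k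
  proof
    fix y assume y: "y \<in> ?C k"
    have yh: "y \<in> h" using y Ch by blast
    have "br (J y) y \<in> ?C (Suc k)" "?D y \<in> ?C (Suc k)"
      using br_in_lower_central_series[OF _ y] Jh yh xh by auto
    then show "?D y = 0"
      using step[OF yh] that br_anti[of y "J y"] by (simp add: br_simps)
  qed
  obtain k where "?C k = {0}"
    using nil by (auto simp: lie_nilpotent_def at_most_step_nilpotent_def)
  then have "\<forall>y\<in>?C k. ?D y = 0" by (simp add: br_simps)
  then have "\<forall>y\<in>?C 0. ?D y = 0" by (induction k) (use down in blast)+
  then show ?thesis using Jh[OF xh] by (simp add: lie_center_def)
qed

text \<open>
  On \<open>z\<close> closedness of the torsion on \<open>(u, Ju, p, Jp)\<close> is the identity \<open>key\<close> below. Summed over an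
  orthonormal basis it says \<open>|a|\<^sup>2 + |b|\<^sup>2 = tr (JaJ a) + tr (JbJ b)\<close>, so equality holds in
  Cauchy--Schwarz for both operators and \<open>a\<^sup>T = JaJ\<close>, \<open>b\<^sup>T = JbJ\<close>. They commute because
  \<open>[u, Ju]\<close> acts trivially on \<open>z\<close>. The operators are extended by zero to the orthogonal complement
  of \<open>z\<close>, so that traces can be taken over the whole space.
\<close>

lemma skew_on_abelian:
  assumes z: "subspace z" and Jz: "\<And>x. x \<in> z \<Longrightarrow> J x \<in> z"
    and zz: "\<And>x y. x \<in> z \<Longrightarrow> y \<in> z \<Longrightarrow> br x y = 0"
    and uz: "\<And>x. x \<in> z \<Longrightarrow> br u x \<in> z" and vz: "\<And>x. x \<in> z \<Longrightarrow> br (J u) x \<in> z"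
    and wz: "\<And>x. x \<in> z \<Longrightarrow> br (br u (J u)) x = 0"
    and Jwz: "\<And>x. x \<in> z \<Longrightarrow> br (J (br u (J u))) x = 0"
    and x: "x \<in> z"
  shows "br u (J x) = J (br u x)" "br (J u) (J x) = J (br (J u) x)"
    "y \<in> z \<Longrightarrow> br u x \<bullet> y = - (x \<bullet> br u y)" "y \<in> z \<Longrightarrow> br (J u) x \<bullet> y = - (x \<bullet> br (J u) y)"
proof -
  obtain P where P: "linear P" "\<And>x. P x \<in> z" "\<And>x. x \<in> z \<Longrightarrow> P x = x" "\<And>x y. P x \<bullet> y = x \<bullet> P y"
    using orthogonal_projection_exists[OF z] by blast
  have PJ: "P (J y) = J (P y)" for y
  proof -
    have "(P (J y) - J (P y)) \<bullet> q = 0" if "q \<in> z" for q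
      using P(4)[of "J y" q] P(4)[of y "J q"] P(3)[OF that] P(3)[OF Jz[OF that]]
      by (simp add: inner_diff_left J_skew)
    moreover have "P (J y) - J (P y) \<in> z" using P(2) Jz subspace_diff[OF z] by blast
    ultimately show ?thesis by (metis eq_iff_diff_eq_0 inner_eq_zero_iff)
  qed
  define a where "a y = br u (P y)" for y
  define b where "b y = br (J u) (P y)" for y
  have la: "linear a" and lb: "linear b"
    unfolding a_def b_def using linear_compose[OF P(1) linear_br_right] by (auto simp: o_def)
  have az: "a y \<in> z" "b y \<in> z" for y using P(2) uz vz by (auto simp: a_def b_def)
  have aP: "a y = br u y" "b y = br (J u) y" if "y \<in> z" for y
    using P(3)[OF that] by (auto simp: a_def b_def)
  have key: "a p \<bullet> a p + a (J p) \<bullet> a (J p) + b p \<bullet> b p + b (J p) \<bullet> b (J p) =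
      a (J (a (J p))) \<bullet> p + J (a (J (a p))) \<bullet> p + b (J (b (J p))) \<bullet> p + J (b (J (b p))) \<bullet> p"
    if p: "p \<in> z" for p
  proof -
    let ?w = "br u (J u)"
    note Jp = Jz[OF p]
    have flip: "br q u = - a q" "br q (J u) = - b q" if "q \<in> z" for q
      using aP[OF that] br_anti[of q] by simp_all
    have zin: "a q \<in> z" "b q \<in> z" "J (a q) \<in> z" "J (b q) \<in> z" for q using az Jz by auto
    have wt: "br (J ?w) q = 0" if "q \<in> z" for q using Jwz[OF that] .
    have e: "br u p = a p" "br u (J p) = a (J p)" "br (J u) p = b p" "br (J u) (J p) = b (J p)"
      using aP[OF p] aP[OF Jp] by simp_all
    have an: "a (- q) = - a q" "b (- q) = - b q" for q
      using linear_neg[OF la] linear_neg[OF lb] by auto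
    have Jab: "J p \<bullet> a (J (a p)) = - (J (a (J (a p))) \<bullet> p)" "J p \<bullet> b (J (b p)) = - (J (b (J (b p))) \<bullet> p)"
      by (simp_all add: J_skew inner_commute)
    show ?thesis
      using torsion_closed[of u "J u" p "J p"] Jp p zz[OF p Jp] zz[OF Jp p]
        zz[OF zin(3)] zz[OF zin(4)] zz[OF _ zin(3)] zz[OF _ zin(4)]
      by (simp add: e torsion_def wt br_simps J_simps flip zin an aP[symmetric] inner_commute Jab)
  qed
  let ?f = "\<lambda>x. a x - J (adjoint a (J x))" and ?g = "\<lambda>x. b x - J (adjoint b (J x))"
  have "(\<Sum>e\<in>Basis. ?f e \<bullet> ?f e) + (\<Sum>e\<in>Basis. ?g e \<bullet> ?g e) = 0"
  proof -
    have "a e \<bullet> a e + a (J e) \<bullet> a (J e) + b e \<bullet> b e + b (J e) \<bullet> b (J e) =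
      a (J (a (J e))) \<bullet> e + J (a (J (a e))) \<bullet> e + b (J (b (J e))) \<bullet> e + J (b (J (b e))) \<bullet> e" for e
    proof -
      have "a (P y) = a y" "b (P y) = b y" for y by (simp_all add: a_def b_def P)
      moreover have "q \<bullet> P e = q \<bullet> e" if "q \<in> z" for q using P(3)[OF that] P(4)[of q e] by simp
      ultimately show ?thesis using key[OF P(2)[of e]] by (simp add: PJ[symmetric] az Jz)
    qed
    then show ?thesis unfolding sum_norm_square_minus_adjoint[OF la] sum_norm_square_minus_adjoint[OF lb]
      by (simp add: sum.distrib[symmetric] algebra_simps)
  qed
  moreover have "(\<Sum>e\<in>Basis. ?f e \<bullet> ?f e) \<ge> 0" "(\<Sum>e\<in>Basis. ?g e \<bullet> ?g e) \<ge> 0"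
    by (auto intro: sum_nonneg)
  ultimately have 0: "(\<Sum>e\<in>Basis. ?f e \<bullet> ?f e) = 0" "(\<Sum>e\<in>Basis. ?g e \<bullet> ?g e) = 0" by linarith+
  have "linear (\<lambda>x. f x - J (adjoint f (J x)))" if "linear f" for f
    using linear_compose_sub[OF that linear_compose[OF linear_compose[OF linear_J adjoint_linear[OF that]] linear_J]]
    by (simp add: o_def)
  from linear_eq_zero_if_sum_norm_square[OF this[OF la] 0(1)]
    linear_eq_zero_if_sum_norm_square[OF this[OF lb] 0(2)]
  have fg: "?f q = 0" "?g q = 0" for q by blast+
  have adja: "a p \<bullet> q = p \<bullet> J (a (J q))" for p q
    using fg(1)[of p] adjoint_works[OF la, of "J q" "J p"]
      J_skew[of "adjoint a (J p)" q] J_skew[of p "a (J q)"] by (simp add: inner_commute)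
  have adjb: "b p \<bullet> q = p \<bullet> J (b (J q))" for p q
    using fg(2)[of p] adjoint_works[OF lb, of "J q" "J p"]
      J_skew[of "adjoint b (J p)" q] J_skew[of p "b (J q)"] by (simp add: inner_commute)
  have comm: "a (b p) = b (a p)" for p
    using jacobi[of u "J u" "P p"] wz[OF P(2)] P az by (simp add: a_def b_def uz vz)
  have int: "a p + J (a (J p)) = b (J p) - J (b p)" for p
    using br_J_J[of u "P p"] by (simp add: a_def b_def PJ)
  note r = commuting_pair_skew[OF la lb adja adjb comm int]
  have r': "a (J p) = J (a p)" "b (J p) = J (b p)" for p
    using arg_cong[OF r(1)[of p], of J] arg_cong[OF r(2)[of p], of J] by (simp_all add: J_simps)
  show "br u (J x) = J (br u x)" "br (J u) (J x) = J (br (J u) x)"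
    using r'[of x] aP[OF x] aP[OF Jz[OF x]] by simp_all
  show "br u x \<bullet> y = - (x \<bullet> br u y)" if "y \<in> z"
    using adja[of x y] r(1)[of y] aP(1) x that by simp
  show "br (J u) x \<bullet> y = - (x \<bullet> br (J u) y)" if "y \<in> z"
    using adjb[of x y] r(2)[of y] aP(2) x that by simp
qed

end

section \<open>Nilpotent SKT Lie algebras are at most two-step\<close>

context almost_herm_lie
begin

definition J_closure :: "'a set \<Rightarrow> 'a set" where
  "J_closure W = {a + J b | a b. a \<in> W \<and> b \<in> W}"

lemma J_closureE:
  assumes "x \<in> J_closure W"
  obtains a b where "x = a + J b" "a \<in> W" "b \<in> W"
  using assms unfolding J_closure_def by blast

lemma J_closureI: "a \<in> W \<Longrightarrow> b \<in> W \<Longrightarrow> a + J b \<in> J_closure W"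
  unfolding J_closure_def by blast

lemma subspace_J_closure:
  assumes "subspace W"
  shows "subspace (J_closure W)"
proof -
  have "J_closure W = {x + y | x y. x \<in> W \<and> y \<in> J ` W}" unfolding J_closure_def by blast
  then show ?thesis
    using subspace_sums[OF assms linear_subspace_image[OF linear_J assms]] by simp
qed

lemma J_closure_base:
  assumes "subspace W" "a \<in> W"
  shows "a \<in> J_closure W" "J a \<in> J_closure W"
  using J_closureI[of a W 0] J_closureI[of 0 W a] assms subspace_0[OF assms(1)]
  by (simp_all add: J_simps)

lemma J_in_J_closure:
  assumes "subspace W" "x \<in> J_closure W"
  shows "J x \<in> J_closure W"
proof -
  obtain a b where "x = a + J b" "a \<in> W" "b \<in> W" using assms(2) by (rule J_closureE)
  moreover from this have "J x = (- b) + J a" by (simp add: J_simps)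
  ultimately show ?thesis using J_closureI[of "- b" W a] subspace_neg[OF assms(1)] by metis
qed

end

context herm_lie
begin

text \<open>
  If \<open>C\<^sub>1 + J C\<^sub>1\<close> is everything, then so is \<open>C\<^sub>i + J C\<^sub>i\<close> for every \<open>i\<close>. In the complexification
  this is the fact that a subalgebra, here that of the vectors of type \<open>(0,1)\<close>, which together with
  the derived algebra spans a nilpotent Lie algebra is the whole of it. In real terms, integrability
  expands the bracket of \<open>a + Jb\<close> and \<open>c + Jd\<close> into brackets that have at least one of
  \<open>a, b, c, d\<close> as an entry, or \<open>J\<close> of such brackets.
\<close>

lemma J_closure_proper:
  assumes h: "complex_subalgebra h" and nil: "lie_nilpotent br h"
    and full: "h \<subseteq> J_closure (lower_central_series br h 1)"
  shows "h = {0}"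
proof -
  let ?C = "lower_central_series br h"
  have sh: "subspace h" and cl: "\<And>x y. x \<in> h \<Longrightarrow> y \<in> h \<Longrightarrow> br x y \<in> h"
    and Jh: "\<And>x. x \<in> h \<Longrightarrow> J x \<in> h"
    using h by (auto simp: complex_subalgebra_def)
  have sC: "subspace (?C k)" for k using sh by (rule subspace_lower_central_series)
  have Ch: "?C k \<subseteq> h" for k using lower_central_series_subset[OF sh cl] by simp
  define R where "R k = J_closure (?C k)" for k
  note sR = subspace_J_closure[OF sC, folded R_def] and JR = J_in_J_closure[OF sC, folded R_def]
  have "h \<subseteq> R (Suc k)" for k
  proof (induction k)
    case 0
    then show ?case using full by (simp add: R_def)
  next
    case (Suc k)
    have C1R: "?C 1 \<subseteq> R (Suc (Suc k))"
      unfolding One_nat_def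
    proof (rule lower_central_series_Suc_subset[OF sR])
      fix x y assume "x \<in> h" "y \<in> ?C 0"
      then have "x \<in> R (Suc k)" "y \<in> R (Suc k)" using Suc by auto
      then obtain a b c d where x: "x = a + J b" "a \<in> ?C (Suc k)" "b \<in> ?C (Suc k)"
        and y: "y = c + J d" "c \<in> ?C (Suc k)" "d \<in> ?C (Suc k)"
        unfolding R_def by (elim J_closureE)
      have m: "br p q \<in> ?C (Suc (Suc k))" "br q p \<in> ?C (Suc (Suc k))" if "p \<in> h" "q \<in> ?C (Suc k)" for p q
        using br_in_lower_central_series[OF that] br_anti[of q p] subspace_neg[OF sC] by auto
      have ah: "a \<in> h" "b \<in> h" "c \<in> h" "d \<in> h" using x y Ch by blast+
      have "br x y = (br a c + br (J b) c + br a (J d) + br b d) + J (br (J b) d + br b (J d))"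
        by (simp add: x y br_simps br_J_J J_simps)
      moreover have "br a c + br (J b) c + br a (J d) + br b d \<in> ?C (Suc (Suc k))"
        "br (J b) d + br b (J d) \<in> ?C (Suc (Suc k))"
        using m(1)[OF ah(1) y(2)] m(1)[OF Jh[OF ah(2)] y(2)] m(2)[OF Jh[OF ah(4)] x(2)]
          m(1)[OF ah(2) y(3)] m(1)[OF Jh[OF ah(2)] y(3)] m(2)[OF Jh[OF ah(4)] x(3)]
        by (simp_all add: subspace_add[OF sC])
      ultimately show "br x y \<in> R (Suc (Suc k))" unfolding R_def by (simp only: J_closureI)
    qed
    show ?case
    proof
      fix x assume "x \<in> h"
      then have "x \<in> J_closure (?C 1)" using full by blast
      then obtain a b where "x = a + J b" "a \<in> ?C 1" "b \<in> ?C 1" by (rule J_closureE)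
      then show "x \<in> R (Suc (Suc k))"
        using C1R JR subspace_add[OF sR] by blast
    qed
  qed
  moreover obtain k where "?C k = {0}"
    using nil by (auto simp: lie_nilpotent_def at_most_step_nilpotent_def)
  moreover from this have "?C (Suc k) = {0}"
    using lower_central_series_decreasing[OF sh cl, of k] subspace_0[OF sC, of "Suc k"] by auto
  then have "R (Suc k) = {0}" by (simp add: R_def J_closure_def J_simps)
  ultimately have "h \<subseteq> {0}" by metis
  then show ?thesis using subspace_0[OF sh] by blast
qed

end

context skt_lie
begin

text \<open>
  For a \<open>2\<close>-step algebra with \<open>J\<close>-invariant centre, closedness of the torsion on \<open>(x, Jx, y, Jy)\<close> is
  \<open>2 \<langle>[x,Jx], [y,Jy]\<rangle> = |[x,y]|\<^sup>2 + |[x,Jy]|\<^sup>2 + |[Jx,y]|\<^sup>2 + |[Jx,Jy]|\<^sup>2\<close>,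
  so \<open>[x, Jx] = 0\<close> forces \<open>[x, y] = 0\<close>.
\<close>

lemma isotropic_central:
  assumes r: "complex_subalgebra r" and two: "\<And>x y. x \<in> r \<Longrightarrow> y \<in> r \<Longrightarrow> br x y \<in> lie_center br r"
    and Jz: "\<And>x. x \<in> lie_center br r \<Longrightarrow> J x \<in> lie_center br r"
    and x: "x \<in> r" "br x (J x) = 0"
  shows "x \<in> lie_center br r"
proof -
  have "br x y = 0" if y: "y \<in> r" for y
  proof -
    have rr: "J p \<in> r" if "p \<in> r" for p using r that by (auto simp: complex_subalgebra_def)
    have t: "torsion (br p q) s t = br (J s) (J t) \<bullet> br p q" if "p \<in> r" "q \<in> r" "s \<in> r" "t \<in> r" for p q s t
    proof -
      have "br (J (br p q)) v = 0" if "v \<in> r" for v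
        using Jz[OF two[OF \<open>p \<in> r\<close> \<open>q \<in> r\<close>]] that by (auto simp: lie_center_def)
      then show ?thesis using that rr by (simp add: torsion_def)
    qed
    have "br x y \<bullet> br x y + br x (J y) \<bullet> br x (J y) + br (J x) y \<bullet> br (J x) y
        + br (J x) (J y) \<bullet> br (J x) (J y) = 0"
      using torsion_closed[of x "J x" y "J y"] x y rr br_anti[of "J x" x]
      by (simp add: t br_simps torsion_def[of 0] J_simps(3-))
    then show ?thesis by (smt (verit) inner_ge_zero inner_eq_zero_iff)
  qed
  then show ?thesis using x(1) by (simp add: lie_center_def)
qed

text \<open>
  Induction on the dimension, applied to the ideal \<open>r = C\<^sub>1 + J C\<^sub>1\<close>. The decisive step is the
  \<open>J\<close>-invariance of \<open>N\<close>: for \<open>x \<in> N\<close> and \<open>e \<in> h\<close>, the element \<open>u = [e, Jx]\<close> satisfies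
  \<open>[Je, Jx] = Ju\<close> modulo the centre of \<open>r\<close>, and the Jacobi identity gives \<open>[u, Ju] = - [u, Ju]\<close>;
  hence \<open>u\<close> is central in \<open>r\<close> by \<open>isotropic_central\<close>.
\<close>

lemma skt_nilpotent_two_step:
  assumes "complex_subalgebra h" "lie_nilpotent br h"
  shows "at_most_step_nilpotent br h 2"
  using assms
proof (induction "dim h" arbitrary: h rule: less_induct)
  case less
  let ?C = "lower_central_series br h"
  have sh: "subspace h" and cl: "\<And>x y. x \<in> h \<Longrightarrow> y \<in> h \<Longrightarrow> br x y \<in> h"
    and Jh: "\<And>x. x \<in> h \<Longrightarrow> J x \<in> h"
    using less.prems(1) by (auto simp: complex_subalgebra_def)
  have sC: "subspace (?C k)" for k using sh by (rule subspace_lower_central_series)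
  have Ch: "?C k \<subseteq> h" for k using lower_central_series_subset[OF sh cl] by simp
  have C1: "br x y \<in> ?C 1" if "x \<in> h" "y \<in> h" for x y
    using br_in_lower_central_series[of x h y 0] that by simp
  define r where "r = J_closure (?C 1)"
  note rI = J_closure_base[OF sC, of _ 1, folded r_def] and Jr = J_in_J_closure[OF sC, of _ 1, folded r_def]
  have sr: "subspace r" unfolding r_def by (rule subspace_J_closure[OF sC])
  have rh: "r \<subseteq> h"
    unfolding r_def using Ch[of 1] Jh subspace_add[OF sh] by (blast elim: J_closureE)
  have hr: "br x y \<in> r" if "x \<in> h" "y \<in> h" for x y using rI(1)[OF C1[OF that]] .
  have r: "complex_subalgebra r" unfolding complex_subalgebra_def using sr Jr hr rh by blast
  have nr: "lie_nilpotent br r"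
  proof -
    obtain k where "?C k = {0}"
      using less.prems(2) by (auto simp: lie_nilpotent_def at_most_step_nilpotent_def)
    then have "lower_central_series br r k = {0}"
      using lower_central_series_mono[OF rh, of k] subspace_0[OF subspace_lower_central_series[OF sr, of k]]
      by auto
    then show ?thesis by (auto simp: lie_nilpotent_def at_most_step_nilpotent_def)
  qed
  show ?case
  proof (cases "r = h")
    case True
    have "h = {0}" using J_closure_proper[OF less.prems] True by (simp add: r_def)
    then show ?thesis using Ch[of 2] subspace_0[OF sC[of 2]] by (auto simp: at_most_step_nilpotent_def)
  next
    case False
    have "dim r < dim h"
      using subspace_dim_equal[OF sr sh rh] False by linarith
    then have "lower_central_series br r 2 = {0}"
      using less.hyps[OF _ r nr] by (simp add: at_most_step_nilpotent_def)
    then have rrr: "br x (br y y') = 0" if "x \<in> r" "y \<in> r" "y' \<in> r" for x y y'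
      using br_in_lower_central_series[of x r "br y y'" 1] br_in_lower_central_series[of y r y' 0] that
      by (simp add: numeral_2_eq_2)
    let ?z = "lie_center br r"
    have two: "br x y \<in> ?z" if "x \<in> r" "y \<in> r" for x y
      using that rrr r br_anti[of "br x y"] by (auto simp: lie_center_def complex_subalgebra_def)
    have sz: "subspace ?z" 
      using sr by (auto simp: lie_center_def subspace_def br_simps)
    have Jz: "J x \<in> ?z" if "x \<in> ?z" for x using J_center[OF r nr that] .
    have zr: "?z \<subseteq> r" by (auto simp: lie_center_def)
    have z0: "br x y = 0" "br y x = 0" if "x \<in> ?z" "y \<in> r" for x y
      using that br_anti[of y x] by (auto simp: lie_center_def)
    have hz: "br e x \<in> ?z" if "e \<in> h" "x \<in> ?z" for e x
    proof -
      have xr: "x \<in> r" using that(2) zr by blast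
      have "br (br e x) y = 0" if "y \<in> r" for y
        using jacobi[of e x y] z0[OF \<open>x \<in> ?z\<close>] that hr[OF \<open>e \<in> h\<close>] rh by (auto simp: br_simps)
      then show ?thesis using hr[OF that(1), of x] xr rh by (auto simp: lie_center_def)
    qed
    \<comment> \<open>elements of \<open>h\<close> act on the centre of \<open>r\<close> by skew maps, which are also nilpotent\<close>
    have hz0: "br e x = 0" if e: "e \<in> h" and x: "x \<in> ?z" for e x
    proof -
      have skew: "br e p \<bullet> q = - (p \<bullet> br e q)" if "p \<in> ?z" "q \<in> ?z" for p q
      proof (rule skew_on_abelian(3)[OF sz _ _ _ _ _ _ that])
        show "br e p \<in> ?z" "br (J e) p \<in> ?z" if "p \<in> ?z" for p using hz that e Jh by auto
        have "br e (J e) \<in> r" using hr e Jh by blast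
        then show "br (br e (J e)) p = 0" "br (J (br e (J e))) p = 0" if "p \<in> ?z" for p
          using z0(2)[OF that] Jr by auto
      qed (use Jz z0 zr in auto)
      have pz: "(br e ^^ k) x \<in> ?z" for k using x hz[OF e] by (induction k) auto
      have pC: "(br e ^^ k) x \<in> ?C k" for k
      proof (induction k)
        case 0
        then show ?case using x zr rh by auto
      next
        case (Suc k)
        then show ?case using br_in_lower_central_series[OF e] by simp
      qed
      obtain k where "?C k = {0}"
        using less.prems(2) by (auto simp: lie_nilpotent_def at_most_step_nilpotent_def)
      then have "(br e ^^ Suc k) x = 0" using pC[of k] by (simp add: br_simps)
      then have "(br e ^^ Suc 0) x = 0"
      proof (induction k)
        case (Suc k)
        have "(br e ^^ Suc k) x \<bullet> (br e ^^ Suc k) x = - ((br e ^^ k) x \<bullet> (br e ^^ Suc (Suc k)) x)"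
          using skew[OF pz pz, of k "Suc k"] by simp
        then show ?case using Suc by simp
      qed simp
      then show ?thesis by simp
    qed
    \<comment> \<open>the part of the second centre that lies in \<open>r\<close>, because the centre of \<open>r\<close> is central in \<open>h\<close>\<close>
    define N where "N = {x \<in> r. \<forall>e\<in>h. br e x \<in> ?z}"
    have JN: "J x \<in> N" if x: "x \<in> N" for x
    proof -
      have xr: "x \<in> r" and xh: "\<And>e. e \<in> h \<Longrightarrow> br e x \<in> ?z" using x by (auto simp: N_def)
      have "br e (J x) \<in> ?z" if e: "e \<in> h" for e
      proof (rule isotropic_central[OF r two Jz])
        let ?T = "J x" and ?f = "J e"
        let ?u = "br e ?T" and ?v = "br ?f ?T"
        have T: "?T \<in> r" "?T \<in> h" and f: "?f \<in> h" using Jr xr rh Jh e by auto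
        show ur: "?u \<in> r" using hr e T by blast
        have vr: "?v \<in> r" using hr f T by blast
        have "?v - J ?u = br e x + J (br ?f x)"
          using br_J_J[of e x] by simp
        then have "?v - J ?u \<in> ?z" using xh[OF e] xh[OF f] Jz subspace_add[OF sz] by simp
        from z0(2)[OF this ur] have uv: "br ?u (J ?u) = br ?u ?v"
          by (simp add: br_simps)
        \<comment> \<open>\<open>ad\<close> of \<open>e\<close> and of \<open>Je\<close> kill \<open>[T, v]\<close> and \<open>[T, u]\<close>, which gives two opposite values of \<open>[u, v]\<close>\<close>
        have 1: "br ?u ?v = - br ?T (br e ?v)"
          using jacobi[of e ?T ?v] hz0[OF e two[OF T(1) vr]] by (simp add: eq_neg_iff_add_eq_0)
        have "br ?v ?u = - br ?T (br ?f ?u)"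
          using jacobi[of ?f ?T ?u] hz0[OF f two[OF T(1) ur]] by (simp add: eq_neg_iff_add_eq_0)
        then have 2: "br ?u ?v = br ?T (br ?f ?u)" using br_anti[of ?u ?v] by simp
        have "br ?T (br e ?v) = br ?T (br ?f ?u)"
        proof -
          have "br (br e ?f) ?T \<in> ?z" using hr[OF e f] T two by blast
          from z0(2)[OF this T(1)] show ?thesis
            using jacobi[of e ?f ?T] by (simp add: br_simps)
        qed
        then have "br ?u ?v + br ?u ?v = 0" using 1 2 by (metis eq_neg_iff_add_eq_0)
        then show "br ?u (J ?u) = 0" using uv by (simp flip: scaleR_2)
      qed auto
      then show ?thesis using xr Jr by (simp add: N_def)
    qed
    have N1: "br q x = 0" if x: "x \<in> N" and q: "q \<in> ?C 1" for x q
    proof -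
      have "?C 1 \<subseteq> {q. br q x = 0}" unfolding One_nat_def
      proof (rule lower_central_series_Suc_subset)
        show "subspace {q. br q x = 0}" by (auto simp: subspace_def br_simps)
        fix a b assume a: "a \<in> h" and b: "b \<in> ?C 0"
        then have "br a (br b x) = 0" "br b (br a x) = 0" using hz0 x by (auto simp: N_def)
        then show "br a b \<in> {q. br q x = 0}" using jacobi[of a b x] by simp
      qed
      then show ?thesis using q by blast
    qed
    \<comment> \<open>for \<open>Jy = x\<close>, closedness of the torsion on \<open>(\<zeta>, a, b, y)\<close>, \<open>\<zeta>\<close> central, says \<open>[J[a,b], x]\<close> is orthogonal to \<open>\<zeta>\<close>\<close>
    have NJ1: "br (J q) x = 0" if x: "x \<in> N" and q: "q \<in> ?C 1" for x q
    proof -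
      have "?C 1 \<subseteq> {q. br (J q) x = 0}" unfolding One_nat_def
      proof (rule lower_central_series_Suc_subset)
        show "subspace {q. br (J q) x = 0}" by (auto simp: subspace_def br_simps J_simps)
        fix a b assume a: "a \<in> h" and "b \<in> ?C 0"
        then have b: "b \<in> h" by simp
        define y where "y = - J x"
        have yN: "y \<in> N" and Jy: "J y = x" 
          using JN[OF x] subspace_neg[OF sr] subspace_neg[OF sz] by (auto simp: y_def N_def br_simps J_simps)
        let ?\<zeta> = "br (J (br a b)) x"
        have "?\<zeta> \<in> ?z" using two Jr hr a b x by (auto simp: N_def)
        note \<zeta> = this Jz[OF this]
        have h0: "br ?\<zeta> q = 0" "br q ?\<zeta> = 0" "br (J ?\<zeta>) q = 0" "br q (J ?\<zeta>) = 0" if "q \<in> h" for q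
          using hz0[OF that] \<zeta> br_anti[of _ q] by auto
        have yz: "br a y \<in> ?z" "br b y \<in> ?z" using yN a b by (auto simp: N_def)
        have yz0: "br q (J (br a y)) = 0" "br q (J (br b y)) = 0" "br (J (br a y)) q = 0" "br (J (br b y)) q = 0" if "q \<in> h" for q
          using hz0[OF that] Jz yz br_anti[of _ q] by auto
        have yh: "y \<in> h" "x \<in> h" "J (br a b) \<in> h" using yN x rh Jh cl a b by (auto simp: N_def)
        have \<zeta>h: "?\<zeta> \<in> h" "J ?\<zeta> \<in> h" using \<zeta> zr rh by auto
        have "?\<zeta> \<bullet> ?\<zeta> = 0"
          using torsion_closed[of ?\<zeta> a b y] a b yh \<zeta>h h0 yz0 Jh
          by (simp add: torsion_def Jy br_simps J_simps)
        then show "br a b \<in> {q. br (J q) x = 0}" by simp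
      qed
      then show ?thesis using q by blast
    qed
    have Nz: "N \<subseteq> ?z"
    proof
      fix x assume x: "x \<in> N"
      have "br q x = 0" if "q \<in> r" for q
        using that N1[OF x] NJ1[OF x] unfolding r_def by (elim J_closureE) (simp add: br_simps)
      then show "x \<in> ?z" using x br_anti[of x] by (auto simp: lie_center_def N_def)
    qed
    \<comment> \<open>climb the lower central series from zero: an element whose brackets with \<open>h\<close> lie in \<open>z\<close> belongs to \<open>N\<close>\<close>
    have "r \<inter> ?C k \<subseteq> ?z" for k
    proof -
      have step: "r \<inter> ?C k \<subseteq> ?z" if "r \<inter> ?C (Suc k) \<subseteq> ?z" for k
      proof -
        have "br e x \<in> ?z" if "x \<in> r \<inter> ?C k" "e \<in> h" for e x
          using br_in_lower_central_series[OF that(2), of x k] that hr[OF that(2), of x] rh \<open>r \<inter> ?C (Suc k) \<subseteq> ?z\<close>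
          by blast
        then show ?thesis using Nz by (auto simp: N_def)
      qed
      obtain m where "?C m = {0}"
        using less.prems(2) by (auto simp: lie_nilpotent_def at_most_step_nilpotent_def)
      then have "r \<inter> ?C m \<subseteq> ?z" using subspace_0[OF sz] by auto
      then have "r \<inter> ?C 0 \<subseteq> ?z" by (induction m) (use step in blast)+
      then show ?thesis using Ch[of k] rh by auto
    qed
    from this[of 0] have "r \<subseteq> ?z" using rh by auto
    have "?C (Suc 1) \<subseteq> {0}"
    proof (rule lower_central_series_Suc_subset)
      fix x y assume "x \<in> h" "y \<in> ?C 1"
      then show "br x y \<in> {0}" using hz0 rI(1) \<open>r \<subseteq> ?z\<close> by blast
    qed simp
    then show ?thesis using subspace_0[OF sC[of 2]]
      by (auto simp: at_most_step_nilpotent_def numeral_2_eq_2)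
  qed
qed

end

section \<open>Alternating forms and Cartan's formula\<close>

abbreviation contract :: "'a \<Rightarrow> ('a list \<Rightarrow> real) \<Rightarrow> 'a list \<Rightarrow> real" where
  "contract x \<beta> \<equiv> \<lambda>xs. \<beta> (x # xs)"

text \<open>
  Multilinear alternating forms of degree \<open>k\<close>, described through the first argument and
  contractions. This recursive shape lets every statement about forms be proved by induction on
  the degree, without reference to positions in the argument list.
\<close>

primrec alternating :: "nat \<Rightarrow> ('a::euclidean_space list \<Rightarrow> real) \<Rightarrow> bool" where
  "alternating 0 \<beta> = True"
| "alternating (Suc k) \<beta> \<longleftrightarrow>
     (\<forall>xs. length xs = k \<longrightarrow> linear (\<lambda>x. \<beta> (x # xs))) \<and>
     (\<forall>x xs. Suc (length xs) = k \<longrightarrow> \<beta> (x # x # xs) = 0) \<and>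
     (\<forall>x. alternating k (contract x \<beta>))"

lemma alternating_contract: "alternating (Suc k) \<beta> \<Longrightarrow> alternating k (contract x \<beta>)"
  by simp

lemma alternating_linear: "alternating (Suc k) \<beta> \<Longrightarrow> length xs = k \<Longrightarrow> linear (\<lambda>x. \<beta> (x # xs))"
  by simp

lemma alternating_repeat: "alternating (Suc (Suc k)) \<beta> \<Longrightarrow> length xs = k \<Longrightarrow> \<beta> (x # x # xs) = 0"
  by simp

lemma alternating_cong:
  assumes "\<And>xs. length xs = k \<Longrightarrow> \<beta> xs = \<gamma> xs" "alternating k \<beta>"
  shows "alternating k \<gamma>"
  using assms
proof (induction k arbitrary: \<beta> \<gamma>)
  case (Suc k)
  have "linear (\<lambda>x. \<gamma> (x # xs))" if "length xs = k" for xs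
  proof -
    have "(\<lambda>x. \<gamma> (x # xs)) = (\<lambda>x. \<beta> (x # xs))" using Suc.prems(1) that by auto
    then show ?thesis using Suc.prems(2) that by simp
  qed
  moreover have "\<gamma> (x # x # xs) = 0" if "Suc (length xs) = k" for x xs
    using Suc.prems(1)[of "x # x # xs"] Suc.prems(2) that by simp
  moreover have "alternating k (contract x \<gamma>)" for x
    by (rule Suc.IH[of "contract x \<beta>"]) (use Suc.prems in auto)
  ultimately show ?case by simp
qed simp

lemma alternating_add:
  "alternating k \<beta> \<Longrightarrow> alternating k \<gamma> \<Longrightarrow> alternating k (\<lambda>xs. \<beta> xs + \<gamma> xs)"
  by (induction k arbitrary: \<beta> \<gamma>) (auto intro: linear_compose_add)

lemma alternating_scale: "alternating k \<beta> \<Longrightarrow> alternating k (\<lambda>xs. c * \<beta> xs)"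
  by (induction k arbitrary: \<beta>) (auto intro: linear_compose_scale_right[where 'a = real, unfolded real_scaleR_def] 
     simp: linear_iff algebra_simps)

lemma alternating_zero: "alternating k (\<lambda>xs. 0)"
  by (induction k) (auto simp: linear_zero)

lemma alternating_swap:
  assumes a: "alternating (Suc (Suc k)) \<beta>" and k: "length xs = k"
  shows "\<beta> (x # y # xs) = - \<beta> (y # x # xs)"
proof -
  have 1: "\<beta> ((p + q) # ys) = \<beta> (p # ys) + \<beta> (q # ys)" if "length ys = Suc k" for p q ys
    using linear_add[OF alternating_linear[OF a that]] .
  have 2: "\<beta> (p # (r + s) # xs) = \<beta> (p # r # xs) + \<beta> (p # s # xs)" for p r s
    using linear_add[OF alternating_linear[OF alternating_contract[OF a] k]] .
  have "\<beta> ((x + y) # (x + y) # xs) =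
      \<beta> (x # x # xs) + \<beta> (x # y # xs) + (\<beta> (y # x # xs) + \<beta> (y # y # xs))"
    using k by (simp add: 1 2)
  then show ?thesis using alternating_repeat[OF a k] by simp
qed

lemma alternating_slot_linear:
  assumes "alternating k \<beta>" "length xs = k" "i < k"
  shows "linear (\<lambda>x. \<beta> (xs[i := x]))"
  using assms
proof (induction k arbitrary: \<beta> xs i)
  case (Suc k)
  then obtain y ys where xs: "xs = y # ys" "length ys = k" by (cases xs) auto
  show ?case
  proof (cases i)
    case 0
    then show ?thesis using Suc.prems xs by simp
  next
    case (Suc j)
    then show ?thesis using Suc.IH[OF alternating_contract[OF Suc.prems(1)] xs(2), of j y] Suc.prems xs by simp
  qed
qed simp

lemma alternating_swap_head:
  assumes "alternating (Suc k) \<beta>" "length ys = k" "j < k"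
  shows "\<beta> (ys ! j # ys[j := y]) = - \<beta> (y # ys)"
proof -
  have rep: "\<beta> (z # ys[j := z]) = 0" if "alternating (Suc k) \<beta>" "length ys = k" "j < k" for \<beta> k ys j z
    using that
  proof (induction k arbitrary: \<beta> ys j)
    case (Suc k)
    then obtain t ts where ys: "ys = t # ts" "length ts = k" by (cases ys) auto
    show ?case
    proof (cases j)
      case 0
      then show ?thesis using Suc.prems ys by simp
    next
      case j: (Suc i)
      have "\<beta> (z # t # ts[i := z]) = - \<beta> (t # z # ts[i := z])"
        by (rule alternating_swap[OF Suc.prems(1)]) (simp add: ys)
      moreover have "contract t \<beta> (z # ts[i := z]) = 0"
        by (rule Suc.IH[OF alternating_contract[OF Suc.prems(1)] ys(2)]) (use j Suc.prems in simp)
      ultimately show ?thesis using j ys by simp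
    qed
  qed simp
  let ?x = "ys ! j"
  have 1: "\<beta> ((?x + y) # zs) = \<beta> (?x # zs) + \<beta> (y # zs)" if "length zs = k" for zs
    using linear_add[OF alternating_linear[OF assms(1) that]] .
  have 2: "\<beta> (p # ys[j := ?x + y]) = \<beta> (p # ys[j := ?x]) + \<beta> (p # ys[j := y])" for p
    using linear_add[OF alternating_slot_linear[OF alternating_contract[OF assms(1)] assms(2,3)]] .
  have "\<beta> ((?x + y) # ys[j := ?x + y]) = \<beta> (?x # ys[j := ?x]) + \<beta> (?x # ys[j := y]) +
      (\<beta> (y # ys[j := ?x]) + \<beta> (y # ys[j := y]))"
    using assms(2) unfolding 2 by (simp add: 1)
  then show ?thesis using rep[OF assms, of "?x + y"] rep[OF assms, of ?x] rep[OF assms, of y] by simp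
qed

lemma alternating_move_head:
  assumes "alternating k \<beta>" "length xs = k" "j < k"
  shows "\<beta> (y # nths xs (- {j})) = (- 1) ^ j * \<beta> (xs[j := y])"
  using assms
proof (induction k arbitrary: \<beta> xs j)
  case (Suc k)
  then obtain t ts where xs: "xs = t # ts" "length ts = k" by (cases xs) auto
  show ?case
  proof (cases j)
    case 0
    have "nths ts {j. Suc j \<in> - {0}} = ts" by (simp add: nths_all)
    then show ?thesis using 0 xs by (simp add: nths_Cons)
  next
    case j: (Suc i)
    have e: "{j. Suc j \<in> - {Suc i}} = - {i}" by auto
    have l: "Suc (length (nths ts (- {i}))) = k"
    proof -
      have "{m. m < k \<and> m \<in> - {i}} = {..<k} - {i}" by auto
      then show ?thesis using xs(2) j Suc.prems(3) by (simp add: length_nths)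
    qed
    then obtain m where m: "k = Suc m" "length (nths ts (- {i})) = m" by (cases k) auto
    have "\<beta> (y # t # nths ts (- {i})) = - \<beta> (t # y # nths ts (- {i}))"
      by (rule alternating_swap[OF Suc.prems(1)[unfolded m(1)] m(2)])
    also have "\<beta> (t # y # nths ts (- {i})) = (- 1) ^ i * \<beta> (t # ts[i := y])"
      by (rule Suc.IH[OF alternating_contract[OF Suc.prems(1)] xs(2)]) (use j Suc.prems in simp)
    finally show ?thesis using xs j e by (simp add: nths_Cons)
  qed
qed simp

text \<open>
  Splitting the first argument as \<open>w + c u\<close> reduces the claim to the contractions of \<open>\<beta>\<close> with \<open>w\<close> and
  with \<open>u\<close>; both inherit the assumptions in lower degree, the second because an alternating form
  vanishes when \<open>u\<close> occurs twice.
\<close>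

lemma alternating_vanish_insert:
  assumes "alternating k \<beta>"
    and "\<And>xs. length xs = k \<Longrightarrow> set xs \<subseteq> span S \<Longrightarrow> \<beta> xs = 0"
    and "\<And>xs. Suc (length xs) = k \<Longrightarrow> set xs \<subseteq> span S \<Longrightarrow> \<beta> (u # xs) = 0"
    and "length xs = k" "set xs \<subseteq> span (insert u S)"
  shows "\<beta> xs = 0"
  using assms
proof (induction k arbitrary: \<beta> xs)
  case 0
  then show ?case by simp
next
  case (Suc k)
  obtain y ys where xs: "xs = y # ys" "length ys = k" using Suc.prems(4) by (cases xs) auto
  obtain c where w: "y - c *\<^sub>R u \<in> span S" using Suc.prems(5) xs span_breakdown_eq[of y u S] by auto
  let ?w = "y - c *\<^sub>R u"
  note lin = alternating_linear[OF Suc.prems(1) xs(2)]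
  have ys: "set ys \<subseteq> span (insert u S)" using Suc.prems(5) xs by simp
  have "\<beta> (u # ys) = 0"
  proof (rule Suc.IH[of "contract u \<beta>", OF alternating_contract[OF Suc.prems(1)] _ _ xs(2) ys])
    show "\<beta> (u # zs) = 0" if "length zs = k" "set zs \<subseteq> span S" for zs
      using Suc.prems(3) that by simp
    show "\<beta> (u # u # zs) = 0" if "Suc (length zs) = k" for zs
      using Suc.prems(1) that by simp
  qed
  moreover have "\<beta> (?w # ys) = 0"
  proof (rule Suc.IH[of "contract ?w \<beta>", OF alternating_contract[OF Suc.prems(1)] _ _ xs(2) ys])
    show "\<beta> (?w # zs) = 0" if "length zs = k" "set zs \<subseteq> span S" for zs
      using Suc.prems(2)[of "?w # zs"] that w by simp
    show "\<beta> (?w # u # zs) = 0" if zs: "Suc (length zs) = k" "set zs \<subseteq> span S" for zs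
    proof -
      obtain m where m: "k = Suc m" "length zs = m" using zs by (cases k) auto
      show ?thesis
        using alternating_swap[OF Suc.prems(1)[unfolded m(1)] m(2), of ?w u] Suc.prems(3)[of "?w # zs"] that w
        by simp
    qed
  qed
  moreover have "\<beta> (y # ys) = \<beta> (?w # ys) + c * \<beta> (u # ys)"
    using linear_add[OF lin, of ?w "c *\<^sub>R u"] linear_cmul[OF lin, of c u] by simp
  ultimately show ?case using xs by simp
qed

text \<open>
  A form whose degree exceeds the dimension vanishes, and a form of top degree is determined by
  its value on a basis.
\<close>

lemma alternating_vanish_span:
  assumes "alternating k \<beta>" "length es \<le> k" "length es = k \<Longrightarrow> \<beta> es = 0"
    and "length xs = k" "set xs \<subseteq> span (set es)"
  shows "\<beta> xs = 0"
  using assms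
proof (induction es arbitrary: k \<beta> xs)
  case Nil
  show ?case
  proof (cases xs)
    case Nil
    then show ?thesis using Nil.prems by simp
  next
    case (Cons y ys)
    then have "y = 0" using Nil.prems by simp
    then show ?thesis using linear_0[of "\<lambda>x. \<beta> (x # ys)"] Nil.prems Cons by auto
  qed
next
  case (Cons e es)
  obtain m where m: "k = Suc m" using Cons.prems(2) by (cases k) auto
  show ?case
  proof (rule alternating_vanish_insert[OF Cons.prems(1), where S = "set es" and u = e])
    show "\<beta> zs = 0" if "length zs = k" "set zs \<subseteq> span (set es)" for zs
      using Cons.IH[OF Cons.prems(1) _ _ that] Cons.prems(2) by simp
    show "\<beta> (e # zs) = 0" if "Suc (length zs) = k" "set zs \<subseteq> span (set es)" for zs
      using Cons.IH[of m "contract e \<beta>" zs] Cons.prems m that by simp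
  qed (use Cons.prems in auto)
qed

text \<open>
  The derivation of forms extending \<open>f\<close>; for \<open>f = ad\<^sub>x\<close> it is minus the Lie derivative along \<open>x\<close>.
\<close>

definition lie_derivative_sum :: "('a \<Rightarrow> 'a) \<Rightarrow> ('a list \<Rightarrow> real) \<Rightarrow> 'a list \<Rightarrow> real" where
  "lie_derivative_sum f \<beta> xs = (\<Sum>i<length xs. \<beta> (xs[i := f (xs ! i)]))"

lemma lie_derivative_sum_Cons:
  "lie_derivative_sum f \<beta> (x # xs) = \<beta> (f x # xs) + lie_derivative_sum f (contract x \<beta>) xs"
  unfolding lie_derivative_sum_def by (simp add: sum.lessThan_Suc_shift del: sum.lessThan_Suc)

lemma lie_derivative_sum_zero:
  assumes "\<And>ys. length ys = length xs \<Longrightarrow> set ys \<subseteq> set xs \<union> f ` set xs \<Longrightarrow> \<beta> ys = 0"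
  shows "lie_derivative_sum f \<beta> xs = 0"
  unfolding lie_derivative_sum_def
proof (intro sum.neutral ballI assms)
  fix i assume "i \<in> {..<length xs}"
  then show "set (xs[i := f (xs ! i)]) \<subseteq> set xs \<union> f ` set xs"
    using set_update_subset_insert[of xs i "f (xs ! i)"] by auto
qed simp

lemma alternating_lie_derivative_sum:
  assumes "linear f" "alternating k \<beta>"
  shows "alternating k (lie_derivative_sum f \<beta>)"
  using assms(2)
proof (induction k arbitrary: \<beta>)
  case (Suc k)
  have "alternating k (contract x (lie_derivative_sum f \<beta>))" for x
    unfolding lie_derivative_sum_Cons
    by (intro alternating_add Suc.IH alternating_contract[OF Suc.prems])
  moreover have "linear (\<lambda>x. lie_derivative_sum f \<beta> (x # xs))" if "length xs = k" for xs
    unfolding lie_derivative_sum_Cons unfolding lie_derivative_sum_def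
    using linear_compose[OF assms(1) alternating_linear[OF Suc.prems that], unfolded o_def]
    by (intro linear_compose_add linear_compose_sum ballI)
       (use Suc.prems that in auto)
  moreover have "lie_derivative_sum f \<beta> (x # x # xs) = 0" if l: "Suc (length xs) = k" for x xs
  proof -
    obtain m where m: "k = Suc m" "length xs = m" using l by (cases k) auto
    have "lie_derivative_sum f (contract x (contract x \<beta>)) xs = 0"
      by (rule lie_derivative_sum_zero) (use Suc.prems l in auto)
    then show ?thesis
      using alternating_swap[OF Suc.prems[unfolded m(1)] m(2), of x "f x"]
      by (simp add: lie_derivative_sum_Cons)
  qed
  ultimately show ?case by simp
qed simp

lemma length_nths_minus_pair:
  assumes "i < j" "j < length xs"
  shows "Suc (Suc (length (nths xs (- {i, j})))) = length xs"
proof -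
  have "{m. m < length xs \<and> m \<in> - {i, j}} = {..<length xs} - {i, j}" by auto
  then show ?thesis using assms by (simp add: length_nths)
qed

lemma ce_d_zero:
  assumes "\<And>ys. Suc (length ys) = length xs \<Longrightarrow> set ys \<subseteq> set xs \<union> {br x y | x y. x \<in> set xs \<and> y \<in> set xs} \<Longrightarrow> \<beta> ys = 0"
  shows "ce_d br \<beta> xs = 0"
  unfolding ce_d_def
proof (intro sum.neutral ballI)
  fix j i assume "j \<in> {..<length xs}" "i \<in> {..<j}"
  then have ij: "i < j" "j < length xs" by auto
  then have "\<beta> (br (xs ! i) (xs ! j) # nths xs (- {i, j})) = 0"
    using length_nths_minus_pair[OF ij]
    by (intro assms) (auto dest: in_set_nthsD, (metis nth_mem order_less_trans)+)
  then show "(- 1) ^ (i + j) * \<beta> (br (xs ! i) (xs ! j) # nths xs (- {i, j})) = 0" by simp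
qed

lemma ce_d_diff: "ce_d br (\<lambda>ys. \<beta> ys - c * \<gamma> ys) xs = ce_d br \<beta> xs - c * ce_d br \<gamma> xs"
  by (simp add: ce_d_def sum_subtractf[symmetric] sum_distrib_left right_diff_distrib mult.left_commute)

text \<open>
  Cartan's formula \<open>\<iota>\<^sub>x d = L\<^sub>x - d \<iota>\<^sub>x\<close>: in the defining sum of \<open>d\<close> the pairs that involve the first
  argument make up the Lie derivative and the remaining ones the differential of the contraction.
\<close>

lemma ce_d_Cons:
  assumes "alternating (length xs) \<beta>"
  shows "ce_d br \<beta> (x # xs) = - lie_derivative_sum (br x) \<beta> xs - ce_d br (contract x \<beta>) xs"
proof -
  have 1: "\<beta> (br x (xs ! j) # nths (x # xs) (- {0, Suc j})) = (- 1) ^ j * \<beta> (xs[j := br x (xs ! j)])"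
    if "j < length xs" for j
  proof -
    have "{m. Suc m \<in> - {0, Suc j}} = - {j}" by auto
    then show ?thesis using alternating_move_head[OF assms _ that] by (simp add: nths_Cons)
  qed
  have 2: "\<beta> (y # nths (x # xs) (- {Suc i, Suc j})) = - contract x \<beta> (y # nths xs (- {i, j}))"
    if ij: "i < j" "j < length xs" for i j y
  proof -
    have e: "{m. Suc m \<in> - {Suc i, Suc j}} = - {i, j}" by auto
    obtain m where m: "length xs = Suc (Suc m)" "length (nths xs (- {i, j})) = m"
      using length_nths_minus_pair[OF ij] by auto
    show ?thesis using alternating_swap[OF assms[unfolded m(1)] m(2), of y x] e by (simp add: nths_Cons)
  qed
  have "ce_d br \<beta> (x # xs) = (\<Sum>j<length xs. \<Sum>i<Suc j. (- 1) ^ (i + Suc j) *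
      \<beta> (br ((x # xs) ! i) (xs ! j) # nths (x # xs) (- {i, Suc j})))"
    unfolding ce_d_def by (simp add: sum.lessThan_Suc_shift del: sum.lessThan_Suc)
  also have "\<dots> = (\<Sum>j<length xs. - \<beta> (xs[j := br x (xs ! j)]) +
      (\<Sum>i<j. - ((- 1) ^ (i + j) * contract x \<beta> (br (xs ! i) (xs ! j) # nths xs (- {i, j})))))"
  proof (rule sum.cong[OF refl])
    fix j assume "j \<in> {..<length xs}"
    then have j: "j < length xs" by simp
    have "(- 1) ^ Suc j * ((- 1) ^ j * b) = - b" for b :: real
      by (simp add: power_mult_distrib[symmetric] mult.assoc[symmetric])
    then show "(\<Sum>i<Suc j. (- 1) ^ (i + Suc j) * \<beta> (br ((x # xs) ! i) (xs ! j) # nths (x # xs) (- {i, Suc j})))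
       = - \<beta> (xs[j := br x (xs ! j)]) +
      (\<Sum>i<j. - ((- 1) ^ (i + j) * contract x \<beta> (br (xs ! i) (xs ! j) # nths xs (- {i, j}))))"
      using 1[OF j] 2[OF _ j] unfolding sum.lessThan_Suc_shift
      by (simp del: sum.lessThan_Suc)
  qed
  also have "\<dots> = - lie_derivative_sum (br x) \<beta> xs - ce_d br (contract x \<beta>) xs"
    by (simp add: sum.distrib sum_subtractf sum_negf lie_derivative_sum_def ce_d_def)
  finally show ?thesis .
qed

lemma alternating_ce_d:
  assumes "bilinear br" "\<And>x. br x x = 0" "alternating k \<beta>"
  shows "alternating (Suc k) (ce_d br \<beta>)"
  using assms(3)
proof (induction k arbitrary: \<beta>)
  case 0
  have "ce_d br \<beta> [x] = 0" for x by (simp add: ce_d_def)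
  then show ?case by (simp add: linear_zero)
next
  case (Suc k)
  have lb: "linear (br x)" "linear (\<lambda>x. br x y)" for x y using assms(1) by (auto simp: bilinear_def)
  have C: "ce_d br \<beta> (x # xs) = - 1 * lie_derivative_sum (br x) \<beta> xs + - 1 * ce_d br (contract x \<beta>) xs"
    if "length xs = Suc k" for x xs
    using ce_d_Cons[of xs \<beta> br x] Suc.prems that by simp
  have "alternating (Suc k) (contract x (ce_d br \<beta>))" for x
    by (rule alternating_cong[OF C[symmetric]], assumption)
       (intro alternating_add alternating_scale alternating_lie_derivative_sum[OF lb(1) Suc.prems]
          Suc.IH alternating_contract[OF Suc.prems])
  moreover have "linear (\<lambda>x. ce_d br \<beta> (x # xs))" if l: "length xs = Suc k" for xs
  proof -
    have s: "linear (\<lambda>x. c * g x)" if "linear g" for c and g :: "'a \<Rightarrow> real"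
      using that by (simp add: linear_iff algebra_simps)
    have 1: "linear (\<lambda>x. \<beta> (xs[i := br x (xs ! i)]))" if "i < length xs" for i
      using linear_compose[OF lb(2) alternating_slot_linear[OF Suc.prems l]] that l by (simp add: o_def)
    have 2: "linear (\<lambda>x. \<beta> (x # br (xs ! i) (xs ! j) # nths xs (- {i, j})))"
      if "i < j" "j < length xs" for i j
      using alternating_linear[OF Suc.prems] length_nths_minus_pair[OF that] l by simp
    show ?thesis unfolding C[OF l] unfolding lie_derivative_sum_def ce_d_def
      by (intro linear_compose_add s linear_compose_sum ballI) (auto intro: 1 2)
  qed
  moreover have "ce_d br \<beta> (x # x # xs) = 0" if "Suc (length xs) = Suc k" for x xs
  proof -
    have l: "length xs = k" using that by simp
    have "ce_d br (contract x (contract x \<beta>)) xs = 0"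
      by (rule ce_d_zero) (use Suc.prems l in auto)
    moreover have "\<beta> (br x x # xs) = 0"
      using linear_0[OF alternating_linear[OF Suc.prems l]] assms(2) by simp
    ultimately show ?thesis
      using ce_d_Cons[of "x # xs" \<beta> br x] ce_d_Cons[of xs "contract x \<beta>" br x] Suc.prems l
      by (simp add: lie_derivative_sum_Cons)
  qed
  ultimately show ?case by simp
qed

section \<open>Contraction of a wedge product\<close>

text \<open>
  Every permutation that sends \<open>r\<close> to \<open>0\<close> is uniquely a permutation of the positive indices composed
  with any chosen \<open>c r\<close> that sends \<open>r\<close> to \<open>0\<close>. The freedom in \<open>c\<close> is what makes the signs come out
  directly in the contraction formula.
\<close>

lemma sum_permutations_by_preimage_of_0:
  fixes g :: "(nat \<Rightarrow> nat) \<Rightarrow> real"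
  assumes c: "\<And>r. r < Suc M \<Longrightarrow> c r permutes {..<Suc M}" "\<And>r. r < Suc M \<Longrightarrow> c r r = 0"
  shows "(\<Sum>\<sigma> | \<sigma> permutes {..<Suc M}. g \<sigma>) =
    (\<Sum>r<Suc M. \<Sum>\<tau> | \<tau> permutes {..<M}. g (map_permutation {..<M} Suc \<tau> \<circ> c r))"
proof -
  define B where "B = {1..<Suc M}"
  have B: "finite B" "0 \<notin> B" "{..<Suc M} = insert 0 B" by (auto simp: B_def)
  have bB: "bij_betw Suc {..<M} B"
    by (rule bij_betw_byWitness[where f' = "\<lambda>n. n - 1"]) (auto simp: B_def)
  have "(\<Sum>\<sigma> | \<sigma> permutes {..<Suc M}. g \<sigma>) = (\<Sum>\<sigma> | \<sigma> permutes insert 0 B. g (inv \<sigma>))"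
    unfolding B(3) by (rule sum_permutations_inverse)
  also have "\<dots> = (\<Sum>b\<in>insert 0 B. \<Sum>q | q permutes B. g (inv (Transposition.transpose 0 b \<circ> q)))"
    by (rule sum_over_permutations_insert[OF B(1,2)])
  also have "\<dots> = (\<Sum>b\<in>insert 0 B. \<Sum>\<tau> | \<tau> permutes {..<M}. g (map_permutation {..<M} Suc \<tau> \<circ> c b))"
  proof (rule sum.cong[OF refl])
    fix b assume "b \<in> insert 0 B"
    then have b: "b < Suc M" using B(3) by auto
    define d where "d = c b \<circ> Transposition.transpose 0 b"
    have dB: "d permutes B"
    proof (rule permutes_superset)
      show "d permutes {..<Suc M}" unfolding d_def
        by (rule permutes_compose[OF permutes_swap_id c(1)[OF b]]) (use b in auto)
      show "d x = x" if "x \<in> {..<Suc M} - B" for x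
      proof -
        have "x = 0" using that by (auto simp: B_def)
        then show ?thesis using c(2)[OF b] by (simp add: d_def)
      qed
    qed
    have "(\<Sum>q | q permutes B. g (inv (Transposition.transpose 0 b \<circ> q))) = (\<Sum>q | q permutes B. g (inv q \<circ> Transposition.transpose 0 b))"
    proof (rule sum.cong[OF refl])
      fix q assume "q \<in> {q. q permutes B}"
      then have "bij q" by (auto intro: permutes_bij)
      then show "g (inv (Transposition.transpose 0 b \<circ> q)) = g (inv q \<circ> Transposition.transpose 0 b)"
        by (simp add: o_inv_distrib)
    qed
    also have "\<dots> = (\<Sum>q | q permutes B. g (q \<circ> Transposition.transpose 0 b))"
      by (rule sum_permutations_inverse[symmetric])
    also have "\<dots> = (\<Sum>q | q permutes B. g (q \<circ> d \<circ> Transposition.transpose 0 b))"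
      by (rule sum_permutations_compose_right[OF dB])
    also have "\<dots> = (\<Sum>q | q permutes B. g (q \<circ> c b))"
      by (simp add: d_def o_assoc[symmetric])
    also have "\<dots> = (\<Sum>\<tau> | \<tau> permutes {..<M}. g (map_permutation {..<M} Suc \<tau> \<circ> c b))"
    proof (rule sum.reindex_bij_betw[symmetric])
      have "(\<lambda>\<pi> x. if x \<in> B then Suc (\<pi> (inv_into {..<M} Suc x)) else x) = map_permutation {..<M} Suc"
        using bB by (auto simp: map_permutation_def restrict_id_def fun_eq_iff bij_betw_def)
      then show "bij_betw (map_permutation {..<M} Suc) {\<tau>. \<tau> permutes {..<M}} {q. q permutes B}"
        using bij_betw_permutations[OF bB] by simp
    qed
    finally show "(\<Sum>q | q permutes B. g (inv (Transposition.transpose 0 b \<circ> q))) =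
      (\<Sum>\<tau> | \<tau> permutes {..<M}. g (map_permutation {..<M} Suc \<tau> \<circ> c b))" .
  qed
  finally show ?thesis unfolding B(3) .
qed

primrec shift_cycle :: "nat \<Rightarrow> nat \<Rightarrow> nat" where
  "shift_cycle 0 = id"
| "shift_cycle (Suc p) = shift_cycle p \<circ> Transposition.transpose p (Suc p)"

lemma shift_cycle_apply: "shift_cycle p i = (if i < p then Suc i else if i = p then 0 else i)"
  by (induction p arbitrary: i) (auto simp: Transposition.transpose_def)

lemma shift_cycle_permutes: "p < n \<Longrightarrow> shift_cycle p permutes {..<n}"
proof (induction p)
  case (Suc p)
  then show ?case unfolding shift_cycle.simps
    by (intro permutes_compose[OF permutes_swap_id]) auto
qed (simp add: permutes_id)

lemma sign_shift_cycle: "sign (shift_cycle p) = (- 1) ^ p"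
proof (induction p)
  case (Suc p)
  have "permutation (shift_cycle p)"
    using shift_cycle_permutes[of p "Suc p"] by (auto simp: permutation_permutes)
  then show ?case unfolding shift_cycle.simps using Suc
    by (subst sign_compose) (simp_all add: permutation_swap_id sign_swap_id)
qed simp

lemma alternating_transpose_0:
  assumes a: "alternating p \<alpha>" and r: "r < p"
  shows "\<alpha> (map (\<lambda>i. v (Transposition.transpose 0 r i)) [0..<p]) = of_int (sign (Transposition.transpose 0 r)) * \<alpha> (map v [0..<p])"
proof (cases r)
  case 0
  then show ?thesis by simp
next
  case (Suc j)
  obtain k where p: "p = Suc k" using r by (cases p) auto
  let ?ys = "map (\<lambda>i. v (Suc i)) [0..<k]"
  have j: "j < k" using r p Suc by simp
  have "\<alpha> (?ys ! j # ?ys[j := v 0]) = - \<alpha> (v 0 # ?ys)"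
    by (rule alternating_swap_head) (use a p j in auto)
  moreover have "map v [0..<p] = v 0 # ?ys"
    unfolding p by (simp add: upt_conv_Cons map_Suc_upt[symmetric] o_def del: upt_Suc)
  moreover have "map (\<lambda>i. v (Transposition.transpose 0 r i)) [0..<p] = ?ys ! j # ?ys[j := v 0]"
  proof (rule nth_equalityI)
    fix i assume "i < length (map (\<lambda>i. v (Transposition.transpose 0 r i)) [0..<p])"
    then have "i < p" by simp
    then show "map (\<lambda>i. v (Transposition.transpose 0 r i)) [0..<p] ! i = (?ys ! j # ?ys[j := v 0]) ! i"
      using p j Suc by (cases i) (auto simp: Transposition.transpose_def nth_list_update simp del: upt_Suc)
  qed (simp add: p)
  ultimately show ?thesis using Suc by (simp add: sign_swap_id)
qed

text \<open>
  The permutations are sorted by the position \<open>r\<close> in which \<open>x\<close> is used. If \<open>r < p\<close>, a transposition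
  brings \<open>x\<close> to the front of the arguments of \<open>\<alpha>\<close>. Otherwise the cycle \<open>shift_cycle p\<close>, of sign
  \<open>(-1)\<^sup>p\<close>, moves \<open>x\<close> past the arguments of \<open>\<alpha>\<close>, and a transposition brings it to the front of those
  of \<open>\<beta>\<close>. All \<open>p\<close> positions of the first kind contribute equally, and so do the \<open>q\<close> of the
  second, which turns \<open>p! q!\<close> into the normalisations of the two contracted products.
\<close>

lemma wedge_Cons:
  assumes a: "alternating p \<alpha>" and b: "alternating q \<beta>" and l: "Suc (length xs) = p + q"
  shows "wedge p q \<alpha> \<beta> (x # xs) =
    (if p = 0 then 0 else wedge (p - 1) q (contract x \<alpha>) \<beta> xs) +
    (if q = 0 then 0 else (- 1) ^ p * wedge p (q - 1) \<alpha> (contract x \<beta>) xs)"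
proof -
  define M where "M = length xs"
  have pq: "p + q = Suc M" using l by (simp add: M_def)
  let ?L = "map_permutation {..<M} Suc"
  define ys where "ys = x # xs"
  define g where "g \<sigma> = of_int (sign \<sigma>) * \<alpha> (map (\<lambda>i. ys ! \<sigma> i) [0..<p]) * \<beta> (map (\<lambda>i. ys ! \<sigma> i) [p..<p + q])" for \<sigma>
  define c where "c r = (if r < p then Transposition.transpose 0 r else shift_cycle p \<circ> Transposition.transpose p r)" for r
  define S1 where "S1 = (\<Sum>\<tau> | \<tau> permutes {..<M}. of_int (sign \<tau>) *
      \<alpha> (x # map (\<lambda>i. xs ! \<tau> i) [0..<p - 1]) * \<beta> (map (\<lambda>i. xs ! \<tau> i) [p - 1..<p - 1 + q]))"
  define S2 where "S2 = (\<Sum>\<tau> | \<tau> permutes {..<M}. of_int (sign \<tau>) *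
      \<alpha> (map (\<lambda>i. xs ! \<tau> i) [0..<p]) * \<beta> (x # map (\<lambda>i. xs ! \<tau> i) [p..<p + (q - 1)]))"
  have cp: "c r permutes {..<Suc M}" if "r < Suc M" for r
  proof (cases "r < p")
    case False
    then have "p < Suc M" using that by simp
    then show ?thesis using False that
      by (auto simp: c_def intro!: permutes_compose[OF permutes_swap_id] shift_cycle_permutes)
  qed (use that in \<open>auto simp: c_def intro!: permutes_swap_id\<close>)
  have c0: "c r r = 0" for r by (simp add: c_def shift_cycle_apply)
  have L0: "?L \<tau> 0 = 0" for \<tau> by (auto simp: map_permutation_def restrict_id_def)
  have LS: "?L \<tau> (Suc j) = Suc (\<tau> j)" if "j < M" for \<tau> j
    using map_permutation_apply[of Suc "{..<M}" j] that by simp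
  have bij: "bij_betw Suc {..<M} {1..<Suc M}"
    by (rule bij_betw_byWitness[where f' = "\<lambda>n. n - 1"]) auto
  have sgn: "sign (?L \<tau> \<circ> d) = sign \<tau> * sign d" if "\<tau> permutes {..<M}" "d permutes {..<Suc M}" for \<tau> d
  proof -
    have "permutation (?L \<tau>)" using map_permutation_permutes[OF bij that(1)] by (auto simp: permutation_permutes)
    moreover have "permutation d" using that(2) by (auto simp: permutation_permutes)
    ultimately show ?thesis using that(1) by (simp add: sign_compose sign_map_permutation)
  qed
  have low: "(\<Sum>\<tau> | \<tau> permutes {..<M}. g (?L \<tau> \<circ> c r)) = S1" if r: "r < p" for r
    unfolding S1_def
  proof (rule sum.cong[OF refl])
    fix \<tau> assume "\<tau> \<in> {\<tau>. \<tau> permutes {..<M}}"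
    then have t: "\<tau> permutes {..<M}" by simp
    obtain k where p: "p = Suc k" using r by (cases p) auto
    have kM: "k \<le> M" using pq p by simp
    have "map (\<lambda>i. ys ! ?L \<tau> i) [0..<p] = ys ! ?L \<tau> 0 # map (\<lambda>i. ys ! ?L \<tau> (Suc i)) [0..<k]"
      unfolding p by (simp add: upt_conv_Cons map_Suc_upt[symmetric] o_def del: upt_Suc)
    also have "\<dots> = x # map (\<lambda>i. xs ! \<tau> i) [0..<k]"
      using kM by (auto simp: L0 LS ys_def)
    finally have 1: "map (\<lambda>i. ys ! ?L \<tau> i) [0..<p] = x # map (\<lambda>i. xs ! \<tau> i) [0..<k]" .
    have 2: "map (\<lambda>i. ys ! ?L \<tau> (Transposition.transpose 0 r i)) [p..<p + q] = map (\<lambda>i. xs ! \<tau> i) [k..<k + q]"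
    proof (rule nth_equalityI)
      fix i assume "i < length (map (\<lambda>i. ys ! ?L \<tau> (Transposition.transpose 0 r i)) [p..<p + q])"
      then have "i < q" by simp
      then show "map (\<lambda>i. ys ! ?L \<tau> (Transposition.transpose 0 r i)) [p..<p + q] ! i = map (\<lambda>i. xs ! \<tau> i) [k..<k + q] ! i"
        using r p pq LS[of "k + i" \<tau>] by (simp add: Transposition.transpose_def ys_def del: upt_Suc)
    qed (simp add: p)
    have "g (?L \<tau> \<circ> c r) = of_int (sign \<tau>) * of_int (sign (Transposition.transpose 0 r)) *
        \<alpha> (map (\<lambda>i. ys ! ?L \<tau> (Transposition.transpose 0 r i)) [0..<p]) * \<beta> (map (\<lambda>i. ys ! ?L \<tau> (Transposition.transpose 0 r i)) [p..<p + q])"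
      using r sgn[OF t cp[of r]] pq by (simp add: g_def c_def)
    then show "g (?L \<tau> \<circ> c r) = of_int (sign \<tau>) * \<alpha> (x # map (\<lambda>i. xs ! \<tau> i) [0..<p - 1]) *
        \<beta> (map (\<lambda>i. xs ! \<tau> i) [p - 1..<p - 1 + q])"
      using alternating_transpose_0[OF a r, of "\<lambda>i. ys ! ?L \<tau> i"] 1 2 p
      by (simp add: sign_swap_id)
  qed
  have high: "(\<Sum>\<tau> | \<tau> permutes {..<M}. g (?L \<tau> \<circ> c r)) = (- 1) ^ p * S2" if r: "\<not> r < p" "r < Suc M" for r
    unfolding S2_def sum_distrib_left
  proof (rule sum.cong[OF refl])
    fix \<tau> assume "\<tau> \<in> {\<tau>. \<tau> permutes {..<M}}"
    then have t: "\<tau> permutes {..<M}" by simp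
    define s where "s = r - p"
    have rs: "r = p + s" "s < q" using r pq by (auto simp: s_def)
    obtain k where q: "q = Suc k" using rs by (cases q) auto
    define v where "v i = ys ! ?L \<tau> (shift_cycle p (p + i))" for i
    have 1: "map (\<lambda>i. ys ! ?L \<tau> (c r i)) [0..<p] = map (\<lambda>i. xs ! \<tau> i) [0..<p]"
      using r pq by (auto simp: c_def Transposition.transpose_def shift_cycle_apply LS ys_def simp del: upt_Suc)
    have 2: "map (\<lambda>i. ys ! ?L \<tau> (c r i)) [p..<p + q] = map (\<lambda>i. v (Transposition.transpose 0 s i)) [0..<q]"
      by (rule nth_equalityI) (auto simp: c_def v_def rs Transposition.transpose_def simp del: upt_Suc)
    have "map v [0..<q] = v 0 # map (\<lambda>i. v (Suc i)) [0..<k]"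
      unfolding q by (simp add: upt_conv_Cons map_Suc_upt[symmetric] o_def del: upt_Suc)
    also have "\<dots> = x # map (\<lambda>i. xs ! \<tau> i) [p..<p + k]"
    proof -
      have "map (\<lambda>i. v (Suc i)) [0..<k] = map (\<lambda>i. xs ! \<tau> i) [p..<p + k]"
        using pq q LS by (intro nth_equalityI) (auto simp: v_def shift_cycle_apply ys_def simp del: upt_Suc)
      then show ?thesis by (simp add: v_def shift_cycle_apply L0 ys_def)
    qed
    finally have 3: "map v [0..<q] = x # map (\<lambda>i. xs ! \<tau> i) [p..<p + k]" .
    have pc: "permutation (shift_cycle p)"
      using shift_cycle_permutes[of p "Suc p"] by (auto simp: permutation_permutes)
    have "sign (c r) = (- 1) ^ p * sign (Transposition.transpose 0 s)"
      using r rs by (simp add: c_def sign_compose[OF pc] permutation_swap_id sign_shift_cycle sign_swap_id)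
    then show "g (?L \<tau> \<circ> c r) = (- 1) ^ p * (of_int (sign \<tau>) * \<alpha> (map (\<lambda>i. xs ! \<tau> i) [0..<p]) *
        \<beta> (x # map (\<lambda>i. xs ! \<tau> i) [p..<p + (q - 1)]))"
      unfolding g_def sgn[OF t cp[OF r(2)]]
      unfolding o_apply 1 2 alternating_transpose_0[OF b rs(2), of v] 3
      using q by (simp add: sign_swap_id)
  qed
  have "(\<Sum>\<sigma> | \<sigma> permutes {..<p + q}. g \<sigma>) = (\<Sum>r<Suc M. \<Sum>\<tau> | \<tau> permutes {..<M}. g (?L \<tau> \<circ> c r))"
    unfolding pq by (rule sum_permutations_by_preimage_of_0[OF cp c0])
  also have "\<dots> = (\<Sum>r<p + q. if r < p then S1 else (- 1) ^ p * S2)"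
    unfolding pq by (rule sum.cong) (auto simp: low high)
  also have "\<dots> = p * S1 + q * ((- 1) ^ p * S2)"
  proof -
    have "{..<p + q} \<inter> {r. r < p} = {..<p}" "{..<p + q} \<inter> - {r. r < p} = {p..<p + q}" by auto
    then show ?thesis by (simp add: sum.If_cases)
  qed
  finally have "wedge p q \<alpha> \<beta> (x # xs) = (p * S1 + q * ((- 1) ^ p * S2)) / (fact p * fact q)"
    by (simp add: wedge_def g_def ys_def)
  moreover have "p * S1 / (fact p * fact q) = wedge (p - 1) q (contract x \<alpha>) \<beta> xs" if "p \<noteq> 0"
  proof -
    have "p - 1 + q = M" using pq that by simp
    moreover have "fact p = real p * fact (p - 1)" using that by (simp add: fact_reduce)
    ultimately show ?thesis using that by (simp add: wedge_def S1_def)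
  qed
  moreover have "q * S2 / (fact p * fact q) = wedge p (q - 1) \<alpha> (contract x \<beta>) xs" if "q \<noteq> 0"
  proof -
    have "p + (q - 1) = M" using pq that by simp
    moreover have "fact q = real q * fact (q - 1)" using that by (simp add: fact_reduce)
    ultimately show ?thesis using that by (simp add: wedge_def S2_def)
  qed
  ultimately show ?thesis
    by (auto simp: add_divide_distrib mult.left_commute[of _ "(- 1) ^ p"] simp flip: times_divide_eq_right)
qed

lemma wedge_cong:
  assumes "\<And>l. length l = p \<Longrightarrow> set l \<subseteq> set xs \<Longrightarrow> \<alpha> l = \<alpha>' l"
    and "\<And>l. length l = q \<Longrightarrow> set l \<subseteq> set xs \<Longrightarrow> \<beta> l = \<beta>' l"
    and "length xs = p + q"
  shows "wedge p q \<alpha> \<beta> xs = wedge p q \<alpha>' \<beta>' xs"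
proof -
  have "\<alpha> (map (\<lambda>i. xs ! \<sigma> i) [0..<p]) = \<alpha>' (map (\<lambda>i. xs ! \<sigma> i) [0..<p]) \<and>
    \<beta> (map (\<lambda>i. xs ! \<sigma> i) [p..<p + q]) = \<beta>' (map (\<lambda>i. xs ! \<sigma> i) [p..<p + q])"
    if "\<sigma> permutes {..<p + q}" for \<sigma>
  proof -
    have "xs ! \<sigma> i \<in> set xs" if "i < p + q" for i
      using permutes_in_image[OF \<open>\<sigma> permutes _\<close>, of i] that assms(3) by simp
    then show ?thesis by (auto intro!: assms(1,2))
  qed
  then show ?thesis by (simp add: wedge_def)
qed

lemma wedge_zero_left:
  assumes "\<And>l. length l = p \<Longrightarrow> set l \<subseteq> set xs \<Longrightarrow> \<alpha> l = 0" "length xs = p + q"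
  shows "wedge p q \<alpha> \<beta> xs = 0"
proof -
  have "wedge p q \<alpha> \<beta> xs = wedge p q (\<lambda>_. 0) \<beta> xs" by (rule wedge_cong) (use assms in auto)
  then show ?thesis by (simp add: wedge_def)
qed

lemma wedge_zero_right:
  assumes "\<And>l. length l = q \<Longrightarrow> set l \<subseteq> set xs \<Longrightarrow> \<beta> l = 0" "length xs = p + q"
  shows "wedge p q \<alpha> \<beta> xs = 0"
proof -
  have "wedge p q \<alpha> \<beta> xs = wedge p q \<alpha> (\<lambda>_. 0) xs" by (rule wedge_cong) (use assms in auto)
  then show ?thesis by (simp add: wedge_def)
qed

lemma wedge_0:
  assumes "alternating q \<beta>" "length xs = q"
  shows "wedge 0 q \<alpha> \<beta> xs = \<alpha> [] * \<beta> xs"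
  using assms
proof (induction q arbitrary: \<beta> xs)
  case 0
  then show ?case by (simp add: wedge_def)
next
  case (Suc q)
  then obtain y ys where xs: "xs = y # ys" "length ys = q" by (cases xs) auto
  show ?case
    using wedge_Cons[OF alternating.simps(1)[THEN iffD2] Suc.prems(1), of ys \<alpha> y]
      Suc.IH[OF alternating_contract[OF Suc.prems(1)] xs(2)] xs by simp
qed

lemma alternating_wedge:
  assumes "alternating p \<alpha>" "alternating q \<beta>"
  shows "alternating (p + q) (wedge p q \<alpha> \<beta>)"
  using assms
proof (induction "p + q" arbitrary: p q \<alpha> \<beta>)
  case (Suc k)
  note C = wedge_Cons[OF Suc.prems]
  have pk: "p \<noteq> 0 \<Longrightarrow> k = (p - 1) + q" "q \<noteq> 0 \<Longrightarrow> k = p + (q - 1)" using Suc.hyps(2) by auto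
  have ca: "p \<noteq> 0 \<Longrightarrow> alternating (p - 1) (contract x \<alpha>)" for x using Suc.prems(1) by (cases p) auto
  have cb: "q \<noteq> 0 \<Longrightarrow> alternating (q - 1) (contract x \<beta>)" for x using Suc.prems(2) by (cases q) auto
  have s: "linear (\<lambda>x. c * g x)" "linear (\<lambda>x. g x * c)" "linear (\<lambda>x. g x / c)" if "linear g" for c and g :: "'a \<Rightarrow> real"
    using that by (simp_all add: linear_iff algebra_simps add_divide_distrib)
  have "alternating k (contract x (wedge p q \<alpha> \<beta>))" for x
  proof (rule alternating_cong[OF C[symmetric]])
    show "alternating k (\<lambda>xs. (if p = 0 then 0 else wedge (p - 1) q (contract x \<alpha>) \<beta> xs) +
        (if q = 0 then 0 else (- 1) ^ p * wedge p (q - 1) \<alpha> (contract x \<beta>) xs))"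
    proof (rule alternating_add)
      show "alternating k (\<lambda>xs. if p = 0 then 0 else wedge (p - 1) q (contract x \<alpha>) \<beta> xs)"
        using Suc.hyps(1)[OF pk(1) ca Suc.prems(2)] pk(1) by (cases "p = 0") (simp_all add: alternating_zero)
      show "alternating k (\<lambda>xs. if q = 0 then 0 else (- 1) ^ p * wedge p (q - 1) \<alpha> (contract x \<beta>) xs)"
        using Suc.hyps(1)[OF pk(2) Suc.prems(1) cb] pk(2)
        by (cases "q = 0") (simp_all add: alternating_zero alternating_scale)
    qed
  qed (use Suc.hyps(2) in simp)
  moreover have "linear (\<lambda>x. wedge p q \<alpha> \<beta> (x # xs))" if l: "length xs = k" for xs
  proof -
    have "linear (\<lambda>x. if p = 0 then 0 else wedge (p - 1) q (contract x \<alpha>) \<beta> xs)"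
    proof (cases p)
      case (Suc m)
      then show ?thesis unfolding wedge_def
        by (auto intro!: s linear_compose_sum simp: alternating_linear[OF Suc.prems(1)[unfolded Suc]])
    qed (simp add: linear_zero)
    moreover have "linear (\<lambda>x. if q = 0 then 0 else (- 1) ^ p * wedge p (q - 1) \<alpha> (contract x \<beta>) xs)"
    proof (cases q)
      case (Suc m)
      then show ?thesis unfolding wedge_def
        by (auto intro!: s linear_compose_sum simp: alternating_linear[OF Suc.prems(2)[unfolded Suc]])
    qed (simp add: linear_zero)
    ultimately show ?thesis using l Suc.hyps(2) by (simp add: C linear_compose_add)
  qed
  moreover have "wedge p q \<alpha> \<beta> (x # x # xs) = 0" if l: "Suc (length xs) = k" for x xs
  proof -
    have l1: "Suc (length (x # xs)) = p + q" using l Suc.hyps(2) by simp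
    have aa: "wedge (p - 1 - 1) q (contract x (contract x \<alpha>)) \<beta> xs = 0" if p1: "p - 1 \<noteq> 0"
    proof (rule wedge_zero_left)
      obtain m where m: "p = Suc (Suc m)" using p1 by (cases p; cases "p - 1") auto
      show "\<alpha> (x # x # ys) = 0" if "length ys = p - 1 - 1" for ys
        using alternating_repeat[OF Suc.prems(1)[unfolded m]] that m by simp
      show "length xs = p - 1 - 1 + q" using l1 m by simp
    qed
    have bb: "wedge p (q - 1 - 1) \<alpha> (contract x (contract x \<beta>)) xs = 0" if q1: "q - 1 \<noteq> 0"
    proof (rule wedge_zero_right)
      obtain m where m: "q = Suc (Suc m)" using q1 by (cases q; cases "q - 1") auto
      show "\<beta> (x # x # ys) = 0" if "length ys = q - 1 - 1" for ys
        using alternating_repeat[OF Suc.prems(2)[unfolded m]] that m by simp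
      show "length xs = p + (q - 1 - 1)" using l1 m by simp
    qed
    have 1: "wedge (p - 1) q (contract x \<alpha>) \<beta> (x # xs) =
       (if q = 0 then 0 else (- 1) ^ (p - 1) * wedge (p - 1) (q - 1) (contract x \<alpha>) (contract x \<beta>) xs)" if "p \<noteq> 0"
      using wedge_Cons[OF ca[OF that] Suc.prems(2), of xs x x] aa l1 that by auto
    have 2: "wedge p (q - 1) \<alpha> (contract x \<beta>) (x # xs) =
       (if p = 0 then 0 else wedge (p - 1) (q - 1) (contract x \<alpha>) (contract x \<beta>) xs)" if "q \<noteq> 0"
      using wedge_Cons[OF Suc.prems(1) cb[OF that], of xs x x] bb l1 that by auto
    show ?thesis unfolding C[OF l1] using 1 2 by (cases p) auto
  qed
  ultimately show ?case using Suc.hyps(2) by (metis alternating.simps(2))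
qed simp

section \<open>The balanced condition\<close>

lemma endo_trace_orthonormal_basis:
  fixes f :: "'a::euclidean_space \<Rightarrow> 'a"
  assumes f: "linear f" and B: "pairwise orthogonal B" "\<And>b. b \<in> B \<Longrightarrow> norm b = 1" "finite B" "span B = UNIV"
  shows "endo_trace f = (\<Sum>b\<in>B. f b \<bullet> b)"
proof -
  have ex: "(\<Sum>b\<in>B. (x \<bullet> b) *\<^sub>R b) = x" for x
    by (rule orthonormal_basis_expand[OF B(1,2) _ B(3)]) (use B(4) in auto)
  have "(\<Sum>b\<in>B. f b \<bullet> b) = (\<Sum>b\<in>B. \<Sum>e\<in>Basis. (f b \<bullet> e) * (e \<bullet> b))"
  proof (rule sum.cong[OF refl])
    fix b
    show "f b \<bullet> b = (\<Sum>e\<in>Basis. (f b \<bullet> e) * (e \<bullet> b))"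
      using euclidean_inner[of "f b" b] by (simp add: inner_commute[of b])
  qed
  also have "\<dots> = (\<Sum>e\<in>Basis. f (\<Sum>b\<in>B. (e \<bullet> b) *\<^sub>R b) \<bullet> e)"
    by (subst sum.swap) (simp add: linear_sum[OF f] linear_cmul[OF f] inner_sum_left mult.commute)
  finally show ?thesis by (simp add: ex endo_trace_def)
qed

text \<open>
  On a form of top degree the derivation extending \<open>f\<close> is multiplication by the trace of \<open>f\<close>. In the
  argument \<open>f e\<^sub>i\<close> of slot \<open>i\<close> only the component along \<open>e\<^sub>i\<close> counts: the other components leave
  the form with arguments in a subspace of smaller dimension.
\<close>

lemma lie_derivative_sum_trace_free:
  assumes b: "alternating (length es) \<beta>"
    and es: "distinct es" "pairwise orthogonal (set es)" "\<And>e. e \<in> set es \<Longrightarrow> norm e = 1"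
    and f: "linear f" "\<And>e. e \<in> set es \<Longrightarrow> f e \<in> span (set es)" and tr: "(\<Sum>e\<in>set es. f e \<bullet> e) = 0"
    and xs: "length xs = length es" "set xs \<subseteq> span (set es)"
  shows "lie_derivative_sum f \<beta> xs = 0"
proof (rule alternating_vanish_span[OF alternating_lie_derivative_sum[OF f(1) b] order_refl _ xs])
  have "\<beta> (es[i := f (es ! i)]) = (f (es ! i) \<bullet> es ! i) * \<beta> es" if i: "i < length es" for i
  proof -
    let ?e = "es ! i"
    let ?S = "set es - {?e}"
    define r where "r = (\<Sum>b\<in>?S. (f ?e \<bullet> b) *\<^sub>R b)"
    have e: "?e \<in> set es" using i by simp
    have "f ?e = (\<Sum>b\<in>set es. (f ?e \<bullet> b) *\<^sub>R b)"
      by (rule orthonormal_basis_expand[symmetric, OF es(2,3) f(2)[OF e]]) auto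
    also have "\<dots> = (f ?e \<bullet> ?e) *\<^sub>R ?e + r" unfolding r_def using e by (simp add: sum.remove)
    finally have fe: "f ?e = (f ?e \<bullet> ?e) *\<^sub>R ?e + r" .
    have S: "set (remove1 ?e es) = ?S" "length (remove1 ?e es) < length es"
      using es(1) e by (simp_all add: length_remove1)
        (metis Suc_pred length_pos_if_in_set lessI)?
    have "\<beta> (es[i := r]) = 0"
    proof (rule alternating_vanish_span[OF b, of "remove1 ?e es"])
      show "set (es[i := r]) \<subseteq> span (set (remove1 ?e es))"
      proof
        fix y assume "y \<in> set (es[i := r])"
        then obtain j where j: "j < length es" "y = es[i := r] ! j" by (auto simp: in_set_conv_nth)
        show "y \<in> span (set (remove1 ?e es))"
        proof (cases "j = i")
          case True
          have "r \<in> span ?S" unfolding r_def by (intro span_sum span_scale span_base)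
          then show ?thesis unfolding S(1) using j True by simp
        next
          case False
          then have "y = es ! j" "es ! j \<noteq> ?e" using j i es(1) by (auto simp: nth_eq_iff_index_eq)
          then show ?thesis unfolding S(1) using j by (auto intro!: span_base)
        qed
      qed
    qed (use S in auto)
    moreover have lin: "linear (\<lambda>x. \<beta> (es[i := x]))" by (rule alternating_slot_linear[OF b refl i])
    ultimately show ?thesis
      by (subst fe) (simp add: linear_add[OF lin] linear_cmul[OF lin])
  qed
  then have "lie_derivative_sum f \<beta> es = (\<Sum>i<length es. f (es ! i) \<bullet> es ! i) * \<beta> es"
    by (simp add: lie_derivative_sum_def sum_distrib_right)
  also have "(\<Sum>i<length es. f (es ! i) \<bullet> es ! i) = (\<Sum>e\<in>set es. f e \<bullet> e)"
    using bij_betw_nth[OF es(1), of "{..<length es}" "set es"] by (intro sum.reindex_bij_betw) auto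
  finally show "lie_derivative_sum f \<beta> es = 0" using tr by simp
qed

context almost_herm_lie
begin

abbreviation \<omega> :: "'a list \<Rightarrow> real" where "\<omega> \<equiv> fundamental_form J"

lemma fundamental_form_self: "J x \<bullet> x = 0"
  using J_skew[of x x] by (simp add: inner_commute)

lemma alternating_fundamental_form: "alternating 2 \<omega>"
  by (auto simp: numeral_2_eq_2 fundamental_form_def fundamental_form_self linear_iff J_simps
      inner_add_left inner_add_right length_Suc_conv)

lemma alternating_wedge_power: "alternating (k * 2) (wedge_power 2 \<omega> k)"
  using alternating_wedge[OF alternating_fundamental_form] by (induction k) simp_all

lemma wedge_power_normal:
  assumes u: "\<And>x. x \<in> h \<Longrightarrow> J u \<bullet> x = 0" and xs: "Suc (length xs) = k * 2" "set xs \<subseteq> h"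
  shows "wedge_power 2 \<omega> k (u # xs) = 0"
  using xs
proof (induction k arbitrary: xs)
  case (Suc k)
  let ?f = "wedge_power 2 \<omega> k"
  have "wedge 1 (k * 2) (contract u \<omega>) ?f xs = 0"
    by (rule wedge_zero_left) (use Suc.prems u in \<open>auto simp: fundamental_form_def length_Suc_conv\<close>)
  moreover have "wedge 2 (k * 2 - 1) \<omega> (contract u ?f) xs = 0" if "k \<noteq> 0"
    by (rule wedge_zero_right) (use Suc.prems Suc.IH that in auto)
  ultimately show ?case
    using wedge_Cons[OF alternating_fundamental_form alternating_wedge_power, of xs k u] Suc.prems
    by auto
qed simp

text \<open>
  This is the coefficient of \<open>u \<and> Ju\<close> in \<open>\<omega>\<^bsup>k+1\<^esup> = (\<omega>\<^sub>h + u \<and> Ju)\<^bsup>k+1\<^esup>\<close>, where \<open>u\<close> and \<open>Ju\<close> are identified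
  with their dual \<open>1\<close>-forms.
\<close>

lemma wedge_power_normal_plane:
  assumes u: "\<And>x. x \<in> h \<Longrightarrow> J u \<bullet> x = 0" "\<And>x. x \<in> h \<Longrightarrow> u \<bullet> x = 0" and uu: "u \<bullet> u = 1"
    and xs: "length xs = k * 2" "set xs \<subseteq> h"
  shows "wedge_power 2 \<omega> (Suc k) (u # J u # xs) = real (Suc k) * wedge_power 2 \<omega> k xs"
  using xs
proof (induction k arbitrary: xs)
  case 0
  note C = wedge_Cons[OF alternating_fundamental_form alternating_wedge_power, of "J u # xs" 0 u]
  have a1: "alternating 1 (contract u \<omega>)" using alternating_fundamental_form by (simp add: numeral_2_eq_2)
  have w: "\<omega> [u, J u] = 1" by (simp add: fundamental_form_def uu)
  show ?case using C 0 wedge_Cons[OF a1 alternating_wedge_power, of "[]" 0 "J u"]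
      wedge_0[of 0 "\<lambda>xs :: 'a list. 1" "[]"]
    by (simp add: w)
next
  case (Suc k)
  let ?f = "wedge_power 2 \<omega> (Suc k)"
  have w: "\<omega> [u, J u] = 1" by (simp add: fundamental_form_def uu)
  have af: "alternating (Suc k * 2) ?f" by (rule alternating_wedge_power)
  have a1: "alternating 1 (contract u \<omega>)" using alternating_fundamental_form by (simp add: numeral_2_eq_2)
  have afu: "alternating (Suc (k * 2)) (contract u ?f)" using af by simp
  have l: "length xs = Suc (Suc (k * 2))" using Suc.prems by simp
  have 1: "wedge 1 (Suc k * 2) (contract u \<omega>) ?f (J u # xs) = ?f xs"
  proof -
    have "wedge 1 (Suc (k * 2)) (contract u \<omega>) (contract (J u) ?f) xs = 0"
      by (rule wedge_zero_left) (use l Suc.prems u in \<open>auto simp: fundamental_form_def length_Suc_conv\<close>)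
    then show ?thesis
      using wedge_Cons[OF a1 af, of xs "J u"] wedge_0[OF af, of xs "contract (J u) (contract u \<omega>)"] l
      by (simp add: w del: wedge_power.simps)
  qed
  have 2: "wedge 2 (Suc (k * 2)) \<omega> (contract u ?f) (J u # xs) = real (Suc k) * ?f xs"
  proof -
    have "wedge 1 (Suc (k * 2)) (contract (J u) \<omega>) (contract u ?f) xs = 0"
      by (rule wedge_zero_left) (use l Suc.prems u in \<open>auto simp: fundamental_form_def length_Suc_conv\<close>)
    moreover have "wedge 2 (k * 2) \<omega> (contract (J u) (contract u ?f)) xs =
        wedge 2 (k * 2) \<omega> (\<lambda>ys. real (Suc k) * wedge_power 2 \<omega> k ys) xs"
      by (rule wedge_cong) (use l Suc.prems Suc.IH in auto)
    moreover have "\<dots> = real (Suc k) * ?f xs"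
      by (simp add: wedge_def sum_distrib_left mult_ac)
    ultimately show ?thesis
      using wedge_Cons[OF alternating_fundamental_form afu, of xs "J u"] l by simp
  qed
  show ?case
    using wedge_Cons[OF alternating_fundamental_form af, of "J u # xs" u] 1 2 l
    by (simp add: algebra_simps)
qed

end

context herm_lie
begin

text \<open>
  The form \<open>d\<omega>\<^bsup>m+1\<^esup>\<close> is evaluated on lists with all arguments in \<open>h\<close>, and on such lists preceded by
  \<open>u\<close>, by \<open>Ju\<close>, or by both. In the first case the degree exceeds the dimension of \<open>h\<close>; in the two
  middle cases Cartan's formula leaves the trace of \<open>ad\<^sub>u\<close> or \<open>ad\<^bsub>Ju\<^esub>\<close>; in the last one the value
  is \<open>(m+1) d\<omega>\<^sub>h\<^sup>m\<close>.
\<close>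

lemma ce_d_wedge_power_vanishes_iff:
  assumes h: "subspace h" "\<And>x y. br x y \<in> h" and dh: "dim h = Suc m * 2" and uni: "unimodular br" 
    and u: "\<And>x. x \<in> h \<Longrightarrow> u \<bullet> x = 0" "\<And>x. x \<in> h \<Longrightarrow> J u \<bullet> x = 0" "norm u = 1" "br u (J u) = 0"
    and dec: "\<And>x. \<exists>y\<in>h. \<exists>a b. x = y + a *\<^sub>R u + b *\<^sub>R J u"
  shows "form_vanishes_on UNIV (Suc (Suc m * 2)) (ce_d br (wedge_power 2 \<omega> (Suc m))) \<longleftrightarrow>
     form_vanishes_on h (Suc (m * 2)) (ce_d br (wedge_power 2 \<omega> m))"
proof -
  define \<Omega> where "\<Omega> = wedge_power 2 \<omega> (Suc m)"
  have a\<Omega>: "alternating (Suc m * 2) \<Omega>" unfolding \<Omega>_def by (rule alternating_wedge_power)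
  then have a\<Omega>': "alternating (Suc (Suc (m * 2))) \<Omega>" by simp
  have ad: "alternating (Suc (Suc m * 2)) (ce_d br \<Omega>)"
    by (rule alternating_ce_d[OF bilinear_br br_self a\<Omega>])
  obtain B where B: "B \<subseteq> h" "pairwise orthogonal B" "\<And>x. x \<in> B \<Longrightarrow> norm x = 1"
    "independent B" "card B = dim h" "span B = h"
    using orthonormal_basis_subspace[OF h(1)] by metis
  have fB: "finite B" using B(4) by (rule independent_imp_finite)
  obtain es where es: "set es = B" "distinct es" using finite_distinct_list[OF fB] by blast
  have les: "length es = Suc m * 2" using distinct_card[OF es(2)] es(1) B(5) dh by simp
  have uu: "u \<bullet> u = 1" "J u \<bullet> u = 0" "u \<bullet> J u = 0" 
    using u(3) fundamental_form_self[of u] by (simp_all add: dot_square_norm inner_commute)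
  have full: "span (insert (J u) (insert u h)) = UNIV"
  proof (intro equalityI subset_UNIV subsetI)
    fix x
    obtain y a b where "x = y + a *\<^sub>R u + b *\<^sub>R J u" "y \<in> h" using dec by blast
    then show "x \<in> span (insert (J u) (insert u h))"
      by (auto intro!: span_add span_scale intro: span_base)
  qed
  have trace: "(\<Sum>e\<in>B. br w e \<bullet> e) = 0" for w
  proof -
    let ?B = "insert u (insert (J u) B)"
    have nB: "u \<notin> insert (J u) B" "J u \<notin> B"
    proof -
      have "u \<noteq> J u" using uu by auto
      moreover have "u \<notin> B" using u(1)[of u] uu B(1) by auto
      ultimately show "u \<notin> insert (J u) B" by simp
      show "J u \<notin> B" using u(2)[of "J u"] uu B(1) by auto
    qed
    have "endo_trace (br w) = (\<Sum>b\<in>?B. br w b \<bullet> b)"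
    proof (rule endo_trace_orthonormal_basis[OF linear_br_right])
      show "pairwise orthogonal ?B"
        using B(1,2) u(1,2) uu by (auto simp: pairwise_insert orthogonal_def inner_commute)
      show "span ?B = UNIV"
      proof -
        have "h \<subseteq> span ?B" using B(6) span_mono[of B ?B] by blast
        then have "insert (J u) (insert u h) \<subseteq> span ?B" by (auto intro: span_base)
        then show ?thesis using full span_mono[of "insert (J u) (insert u h)" "span ?B"] by (simp add: span_span top_le)
      qed
    qed (use fB B(3) u(3) in auto)
    moreover have "br w u \<bullet> u = 0" "br w (J u) \<bullet> J u = 0"
      using u(1)[OF h(2)] u(2)[OF h(2)] by (simp_all add: inner_commute)
    ultimately have "endo_trace (br w) = (\<Sum>e\<in>B. br w e \<bullet> e)" using nB fB by simp
    then show ?thesis using uni by (simp add: unimodular_def)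
  qed
  have L0: "lie_derivative_sum (br w) \<Omega> xs = 0" if "length xs = Suc m * 2" "set xs \<subseteq> h" for w xs
  proof (rule lie_derivative_sum_trace_free[where es = es])
    show "alternating (length es) \<Omega>" using a\<Omega> les by simp
    show "br w e \<in> span (set es)" for e using h(2) B(6) es(1) by simp
    show "(\<Sum>e\<in>set es. br w e \<bullet> e) = 0" using trace es(1) by simp
  qed (use es B linear_br_right les that in auto)
  have n1: "\<Omega> (u # xs) = 0" "\<Omega> (J u # xs) = 0" if "Suc (length xs) = Suc m * 2" "set xs \<subseteq> h" for xs
    using wedge_power_normal[of h u xs "Suc m"] wedge_power_normal[of h "J u" xs "Suc m"] u(1,2) that
    unfolding \<Omega>_def by auto
  have hset: "set xs \<union> {br x y |x y. x \<in> set xs \<and> y \<in> set xs} \<subseteq> h" "set xs \<union> br w ` set xs \<subseteq> h"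
    if "set xs \<subseteq> h" for xs w using that h(2) by auto
  have one: "ce_d br \<Omega> (w # xs) = 0"
    if "w = u \<or> w = J u" "length xs = Suc m * 2" "set xs \<subseteq> h" for w xs
  proof -
    have "ce_d br (contract w \<Omega>) xs = 0"
    proof (rule ce_d_zero)
      fix ys assume ys: "Suc (length ys) = length xs"
        "set ys \<subseteq> set xs \<union> {br x y |x y. x \<in> set xs \<and> y \<in> set xs}"
      have "Suc (length ys) = Suc m * 2" "set ys \<subseteq> h"
        using ys(1) that(2) subset_trans[OF ys(2) hset(1)[OF that(3)]] by auto
      then show "\<Omega> (w # ys) = 0" using n1 that(1) by blast
    qed
    then show ?thesis using ce_d_Cons[of xs \<Omega> br w] a\<Omega> L0[OF that(2,3)] that(2) by simp
  qed
  have two: "ce_d br \<Omega> (u # J u # xs) = real (Suc m) * ce_d br (wedge_power 2 \<omega> m) xs"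
    if l: "length xs = Suc (m * 2)" and s: "set xs \<subseteq> h" for xs
  proof -
    \<comment> \<open>the bracket of \<open>u\<close> and \<open>Ju\<close> vanishes and produces this argument\<close>
    have "\<Omega> (0 # xs) = 0" using linear_0[OF alternating_linear[OF a\<Omega>' l]] .
    moreover have "lie_derivative_sum (br u) (contract (J u) \<Omega>) xs = 0"
      "lie_derivative_sum (br (J u)) (contract u \<Omega>) xs = 0"
      by (rule lie_derivative_sum_zero, rule n1, use l in simp, use hset(2)[OF s] in blast)+
    ultimately have "ce_d br \<Omega> (u # J u # xs) = ce_d br (\<lambda>ys. \<Omega> (u # J u # ys)) xs"
      using ce_d_Cons[of "J u # xs" \<Omega> br u] ce_d_Cons[of xs "contract u \<Omega>" br "J u"] a\<Omega>' l u(4)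
      by (simp add: lie_derivative_sum_Cons)
    moreover have "ce_d br (\<lambda>ys. \<Omega> (u # J u # ys) - real (Suc m) * wedge_power 2 \<omega> m ys) xs = 0"
    proof (rule ce_d_zero)
      fix ys assume ys: "Suc (length ys) = length xs"
        "set ys \<subseteq> set xs \<union> {br x y |x y. x \<in> set xs \<and> y \<in> set xs}"
      have "length ys = m * 2" "set ys \<subseteq> h"
        using ys(1) l subset_trans[OF ys(2) hset(1)[OF s]] by auto
      from wedge_power_normal_plane[OF u(2,1) uu(1) this]
      show "\<Omega> (u # J u # ys) - real (Suc m) * wedge_power 2 \<omega> m ys = 0" by (simp add: \<Omega>_def)
    qed
    ultimately show ?thesis by (simp add: ce_d_diff)
  qed
  have zero: "ce_d br \<Omega> xs = 0" if "length xs = Suc (Suc m * 2)" "set xs \<subseteq> h" for xs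
    by (rule alternating_vanish_span[OF ad, of es]) (use les that es(1) B(6) in auto)
  have sh: "span h = h" using h(1) by (simp add: span_eq_iff)
  show ?thesis unfolding \<Omega>_def[symmetric] form_vanishes_on_def
  proof (intro iffI allI impI)
    fix xs assume "\<forall>xs. length xs = Suc (Suc m * 2) \<and> set xs \<subseteq> UNIV \<longrightarrow> ce_d br \<Omega> xs = 0"
      and "length xs = Suc (m * 2) \<and> set xs \<subseteq> h"
    then show "ce_d br (wedge_power 2 \<omega> m) xs = 0" using two[of xs] by simp
  next
    fix xs :: "'a list"
    assume H: "\<forall>xs. length xs = Suc (m * 2) \<and> set xs \<subseteq> h \<longrightarrow> ce_d br (wedge_power 2 \<omega> m) xs = 0"
      and xs: "length xs = Suc (Suc m * 2) \<and> set xs \<subseteq> UNIV"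
    show "ce_d br \<Omega> xs = 0"
    proof (rule alternating_vanish_insert[OF ad, where S = "insert u h" and u = "J u"])
      show "ce_d br \<Omega> ys = 0" if "length ys = Suc (Suc m * 2)" "set ys \<subseteq> span (insert u h)" for ys
        by (rule alternating_vanish_insert[OF ad _ _ that]) (use zero one sh in auto)
      show "ce_d br \<Omega> (J u # ys) = 0"
        if "Suc (length ys) = Suc (Suc m * 2)" "set ys \<subseteq> span (insert u h)" for ys
      proof (rule alternating_vanish_insert[OF alternating_contract[OF ad] _ _ _ that(2)])
        show "length ys = Suc m * 2" using that by simp
        show "ce_d br \<Omega> (J u # zs) = 0" if "length zs = Suc m * 2" "set zs \<subseteq> span h" for zs
          using one that sh by simp
        show "ce_d br \<Omega> (J u # u # zs) = 0" if "Suc (length zs) = Suc m * 2" "set zs \<subseteq> span h" for zs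
        proof -
          have "ce_d br \<Omega> (J u # u # zs) = - ce_d br \<Omega> (u # J u # zs)"
            by (rule alternating_swap[of "Suc (m * 2)"]) (use ad that in auto)
          then show ?thesis using two[of zs] H that sh by simp
        qed
      qed
    qed (use xs full in auto)
  qed
qed

end

section \<open>Almost Hermitian Lie algebras with nilradical of codimension two\<close>

theorem theorem2p1:
  fixes br :: "'a::euclidean_space \<Rightarrow> 'a \<Rightarrow> 'a"
    and J A B :: "'a \<Rightarrow> 'a"
    and h :: "'a set"
    and U :: 'a
    and n :: nat
  assumes "lie_algebra br"
    and "lie_solvable br UNIV"
    and "DIM('a) = 2 * n"
    and "is_nilradical br h"
    and "dim h + 2 = DIM('a)"
    and "almost_hermitian_on UNIV J"
    and "J ` h = h"
    and "norm U = 1" and "norm (J U) = 1" and "orthogonal U (J U)"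
    and "span {U, J U} = h\<^sup>\<bottom>"
    and "\<And>X. X \<in> h \<Longrightarrow> A X = br U X"
    and "\<And>X. X \<in> h \<Longrightarrow> B X = br (J U) X"
  shows "(complex_structure_on br UNIV J \<longleftrightarrow>
            complex_structure_on br h J \<and>
            (\<forall>X\<in>h. commutator J A (J X) + commutator J B X = 0))
       \<and> (complex_structure_on br UNIV J \<longrightarrow> chern_ricci_flat br J)
       \<and> (complex_structure_on br UNIV J \<and> unimodular br \<and> br U (J U) = 0 \<longrightarrow>
            (balanced_on br UNIV J \<longleftrightarrow> balanced_on br h J))
       \<and> (complex_structure_on br UNIV J \<and> skt_on br UNIV J \<longrightarrow>
            at_most_step_nilpotent br h 2 \<and>
            A \<in> so_on (lie_center br h) \<and> B \<in> so_on (lie_center br h) \<and>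
            endo_on (lie_center br h) J \<and>
            (\<forall>X\<in>lie_center br h. commutator A J X = 0) \<and>
            (\<forall>X\<in>lie_center br h. commutator B J X = 0))"
proof -
  interpret almost_herm_lie br J
    by (unfold_locales) (use assms in auto)
  have idl: "lie_ideal br h" and nil: "lie_nilpotent br h"
    using assms(4) by (auto simp: is_nilradical_def)
  have sh: "subspace h" using idl by (simp add: lie_ideal_def)
  have Jh: "J x \<in> h" if "x \<in> h" for x using assms(7) that by blast
  have perp: "U \<bullet> x = 0" "J U \<bullet> x = 0" if "x \<in> h" for x
  proof -
    have "U \<in> h\<^sup>\<bottom>" "J U \<in> h\<^sup>\<bottom>" unfolding assms(11)[symmetric] by (auto intro: span_base)
    then show "U \<bullet> x = 0" "J U \<bullet> x = 0" using that
      by (auto simp: orthogonal_comp_def orthogonal_def inner_commute)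
  qed
  have dec: "\<exists>y\<in>h. \<exists>a b. x = y + a *\<^sub>R U + b *\<^sub>R J U" for x
  proof -
    obtain y z where yz: "y \<in> span h" "\<And>w. w \<in> span h \<Longrightarrow> orthogonal z w" "x = y + z"
      using orthogonal_subspace_decomp_exists[of h x] by metis
    then have "z \<in> h\<^sup>\<bottom>" by (auto simp: orthogonal_comp_def orthogonal_commute span_base)
    then have "z \<in> span {U, J U}" using assms(11) by simp
    then obtain a b where "z = a *\<^sub>R U + b *\<^sub>R J U"
      by (auto simp: span_insert span_singleton algebra_simps)
    then show ?thesis using yz span_eq_iff[of h] sh by (metis add.assoc)
  qed
  have der: "br x y \<in> h" for x y
    by (rule nilradical_contains_derived[OF assms(4) dec])
  have nij: "nijenhuis br J U X = commutator J A (J X) + commutator J B X" if "X \<in> h" for X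
    using that Jh[OF that] subspace_neg[OF sh that]
    by (simp add: nijenhuis_def commutator_def assms(12,13) br_simps J_simps)
  have i: "complex_structure_on br UNIV J \<longleftrightarrow> complex_structure_on br h J \<and>
      (\<forall>X\<in>h. commutator J A (J X) + commutator J B X = 0)"
  proof -
    have "almost_complex_on V J" if "\<And>x. x \<in> V \<Longrightarrow> J x \<in> V" for V
      using that by (auto simp: almost_complex_on_def endo_on_def J_simps)
    then show ?thesis
      using nijenhuis_vanishes_iff[OF dec] nij Jh by (auto simp: complex_structure_on_def)
  qed
  have herm: "herm_lie br J" if "complex_structure_on br UNIV J"
    using that by unfold_locales (auto simp: complex_structure_on_def)
  have ii: "chern_ricci_flat br J" if "complex_structure_on br UNIV J"
    using herm_lie.chern_ricci_flat_if_derived_in_nilpotent_ideal[OF herm[OF that] idl nil Jh der] .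
  have iii: "balanced_on br UNIV J \<longleftrightarrow> balanced_on br h J"
    if c: "complex_structure_on br UNIV J" and uni: "unimodular br" and UV: "br U (J U) = 0"
  proof -
    interpret herm_lie br J by (rule herm[OF c])
    obtain k where n: "n = Suc k" using assms(3,5) by (cases n) auto
    have dims: "dim h = k * 2" using assms(3,5) n by simp
    have "form_vanishes_on UNIV (2 * (n - 1) + 1) (ce_d br (wedge_power 2 \<omega> (n - 1))) \<longleftrightarrow>
        form_vanishes_on h (2 * (k - 1) + 1) (ce_d br (wedge_power 2 \<omega> (k - 1)))"
    proof (cases k)
      case 0
      \<comment> \<open>if \<open>h = 0\<close> both conditions concern differentials of constants\<close>
      have "form_vanishes_on V 1 (ce_d br \<alpha>)" for V and \<alpha> :: "'a form"
        by (auto simp: form_vanishes_on_def ce_d_def length_Suc_conv)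
      then show ?thesis using n 0 by simp
    next
      case (Suc m)
      then show ?thesis
        using ce_d_wedge_power_vanishes_iff[OF sh der, of m U] dims uni perp assms(8) UV dec n
        by (simp add: mult.commute)
    qed
    then show ?thesis
      using hermitian hermitian_on_subspace[OF Jh] n dims assms(3) by (simp add: balanced_on_def)
  qed
  have iv: "at_most_step_nilpotent br h 2 \<and>
      A \<in> so_on (lie_center br h) \<and> B \<in> so_on (lie_center br h) \<and> endo_on (lie_center br h) J \<and>
      (\<forall>X\<in>lie_center br h. commutator A J X = 0) \<and> (\<forall>X\<in>lie_center br h. commutator B J X = 0)"
    if c: "complex_structure_on br UNIV J" and skt: "skt_on br UNIV J"
  proof -
    interpret skt_lie br J
      using herm[OF c] skt by (simp add: skt_lie_def skt_lie_axioms_def)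
    have hc: "complex_subalgebra h" unfolding complex_subalgebra_def using sh der Jh by blast
    let ?z = "lie_center br h"
    have zh: "?z \<subseteq> h" by (auto simp: lie_center_def)
    have Jz: "J x \<in> ?z" if "x \<in> ?z" for x by (rule J_center[OF hc nil that])
    have sz: "subspace ?z" using sh by (auto simp: lie_center_def subspace_def br_simps)
    have z0: "br x y = 0" "br y x = 0" if "x \<in> ?z" "y \<in> h" for x y
      using that br_anti[of y x] by (auto simp: lie_center_def)
    have gz: "br e x \<in> ?z" if "x \<in> ?z" for e x
    proof -
      have "br (br e x) y = 0" if "y \<in> h" for y
        using jacobi[of e x y] z0[OF \<open>x \<in> ?z\<close>] der that by (simp add: br_simps)
      then show ?thesis using der by (simp add: lie_center_def)
    qed
    have AB: "A x = br U x" "B x = br (J U) x" if "x \<in> ?z" for x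
      using that zh assms(12,13) by auto
    note skew = skew_on_abelian[of ?z U, OF sz Jz z0(1)[OF _ subsetD[OF zh]] gz gz z0(2)[OF _ der]
        z0(2)[OF _ Jh[OF der]]]
    have "A \<in> so_on ?z" "B \<in> so_on ?z"
      using skew(3,4) gz AB subspace_add[OF sz] subspace_scale[OF sz]
      by (auto simp: so_on_def endo_on_def br_simps)
    moreover have "endo_on ?z J" using Jz by (auto simp: endo_on_def J_simps)
    ultimately show ?thesis
      using skt_nilpotent_two_step[OF hc nil] skew(1,2) AB Jz by (simp add: commutator_def)
  qed
  show ?thesis using i ii iii iv by blast
qed

end
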